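(* Let $G$ be a compact Lie group and $H \subset G$ a compact Lie subgroup, with Lie algebras $\mathfrak{h} \subset \mathfrak{g}$. Let $Q$ be a biinvariant inner product on $\mathfrak{g}$, and for $t > 0$ let $g_t$ be the left invariant metric on $G$ induced by the inner product $$Q_t := t\, Q|_{\mathfrak{h}} + Q|_{\mathfrak{h}^\perp}$$ on $\mathfrak{g}$. If there is a $t > 1$ such that $g_t$ has non-negative sectional curvature, then the semi-simple part of $\mathfrak{h}$ is an ideal of $\mathfrak{g}$.
   Context: A biinvariant inner product on $\mathfrak{g}$ is a (positive definite) inner product invariant under the adjoint action of $G$; equivalently, the left invariant Riemannian metric on $G$ it induces is biinvariant. $\mathfrak{h}^\perp$ is the $Q$-orthogonal complement of $\mathfrak{h}$ in $\mathfrak{g}$. The inner product $Q_t = t\,Q|_{\mathfrak{h}} + Q|_{\mathfrak{h}^\perp}$ is the one for which $\mathfrak{h}$ and $\mathfrak{h}^\perp$ are orthogonal, which equals $tQ$ on $\mathfrak{h}$ and equals $Q$ on $\mathfrak{h}^\perp$. The left invariant metric induced by an inner product on $\mathfrak{g} = T_eG$ is the Riemannian metric on $G$ obtained by left translation. The Lie algebra $\mathfrak{h}$ decomposes as $\mathfrak{h} = \mathfrak{z}(\mathfrak{h}) \oplus \mathfrak{h}_1 \oplus \cdots \oplus \mathfrak{h}_r$ with $\mathfrak{z}(\mathfrak{h})$ the center and $\mathfrak{h}_k$ simple ideals; the semi-simple part of $\mathfrak{h}$ is $\mathfrak{h}_1 \oplus \cdots \oplus \mathfrak{h}_r = [\mathfrak{h},\mathfrak{h}]$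 (possibly zero). *)

theory Defs
  imports "HOL-Analysis.Analysis" "HOL-Algebra.Group"
begin

section \<open>Smooth maps between open subsets of normed spaces\<close>

text \<open>
  In finite dimension, \<open>C\<^sup>k\<close> is equivalent to the existence and continuity of the iterated
  directional derivatives below.  These notions are only used on open sets \<open>S\<close>.
\<close>

primrec Ck_on ::
  "nat \<Rightarrow> 'a::real_normed_vector set \<Rightarrow> ('a \<Rightarrow> 'b::real_normed_vector) \<Rightarrow> bool" where
  "Ck_on 0 S f \<longleftrightarrow> continuous_on S f"
| "Ck_on (Suc k) S f \<longleftrightarrow>
     (\<forall>x\<in>S. f differentiable (at x)) \<and> (\<forall>v. Ck_on k S (\<lambda>x. frechet_derivative f (at x) v))"

definition smooth_on ::
  "'a::real_normed_vector set \<Rightarrow> ('a \<Rightarrow> 'b::real_normed_vector) \<Rightarrow> bool" where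
  "smooth_on S f \<longleftrightarrow> (\<forall>k. Ck_on k S f)"


section \<open>Smooth manifolds\<close>

text \<open>
  A chart is a pair \<open>(U, \<phi>)\<close>; the values of \<open>\<phi>\<close> outside \<open>U\<close> are irrelevant.  The model space is
  a finite-dimensional inner product space.  The class \<open>euclidean_space\<close> is not used for it because
  it excludes dimension 0, that is, finite groups.
\<close>

type_synonym ('m, 'e) chart = "'m set \<times> ('m \<Rightarrow> 'e)"

definition is_chart :: "'m topology \<Rightarrow> ('m, 'e::real_inner) chart \<Rightarrow> bool" where
  "is_chart T c \<longleftrightarrow> openin T (fst c) \<and> open (snd c ` fst c) \<and>
     homeomorphic_map (subtopology T (fst c)) (top_of_set (snd c ` fst c)) (snd c)"

definition chart_inv :: "('m, 'e) chart \<Rightarrow> 'e \<Rightarrow> 'm" where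
  "chart_inv c = inv_into (fst c) (snd c)"

text \<open>The coordinate representation of \<open>f\<close>, meaningful on \<open>coord_dom c d f\<close>.\<close>

definition coord_rep ::
  "('m, 'e) chart \<Rightarrow> ('n, 'f) chart \<Rightarrow> ('m \<Rightarrow> 'n) \<Rightarrow> 'e \<Rightarrow> 'f" where
  "coord_rep c d f = snd d \<circ> f \<circ> chart_inv c"

definition coord_dom ::
  "('m, 'e) chart \<Rightarrow> ('n, 'f) chart \<Rightarrow> ('m \<Rightarrow> 'n) \<Rightarrow> 'e set" where
  "coord_dom c d f = snd c ` (fst c \<inter> f -` fst d)"

definition compatible_charts ::
  "('m, 'e::real_inner) chart \<Rightarrow> ('m, 'e) chart \<Rightarrow> bool" where
  "compatible_charts c d \<longleftrightarrow>
     smooth_on (coord_dom c d (\<lambda>p. p)) (coord_rep c d (\<lambda>p. p)) \<and>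
     smooth_on (coord_dom d c (\<lambda>p. p)) (coord_rep d c (\<lambda>p. p))"

text \<open>A smooth structure is a maximal smooth atlas.\<close>

definition smooth_structure ::
  "'m topology \<Rightarrow> ('m, 'e::real_inner) chart set \<Rightarrow> bool" where
  "smooth_structure T A \<longleftrightarrow>
     (\<forall>c\<in>A. is_chart T c) \<and> (\<Union>c\<in>A. fst c) = topspace T \<and>
     (\<forall>c\<in>A. \<forall>d\<in>A. compatible_charts c d) \<and>
     (\<forall>c. is_chart T c \<longrightarrow> (\<forall>d\<in>A. compatible_charts c d) \<longrightarrow> c \<in> A)"

definition smooth_manifold ::
  "'m topology \<Rightarrow> ('m, 'e::real_inner) chart set \<Rightarrow> bool" where
  "smooth_manifold T A \<longleftrightarrow>
     (\<exists>B::'e set. finite B \<and> span B = UNIV) \<and>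
     Hausdorff_space T \<and> second_countable T \<and> smooth_structure T A"

text \<open>\<open>A\<close> and \<open>B\<close> need only be atlases here, not maximal ones.\<close>

definition smooth_map ::
  "'m topology \<Rightarrow> ('m, 'e::real_inner) chart set \<Rightarrow>
   'n topology \<Rightarrow> ('n, 'f::real_inner) chart set \<Rightarrow> ('m \<Rightarrow> 'n) \<Rightarrow> bool" where
  "smooth_map T A S B f \<longleftrightarrow> continuous_map T S f \<and>
     (\<forall>c\<in>A. \<forall>d\<in>B. smooth_on (coord_dom c d f) (coord_rep c d f))"

definition prod_atlas ::
  "('m, 'e) chart set \<Rightarrow> ('n, 'f) chart set \<Rightarrow> ('m \<times> 'n, 'e \<times> 'f) chart set" where
  "prod_atlas A B = {(fst c \<times> fst d, map_prod (snd c) (snd d)) |c d. c \<in> A \<and> d \<in> B}"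

text \<open>
  The differential of \<open>f\<close> at \<open>p\<close>, with the tangent spaces at \<open>p\<close> and \<open>f p\<close> identified with the model
  spaces through the charts \<open>c\<close> around \<open>p\<close> and \<open>d\<close> around \<open>f p\<close>.
\<close>

definition tangent_map ::
  "('m, 'e::real_inner) chart \<Rightarrow> ('n, 'f::real_inner) chart \<Rightarrow> ('m \<Rightarrow> 'n) \<Rightarrow> 'm \<Rightarrow> 'e \<Rightarrow> 'f" where
  "tangent_map c d f p = frechet_derivative (coord_rep c d f) (at (snd c p))"

text \<open>Every point of \<open>H\<close> has a slice chart.\<close>

definition embedded_submanifold ::
  "'m topology \<Rightarrow> ('m, 'e::real_inner) chart set \<Rightarrow> 'm set \<Rightarrow> bool" where
  "embedded_submanifold T A H \<longleftrightarrow> H \<subseteq> topspace T \<and>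
     (\<forall>p\<in>H. \<exists>c\<in>A. \<exists>S. p \<in> fst c \<and> subspace S \<and> snd c ` (fst c \<inter> H) = snd c ` fst c \<inter> S)"

text \<open>
  The tangent space at \<open>p\<close> of an embedded submanifold \<open>H\<close>, as a subspace of the tangent space of the
  ambient manifold, identified with the model space through the chart \<open>c\<close> around \<open>p\<close>: the
  velocities of smooth curves lying in \<open>H\<close>.
\<close>

definition tangent_space_of ::
  "('m, 'e::real_inner) chart \<Rightarrow> 'm set \<Rightarrow> 'm \<Rightarrow> 'e set" where
  "tangent_space_of c H p = {v. \<exists>\<gamma>::real \<Rightarrow> 'm. \<exists>\<epsilon>>0. \<gamma> 0 = p \<and>
     \<gamma> ` {-\<epsilon><..<\<epsilon>} \<subseteq> H \<inter> fst c \<and> smooth_on {-\<epsilon><..<\<epsilon>} (snd c \<circ> \<gamma>) \<and>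
     ((snd c \<circ> \<gamma>) has_vector_derivative v) (at 0)}"


section \<open>Curvature of a Riemannian metric in coordinates\<close>

text \<open>
  Here \<open>g x v w\<close> is the inner product of the tangent vectors \<open>v\<close>, \<open>w\<close> at the point with
  coordinates \<open>x\<close>, and vectors are extended to constant vector fields in the chart.
  \<open>metric_deriv g x u v w\<close> is the derivative of \<open>g(v,w)\<close> in direction \<open>u\<close>, and
  \<open>christoffel g x u v\<close> is the covariant derivative \<open>\<nabla>\<^sub>u v\<close> of the Levi-Civita connection, given by
  the Koszul formula.
\<close>

type_synonym 'e local_metric = "'e \<Rightarrow> 'e \<Rightarrow> 'e \<Rightarrow> real"

definition metric_deriv ::
  "'e::real_inner local_metric \<Rightarrow> 'e \<Rightarrow> 'e \<Rightarrow> 'e \<Rightarrow> 'e \<Rightarrow> real" where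
  "metric_deriv g x u v w = frechet_derivative (\<lambda>y. g y v w) (at x) u"

definition christoffel :: "'e::real_inner local_metric \<Rightarrow> 'e \<Rightarrow> 'e \<Rightarrow> 'e \<Rightarrow> 'e" where
  "christoffel g x u v = (THE z. \<forall>w.
     2 * g x z w = metric_deriv g x u v w + metric_deriv g x v u w - metric_deriv g x w u v)"

text \<open>\<open>R(u,v)w = \<nabla>\<^sub>u \<nabla>\<^sub>v w - \<nabla>\<^sub>v \<nabla>\<^sub>u w\<close>, as constant vector fields commute.\<close>

definition curvature_tensor ::
  "'e::real_inner local_metric \<Rightarrow> 'e \<Rightarrow> 'e \<Rightarrow> 'e \<Rightarrow> 'e \<Rightarrow> 'e" where
  "curvature_tensor g x u v w =
     frechet_derivative (\<lambda>y. christoffel g y v w) (at x) u + christoffel g x u (christoffel g x v w)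
   - (frechet_derivative (\<lambda>y. christoffel g y u w) (at x) v + christoffel g x v (christoffel g x u w))"

definition sectional_curvature :: "'e::real_inner local_metric \<Rightarrow> 'e \<Rightarrow> 'e \<Rightarrow> 'e \<Rightarrow> real" where
  "sectional_curvature g x u v =
     g x (curvature_tensor g x u v v) u / (g x u u * g x v v - (g x u v)\<^sup>2)"

text \<open>A Riemannian metric on a manifold is given by its coordinate expression \<open>g d\<close> in each chart \<open>d\<close>.\<close>

definition nonneg_sectional_curvature ::
  "('m, 'e::real_inner) chart set \<Rightarrow> (('m, 'e) chart \<Rightarrow> 'e local_metric) \<Rightarrow> bool" where
  "nonneg_sectional_curvature A g \<longleftrightarrow>
     (\<forall>d\<in>A. \<forall>x\<in>snd d ` fst d. \<forall>u v. u \<noteq> v \<and> independent {u, v} \<longrightarrow>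
        sectional_curvature (g d) x u v \<ge> 0)"


section \<open>Lie groups\<close>

definition lie_group ::
  "('m, 'b) monoid_scheme \<Rightarrow> 'm topology \<Rightarrow> ('m, 'e::real_inner) chart set \<Rightarrow> bool" where
  "lie_group G T A \<longleftrightarrow> group G \<and> topspace T = carrier G \<and> smooth_manifold T A \<and>
     smooth_map (prod_topology T T) (prod_atlas A A) T A (\<lambda>(a, b). a \<otimes>\<^bsub>G\<^esub> b) \<and>
     smooth_map T A T A (\<lambda>a. inv\<^bsub>G\<^esub> a)"

text \<open>
  For a subgroup that is compact in its own Lie group topology, being embedded is no restriction
  compared with being immersed.
\<close>

definition compact_lie_subgroup ::
  "('m, 'b) monoid_scheme \<Rightarrow> 'm topology \<Rightarrow> ('m, 'e::real_inner) chart set \<Rightarrow> 'm set \<Rightarrow> bool" where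
  "compact_lie_subgroup G T A H \<longleftrightarrow>
     subgroup H G \<and> embedded_submanifold T A H \<and> compactin T H"

text \<open>
  In the following, \<open>c\<close> is a chart around the identity element.  It identifies the Lie algebra of
  \<open>G\<close>, i.e. the tangent space at the identity, with the model space.

  \<open>left_invariant_field G c v\<close> is the coordinate expression in \<open>c\<close> of the left invariant vector
  field \<open>a \<mapsto> d(L\<^sub>a) v\<close>, and \<open>lie_bracket\<close> is the commutator of left invariant vector fields,
  evaluated at the identity.
\<close>

definition left_invariant_field ::
  "('m, 'b) monoid_scheme \<Rightarrow> ('m, 'e::real_inner) chart \<Rightarrow> 'e \<Rightarrow> 'e \<Rightarrow> 'e" where
  "left_invariant_field G c v x = tangent_map c c (\<lambda>b. chart_inv c x \<otimes>\<^bsub>G\<^esub> b) \<one>\<^bsub>G\<^esub> v"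

definition lie_bracket ::
  "('m, 'b) monoid_scheme \<Rightarrow> ('m, 'e::real_inner) chart \<Rightarrow> 'e \<Rightarrow> 'e \<Rightarrow> 'e" where
  "lie_bracket G c u v =
     frechet_derivative (left_invariant_field G c v) (at (snd c \<one>\<^bsub>G\<^esub>)) u
   - frechet_derivative (left_invariant_field G c u) (at (snd c \<one>\<^bsub>G\<^esub>)) v"

definition Ad ::
  "('m, 'b) monoid_scheme \<Rightarrow> ('m, 'e::real_inner) chart \<Rightarrow> 'm \<Rightarrow> 'e \<Rightarrow> 'e" where
  "Ad G c a = tangent_map c c (\<lambda>b. a \<otimes>\<^bsub>G\<^esub> b \<otimes>\<^bsub>G\<^esub> inv\<^bsub>G\<^esub> a) \<one>\<^bsub>G\<^esub>"

definition lie_algebra_of ::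
  "('m, 'b) monoid_scheme \<Rightarrow> ('m, 'e::real_inner) chart \<Rightarrow> 'm set \<Rightarrow> 'e set" where
  "lie_algebra_of G c H = tangent_space_of c H \<one>\<^bsub>G\<^esub>"

definition lie_ideal ::
  "('m, 'b) monoid_scheme \<Rightarrow> ('m, 'e::real_inner) chart \<Rightarrow> 'e set \<Rightarrow> bool" where
  "lie_ideal G c I \<longleftrightarrow> subspace I \<and> (\<forall>x. \<forall>y\<in>I. lie_bracket G c x y \<in> I)"

text \<open>
  The semi-simple part \<open>\<hh>\<^sub>1 \<oplus> \<dots> \<oplus> \<hh>\<^sub>r = [\<hh>,\<hh>]\<close> of the Lie algebra \<open>\<hh>\<close> of a compact Lie group.
\<close>

definition semisimple_part ::
  "('m, 'b) monoid_scheme \<Rightarrow> ('m, 'e::real_inner) chart \<Rightarrow> 'e set \<Rightarrow> 'e set" where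
  "semisimple_part G c h = span {lie_bracket G c u v |u v. u \<in> h \<and> v \<in> h}"


section \<open>Left invariant metrics\<close>

definition inner_product :: "('e::real_vector \<Rightarrow> 'e \<Rightarrow> real) \<Rightarrow> bool" where
  "inner_product Q \<longleftrightarrow> bilinear Q \<and> (\<forall>u v. Q u v = Q v u) \<and> (\<forall>v. v \<noteq> 0 \<longrightarrow> Q v v > 0)"

definition biinvariant_inner_product ::
  "('m, 'b) monoid_scheme \<Rightarrow> ('m, 'e::real_inner) chart \<Rightarrow> ('e \<Rightarrow> 'e \<Rightarrow> real) \<Rightarrow> bool" where
  "biinvariant_inner_product G c Q \<longleftrightarrow> inner_product Q \<and>
     (\<forall>a\<in>carrier G. \<forall>u v. Q (Ad G c a u) (Ad G c a v) = Q u v)"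

definition orth_compl :: "('e \<Rightarrow> 'e \<Rightarrow> real) \<Rightarrow> 'e set \<Rightarrow> 'e set" where
  "orth_compl Q h = {v. \<forall>w\<in>h. Q v w = 0}"

definition orth_proj :: "('e::real_vector \<Rightarrow> 'e \<Rightarrow> real) \<Rightarrow> 'e set \<Rightarrow> 'e \<Rightarrow> 'e" where
  "orth_proj Q h v = (THE w. w \<in> h \<and> v - w \<in> orth_compl Q h)"

text \<open>The inner product \<open>Q\<^sub>t\<close>; note that \<open>v - orth_proj Q h v\<close> is the component of \<open>v\<close> in \<open>h\<^sup>\<bottom>\<close>.\<close>

definition rescaled_product ::
  "('e::real_vector \<Rightarrow> 'e \<Rightarrow> real) \<Rightarrow> 'e set \<Rightarrow> real \<Rightarrow> 'e \<Rightarrow> 'e \<Rightarrow> real" where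
  "rescaled_product Q h t u v =
     t * Q (orth_proj Q h u) (orth_proj Q h v) + Q (u - orth_proj Q h u) (v - orth_proj Q h v)"

text \<open>
  The coordinate expression in the chart \<open>d\<close> of the left invariant metric induced by the inner
  product \<open>P\<close> on the Lie algebra: vectors at \<open>a\<close> are moved to the identity by \<open>d(L\<^bsub>a\<^sup>-\<^sup>1\<^esub>)\<close>.
\<close>

definition left_invariant_metric ::
  "('m, 'b) monoid_scheme \<Rightarrow> ('m, 'e::real_inner) chart \<Rightarrow> ('e \<Rightarrow> 'e \<Rightarrow> real) \<Rightarrow>
   ('m, 'e) chart \<Rightarrow> 'e local_metric" where
  "left_invariant_metric G c P d x v w =
     (let a = chart_inv d x;
          dL = tangent_map d c (\<lambda>b. inv\<^bsub>G\<^esub> a \<otimes>\<^bsub>G\<^esub> b) a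
      in P (dL v) (dL w))"

end

theory Submission
  imports Defs
begin

text \<open>
  In a chart around the identity, the left Maurer--Cartan form turns the Levi-Civita connection of a
  left invariant metric into an algebraic expression in the bracket, so that the curvature
  condition at the identity is one on \<open>(\<gg>, [\<cdot>,\<cdot>], Q, \<hh>)\<close>. Let \<open>P\<close> be the
  \<open>Q\<close>-orthogonal projection onto \<open>\<hh>\<close>. For \<open>t > 1\<close>, non-negativity of the curvature implies
  \<open>|[P X, P Y]| \<le> K |[X, Y]|\<close> for some constant \<open>K\<close>. Suppose that \<open>[[\<hh>,\<hh>], \<hh>\<^sup>\<bottom>] \<noteq> 0\<close>. Then some
  simple ideal \<open>J\<close> of \<open>\<hh>\<close>, which inherits the inequality, does not commute with \<open>J\<^sup>\<bottom>\<close>. The inequality forces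
  the centralizer of \<open>A + \<xi>\<close>, for \<open>0 \<noteq> A \<in> J\<close> and \<open>0 \<noteq> \<xi> \<in> J\<^sup>\<bottom>\<close> orthogonal to the centralizer of \<open>J\<close>, to be
  one-dimensional in a suitable subalgebra that contains \<open>J\<close> and \<open>\<xi>\<close>. That subalgebra has rank one,
  hence dimension at most 3, which leaves no room for \<open>J\<close> and \<open>\<xi>\<close>.
\<close>

section \<open>Linear algebra in finite-dimensional inner product spaces\<close>

text \<open>The condition \<open>t > 1\<close> fixes the sign of one constant, the coefficient of
  |[P X, P Y]|^2 in the curvature; afterwards only the inequality between brackets is left. The
  inequality acts twice: commuting pairs project to commuting pairs, and pairs that commute up to
  second order yield a first-order identity. By this identity the projection to \<open>J\<close> of
  the centralizer of a vector X orthogonal to \<open>J\<close> is an ideal of \<open>J\<close>.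
  Simplicity leaves two cases: X commutes with \<open>J\<close>, or nothing that commutes with X has
  a component in \<open>J\<close>. The obstacle to a one-dimensional centralizer of A + \<xi> is
  what commutes with both \<open>J\<close> and \<xi>. It is removed by passing to the vectors that
  commute with a maximal commuting set of such elements and are orthogonal to that set. Minimal
  eigenvectors of quadratic forms take the place of roots, maximal commuting sets that of tori, and
  nonabelian ideals of least dimension that of simple factors. The semi-simple part is reached
  through the ideal of those elements of the subalgebra that commute with its normal space: the
  complement of this ideal is abelian.\<close>

locale inner_product_form =
  fixes Q :: "'e::real_vector \<Rightarrow> 'e \<Rightarrow> real"
  assumes Q: "inner_product Q"
begin

lemma bilinear_Q: "bilinear Q"
  using Q by (simp add: inner_product_def)

lemmas Q_simps =
  bilinear_ladd[OF bilinear_Q] bilinear_radd[OF bilinear_Q]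
  bilinear_lsub[OF bilinear_Q] bilinear_rsub[OF bilinear_Q]
  bilinear_lneg[OF bilinear_Q] bilinear_rneg[OF bilinear_Q]
  bilinear_lmul[OF bilinear_Q] bilinear_rmul[OF bilinear_Q]
  bilinear_lzero[OF bilinear_Q] bilinear_rzero[OF bilinear_Q]

lemma Q_commute: "Q x y = Q y x"
  using Q by (simp add: inner_product_def)

lemma Q_pos: "x \<noteq> 0 \<Longrightarrow> Q x x > 0"
  using Q by (simp add: inner_product_def)

lemma Q_nonneg: "Q x x \<ge> 0"
  using Q_pos[of x] by (cases "x = 0") (auto simp: Q_simps)

lemma Q_eq_0_iff: "Q x x = 0 \<longleftrightarrow> x = 0"
  using Q_pos[of x] by (cases "x = 0") (auto simp: Q_simps)

lemma Q_nondegenerate: "(\<And>z. Q x z = Q y z) \<Longrightarrow> x = y"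
  using Q_eq_0_iff[of "x - y"] by (simp add: Q_simps)

lemma Q_sum_left: "Q (sum f S) y = (\<Sum>x\<in>S. Q (f x) y)"
  using linear_sum[of "\<lambda>x. Q x y"] bilinear_Q by (simp add: bilinear_def)

text \<open>Gram--Schmidt. A vector that depends on the earlier ones leaves the residue 0 and is
  dropped, so any finite spanning set will do.\<close>

lemma orthonormal_basis_exists:
  assumes "finite B"
  obtains C where "finite C" "span C = span B" "\<And>c. c \<in> C \<Longrightarrow> Q c c = 1"
    "\<And>c d. c \<in> C \<Longrightarrow> d \<in> C \<Longrightarrow> c \<noteq> d \<Longrightarrow> Q c d = 0"
proof -
  have "\<exists>C. finite C \<and> span C = span B \<and> (\<forall>c\<in>C. \<forall>d\<in>C. Q c d = (if c = d then 1 else 0))"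
    using assms
  proof (induction B rule: finite_induct)
    case (insert a B)
    then obtain C where C: "finite C" "span C = span B"
      and on: "\<And>c d. c \<in> C \<Longrightarrow> d \<in> C \<Longrightarrow> Q c d = (if c = d then 1 else 0)"
      by blast
    define a' where "a' = a - (\<Sum>c\<in>C. Q a c *\<^sub>R c)"
    have s: "(\<Sum>c\<in>C. Q a c *\<^sub>R c) \<in> span C"
      by (intro span_sum span_scale span_base)
    have orth: "Q a' d = 0" if "d \<in> C" for d
      using that C(1) by (simp add: a'_def Q_simps Q_sum_left on if_distrib cong: if_cong)
    have sp: "span (insert a B) = span (insert a' C)"
    proof -
      have "span (insert a B) = span (insert a C)"
        by (simp add: span_insert C)
      also have "\<dots> = span (insert a' C)"
      proof (rule span_eq[THEN iffD2], intro conjI)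
        have "a = a' + (\<Sum>c\<in>C. Q a c *\<^sub>R c)" by (simp add: a'_def)
        then have "a \<in> span (insert a' C)"
          by (metis s span_add span_base insertI1 span_mono subset_insertI subsetD)
        then show "insert a C \<subseteq> span (insert a' C)"
          by (auto intro: span_base)
        have "a' \<in> span (insert a C)"
          unfolding a'_def
          by (metis s span_diff span_base insertI1 span_mono subset_insertI subsetD)
        then show "insert a' C \<subseteq> span (insert a C)"
          by (auto intro: span_base)
      qed
      finally show ?thesis .
    qed
    show ?case
    proof (cases "a' = 0")
      case True
      then have "span (insert a B) = span C" using sp by simp
      then show ?thesis using C on by (intro exI[of _ C]) simp
    next
      case False
      define u where "u = (1 / sqrt (Q a' a')) *\<^sub>R a'"
      have pos: "Q a' a' > 0" using Q_pos[OF False] .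
      have "Q u u = 1"
        using pos by (simp add: u_def Q_simps field_simps flip: real_sqrt_mult)
      moreover have ud: "Q u d = 0 \<and> Q d u = 0 \<and> d \<noteq> u" if "d \<in> C" for d
        using orth[OF that] Q_commute[of d u] on[OF that that] by (auto simp: u_def Q_simps)
      moreover have "span (insert a' C) = span (insert u C)"
      proof (rule span_eq[THEN iffD2], intro conjI)
        have "a' = sqrt (Q a' a') *\<^sub>R u" using pos by (simp add: u_def)
        then have "a' \<in> span (insert u C)"
          by (metis span_scale span_base insertI1)
        then show "insert a' C \<subseteq> span (insert u C)"
          by (auto intro: span_base)
        have "u \<in> span (insert a' C)"
          unfolding u_def by (intro span_scale span_base) simp
        then show "insert u C \<subseteq> span (insert a' C)"
          by (auto intro: span_base)
      qed
      ultimately show ?thesis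
        using C on sp
        by (intro exI[of _ "insert u C"]) force
    qed
  qed auto
  then obtain C where "finite C" "span C = span B"
    "\<forall>c\<in>C. \<forall>d\<in>C. Q c d = (if c = d then 1 else 0)" by blast
  then show thesis by (intro that[of C]) simp_all
qed

lemma orthonormal_expansion:
  assumes "finite C" "\<And>c. c \<in> C \<Longrightarrow> Q c c = 1"
    "\<And>c d. c \<in> C \<Longrightarrow> d \<in> C \<Longrightarrow> c \<noteq> d \<Longrightarrow> Q c d = 0"
    and "x \<in> span C"
  shows "(\<Sum>c\<in>C. Q x c *\<^sub>R c) = x"
  using \<open>x \<in> span C\<close>
proof (induction rule: span_induct_alt)
  case base
  then show ?case by (simp add: Q_simps)
next
  case (step a x y)
  have "(\<Sum>c\<in>C. Q x c *\<^sub>R c) = (\<Sum>c\<in>C. if c = x then x else 0)"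
    by (rule sum.cong) (use assms step in auto)
  also have "\<dots> = x" using step assms by simp
  finally show ?case
    using step by (simp add: Q_simps scaleR_add_left sum.distrib flip: scaleR_scaleR scaleR_right.sum)
qed

lemma subspace_orth_compl: "subspace (orth_compl Q V)"
  by (auto simp: orth_compl_def subspace_def Q_simps)

end

section \<open>Orthogonal complements and projections in finite dimension\<close>

lemma finite_span_subspaceE:
  fixes B V :: "'e::real_vector set"
  assumes "finite B" "span B = UNIV" "subspace V"
  obtains C where "finite C" "span C = V"
proof -
  obtain C where C: "C \<subseteq> V" "independent C" "V \<subseteq> span C"
    by (rule basis_exists)
  have "finite C"
    using independent_span_bound[of B C] C(2) assms by auto
  moreover have "span C = V"
    using C assms(3) by (simp add: span_minimal subset_antisym)
  ultimately show thesis by (rule that)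
qed

locale finite_inner_product_form = inner_product_form Q
  for Q :: "'e::real_vector \<Rightarrow> 'e \<Rightarrow> real" +
  assumes finite_dim: "\<exists>B::'e set. finite B \<and> span B = UNIV"
begin

lemma orthonormal_basis_subspace:
  assumes "subspace V"
  obtains C where "finite C" "span C = V" "\<And>c. c \<in> C \<Longrightarrow> Q c c = 1"
    "\<And>c d. c \<in> C \<Longrightarrow> d \<in> C \<Longrightarrow> c \<noteq> d \<Longrightarrow> Q c d = 0"
proof -
  obtain B where B: "finite B" "span B = V"
    using finite_span_subspaceE finite_dim assms by metis
  show thesis
    using orthonormal_basis_exists[OF B(1)] that unfolding B(2) by metis
qed

lemma orth_proj_ex1:
  assumes "subspace V"
  shows "\<exists>!w. w \<in> V \<and> x - w \<in> orth_compl Q V"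
proof -
  obtain C where C: "finite C" "span C = V" "\<And>c. c \<in> C \<Longrightarrow> Q c c = 1"
    "\<And>c d. c \<in> C \<Longrightarrow> d \<in> C \<Longrightarrow> c \<noteq> d \<Longrightarrow> Q c d = 0"
    by (rule orthonormal_basis_subspace[OF assms]) blast
  define w where "w = (\<Sum>c\<in>C. Q x c *\<^sub>R c)"
  have wV: "w \<in> V"
    unfolding w_def C(2)[symmetric] by (intro span_sum span_scale span_base)
  have "Q (x - w) d = 0" if "d \<in> C" for d
  proof -
    have "Q w d = (\<Sum>c\<in>C. if c = d then Q x d else 0)"
      unfolding w_def Q_sum_left Q_simps by (rule sum.cong) (use C that in auto)
    then show ?thesis using C(1) that by (simp add: Q_simps)
  qed
  then have "V \<subseteq> {d. Q (x - w) d = 0}"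
    unfolding C(2)[symmetric]
    by (intro span_minimal) (auto simp: subspace_def Q_simps)
  then have w: "x - w \<in> orth_compl Q V"
    by (auto simp: orth_compl_def)
  show ?thesis
  proof (rule ex1I[of _ w])
    fix v assume v: "v \<in> V \<and> x - v \<in> orth_compl Q V"
    then have "v - w \<in> V" using wV assms by (simp add: subspace_diff)
    then have "Q (x - w) (v - w) = 0" "Q (x - v) (v - w) = 0"
      using w v by (auto simp: orth_compl_def)
    then have "Q (v - w) (v - w) = 0" by (simp add: Q_simps)
    then show "v = w" using Q_eq_0_iff by simp
  qed (use w wV in simp)
qed

lemma
  assumes "subspace V"
  shows orth_proj_in: "orth_proj Q V x \<in> V"
    and orth_proj_diff: "x - orth_proj Q V x \<in> orth_compl Q V"
  using theI'[OF orth_proj_ex1[OF assms, of x]] unfolding orth_proj_def by auto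

lemma orth_proj_eqI:
  assumes "subspace V" "w \<in> V" "x - w \<in> orth_compl Q V"
  shows "orth_proj Q V x = w"
  using orth_proj_ex1[OF assms(1), of x] orth_proj_in[OF assms(1), of x]
    orth_proj_diff[OF assms(1), of x] assms by blast

lemma orth_proj_linear:
  assumes "subspace V"
  shows "linear (orth_proj Q V)"
proof (rule linearI)
  note sub = subspace_add subspace_scale
  have [simp]: "a + b \<in> orth_compl Q V" "r *\<^sub>R a \<in> orth_compl Q V"
    if "a \<in> orth_compl Q V" "b \<in> orth_compl Q V" for a b r
    using that sub[OF subspace_orth_compl] by auto
  fix x y :: 'e and r :: real
  let ?p = "orth_proj Q V"
  show "?p (x + y) = ?p x + ?p y"
  proof (rule orth_proj_eqI[OF assms])
    have "x + y - (?p x + ?p y) = (x - ?p x) + (y - ?p y)" by simp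
    then show "x + y - (?p x + ?p y) \<in> orth_compl Q V"
      by (metis orth_proj_diff[OF assms] subspace_add[OF subspace_orth_compl])
  qed (simp add: orth_proj_in assms subspace_add)
  show "?p (r *\<^sub>R x) = r *\<^sub>R ?p x"
  proof (rule orth_proj_eqI[OF assms])
    have "r *\<^sub>R x - r *\<^sub>R ?p x = r *\<^sub>R (x - ?p x)" by (simp add: scaleR_diff_right)
    then show "r *\<^sub>R x - r *\<^sub>R ?p x \<in> orth_compl Q V"
      by (metis orth_proj_diff[OF assms] subspace_scale[OF subspace_orth_compl])
  qed (simp add: orth_proj_in assms subspace_scale)
qed

lemma orth_proj_id: "subspace V \<Longrightarrow> x \<in> V \<Longrightarrow> orth_proj Q V x = x"
  by (rule orth_proj_eqI) (auto simp: orth_compl_def Q_simps)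

lemma orth_proj_eq_0: "subspace V \<Longrightarrow> x \<in> orth_compl Q V \<Longrightarrow> orth_proj Q V x = 0"
  by (rule orth_proj_eqI) (auto simp: subspace_0)

lemma Q_orth_proj_left:
  assumes "subspace V" "w \<in> V"
  shows "Q (orth_proj Q V x) w = Q x w"
  using orth_proj_diff[OF assms(1), of x] assms(2) by (simp add: orth_compl_def Q_simps)

lemma Q_orth_proj_right:
  assumes "subspace V" "w \<in> V"
  shows "Q w (orth_proj Q V x) = Q w x"
  using Q_orth_proj_left[OF assms] Q_commute by metis

lemma orth_compl_orth_compl:
  assumes "subspace V" "\<And>y. y \<in> orth_compl Q V \<Longrightarrow> Q x y = 0"
  shows "x \<in> V"
proof -
  have "x - orth_proj Q V x \<in> orth_compl Q V" by (rule orth_proj_diff[OF assms(1)])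
  moreover from this have "Q (orth_proj Q V x) (x - orth_proj Q V x) = 0"
    using orth_proj_in[OF assms(1), of x] Q_commute by (auto simp: orth_compl_def)
  ultimately have "Q (x - orth_proj Q V x) (x - orth_proj Q V x) = 0"
    using assms(2) by (simp add: Q_simps(3))
  then show ?thesis
    using Q_eq_0_iff orth_proj_in[OF assms(1), of x] by simp
qed

end

text \<open>The expansion identity makes every linear map a finite sum over \<open>B\<close> of
  scalar coordinates times fixed values, which reduces calculus with varying operators to products.
  An empty \<open>B\<close> gives dimension 0.\<close>

locale finite_dim_space =
  fixes B :: "'e::real_inner set"
  assumes finite_B: "finite B" and expand: "(\<Sum>b\<in>B. (x \<bullet> b) *\<^sub>R b) = x"

text \<open>Each further vector replaces the set by a continuous image of its product with [-1, 1].
  The box will contain the unit sphere of a subspace.\<close>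

lemma compact_coordinate_box:
  fixes C :: "'e::real_normed_vector set"
  assumes "finite C"
  shows "compact ((\<lambda>x. \<Sum>c\<in>C. x c *\<^sub>R c) ` {x. \<forall>c\<in>C. \<bar>x c :: real\<bar> \<le> 1})"
  using assms
proof (induction C rule: finite_induct)
  case empty
  then show ?case by simp
next
  case (insert a C)
  let ?K = "\<lambda>C::'e set. (\<lambda>x. \<Sum>c\<in>C. x c *\<^sub>R c) ` {x. \<forall>c\<in>C. \<bar>x c :: real\<bar> \<le> 1}"
  have "?K (insert a C) = (\<lambda>(t, y). t *\<^sub>R a + y) ` ({-1..1} \<times> ?K C)"
  proof (intro subset_antisym subsetI)
    fix y assume "y \<in> ?K (insert a C)"
    then obtain x where "\<forall>c\<in>insert a C. \<bar>x c :: real\<bar> \<le> 1" "y = (\<Sum>c\<in>insert a C. x c *\<^sub>R c)"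
      by blast
    then show "y \<in> (\<lambda>(t, y). t *\<^sub>R a + y) ` ({-1..1} \<times> ?K C)"
      using insert(1,2) by (intro image_eqI[of _ _ "(x a, \<Sum>c\<in>C. x c *\<^sub>R c)"]) auto
  next
    fix y assume "y \<in> (\<lambda>(t, y). t *\<^sub>R a + y) ` ({-1..1} \<times> ?K C)"
    then obtain t x where *: "t \<in> {-1..1}" "\<forall>c\<in>C. \<bar>x c :: real\<bar> \<le> 1"
      "y = t *\<^sub>R a + (\<Sum>c\<in>C. x c *\<^sub>R c)"
      by auto
    have "(\<Sum>c\<in>C. (x(a := t)) c *\<^sub>R c) = (\<Sum>c\<in>C. x c *\<^sub>R c)"
      by (rule sum.cong) (use insert(2) in auto)
    with * insert(1,2) show "y \<in> ?K (insert a C)"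
      by (intro image_eqI[of _ _ "x(a := t)"]) auto
  qed
  moreover have "compact ({-1..1::real} \<times> ?K C)"
    by (intro compact_Times insert.IH) simp
  ultimately show ?case
    by (auto simp: case_prod_unfold intro!: compact_continuous_image continuous_intros)
qed

lemma inner_product_inner: "inner_product (inner :: 'e::real_inner \<Rightarrow> 'e \<Rightarrow> real)"
  unfolding inner_product_def bilinear_def
  by (auto simp: inner_commute bounded_linear.linear bounded_linear_inner_left bounded_linear_inner_right)

lemma finite_dim_space_exists:
  fixes B :: "'e::real_inner set"
  assumes "finite B" "span B = UNIV"
  obtains C :: "'e set" where "finite_dim_space C"
proof -
  interpret inner_product_form "inner :: 'e \<Rightarrow> 'e \<Rightarrow> real"
    by standard (rule inner_product_inner)
  obtain C where C: "finite C" "span C = span B" "\<And>c. c \<in> C \<Longrightarrow> c \<bullet> c = 1"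
    "\<And>c d. c \<in> C \<Longrightarrow> d \<in> C \<Longrightarrow> c \<noteq> d \<Longrightarrow> c \<bullet> d = 0"
    by (rule orthonormal_basis_exists[OF assms(1)]) blast
  have "finite_dim_space C"
    by standard (use C orthonormal_expansion[OF C(1,3,4)] assms(2) in auto)
  then show thesis by (rule that)
qed

context finite_dim_space
begin

lemma span_B: "span B = UNIV"
proof -
  have "(\<Sum>b\<in>B. (x \<bullet> b) *\<^sub>R b) \<in> span B" for x
    by (intro span_sum span_scale span_base)
  then show ?thesis unfolding expand by auto
qed

lemma linear_expand: "linear f \<Longrightarrow> f x = (\<Sum>b\<in>B. (x \<bullet> b) *\<^sub>R f b)"
  using linear_sum[of f "\<lambda>b. (x \<bullet> b) *\<^sub>R b" B] by (simp add: expand linear_scale)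

lemma bilinear_imp_bounded:
  fixes f :: "'e \<Rightarrow> 'e \<Rightarrow> 'f::real_normed_vector"
  assumes "bilinear f"
  shows "bounded_bilinear f"
proof
  show "f (a + a') b = f a b + f a' b" "f a (b + b') = f a b + f a b'"
    "f (r *\<^sub>R a) b = r *\<^sub>R f a b" "f a (r *\<^sub>R b) = r *\<^sub>R f a b" for a a' b b' r
    using assms by (simp_all add: bilinear_ladd bilinear_radd bilinear_lmul bilinear_rmul)
  have "norm (f x y) \<le> norm x * norm y * (\<Sum>(b,c)\<in>B\<times>B. norm b * norm c * norm (f b c))" for x y
  proof -
    have "f x y = (\<Sum>(b,c)\<in>B\<times>B. f ((x \<bullet> b) *\<^sub>R b) ((y \<bullet> c) *\<^sub>R c))"
      using bilinear_sum[OF assms, of "\<lambda>b. (x \<bullet> b) *\<^sub>R b" B "\<lambda>b. (y \<bullet> b) *\<^sub>R b" B]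
      by (simp add: expand)
    also have "norm \<dots> \<le> (\<Sum>(b,c)\<in>B\<times>B. norm x * norm y * (norm b * norm c * norm (f b c)))"
    proof (rule sum_norm_le, clarify)
      fix b c
      have "norm (f ((x \<bullet> b) *\<^sub>R b) ((y \<bullet> c) *\<^sub>R c)) = (\<bar>x \<bullet> b\<bar> * \<bar>y \<bullet> c\<bar>) * norm (f b c)"
        using assms by (simp add: bilinear_lmul[OF assms] bilinear_rmul[OF assms] abs_mult)
      also have "\<dots> \<le> ((norm x * norm b) * (norm y * norm c)) * norm (f b c)"
        by (intro mult_mono Cauchy_Schwarz_ineq2) auto
      finally show "norm (f ((x \<bullet> b) *\<^sub>R b) ((y \<bullet> c) *\<^sub>R c))
          \<le> norm x * norm y * (norm b * norm c * norm (f b c))" by (simp add: mult_ac)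
    qed
    finally show ?thesis by (simp add: sum_distrib_left case_prod_unfold)
  qed
  then show "\<exists>K. \<forall>a b. norm (f a b) \<le> norm a * norm b * K" by blast
qed

text \<open>The eigenvector is a minimiser of the Rayleigh quotient \<open>a(v,v) / b(v,v)\<close> on \<open>V\<close>.\<close>

lemma minimal_eigenvector:
  fixes a b :: "'e \<Rightarrow> 'e \<Rightarrow> real"
  assumes "subspace V" "V \<noteq> {0}" "bilinear a" "bilinear b"
    and a_sym: "\<And>x y. x \<in> V \<Longrightarrow> y \<in> V \<Longrightarrow> a x y = a y x"
    and b_sym: "\<And>x y. x \<in> V \<Longrightarrow> y \<in> V \<Longrightarrow> b x y = b y x"
    and b_pos: "\<And>x. x \<in> V \<Longrightarrow> x \<noteq> 0 \<Longrightarrow> b x x > 0"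
  obtains v l where "v \<in> V" "v \<noteq> 0" "\<And>w. w \<in> V \<Longrightarrow> a v w = l * b v w"
    "\<And>w. w \<in> V \<Longrightarrow> l * b w w \<le> a w w"
proof -
  interpret inner_product_form "inner :: 'e \<Rightarrow> 'e \<Rightarrow> real"
    by standard (rule inner_product_inner)
  interpret finite_inner_product_form "inner :: 'e \<Rightarrow> 'e \<Rightarrow> real"
    by standard (use finite_B span_B in blast)
  obtain C where C: "finite C" "span C = V" "\<And>c. c \<in> C \<Longrightarrow> c \<bullet> c = 1"
    "\<And>c d. c \<in> C \<Longrightarrow> d \<in> C \<Longrightarrow> c \<noteq> d \<Longrightarrow> c \<bullet> d = 0"
    by (rule orthonormal_basis_subspace[OF assms(1)]) blast
  \<comment> \<open>The unit sphere of \<open>V\<close>: Cauchy--Schwarz bounds the coordinates of a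
    unit vector by 1, so the intersection with the box loses nothing and is compact.\<close>
  define K where "K = (\<lambda>x. \<Sum>c\<in>C. x c *\<^sub>R c) ` {x. \<forall>c\<in>C. \<bar>x c :: real\<bar> \<le> 1} \<inter> {x. x \<bullet> x = 1}"
  have KV: "K \<subseteq> V"
    unfolding K_def C(2)[symmetric] by (auto intro: span_sum span_scale span_base)
  have K0: "x \<noteq> 0" if "x \<in> K" for x
    using that unfolding K_def by auto
  have "compact K"
    unfolding K_def
    by (intro compact_Int_closed compact_coordinate_box C(1) closed_Collect_eq continuous_intros)
  have unit: "(1 / norm w) *\<^sub>R w \<in> K" if w: "w \<in> V" "w \<noteq> 0" for w
  proof -
    let ?u = "(1 / norm w) *\<^sub>R w"
    have n: "norm ?u = 1" using w by simp
    have "?u \<in> span C" unfolding C(2) using assms(1) w(1) by (rule subspace_scale)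
    then have u: "?u = (\<Sum>c\<in>C. (?u \<bullet> c) *\<^sub>R c)"
      by (metis (no_types, lifting) orthonormal_expansion[OF C(1,3,4)] sum.cong)
    have "\<bar>?u \<bullet> c\<bar> \<le> 1" if "c \<in> C" for c
      using Cauchy_Schwarz_ineq2[of ?u c] n C(3)[OF that] by (simp add: norm_eq_sqrt_inner)
    then have "?u \<in> (\<lambda>x. \<Sum>c\<in>C. x c *\<^sub>R c) ` {x. \<forall>c\<in>C. \<bar>x c :: real\<bar> \<le> 1}"
      by (intro image_eqI[of _ _ "\<lambda>c. ?u \<bullet> c"] u) blast
    then show ?thesis
      using n unfolding K_def norm_eq_1 by blast
  qed
  obtain w0 where "w0 \<in> V" "w0 \<noteq> 0"
    using assms(1,2) subspace_0 by fastforce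
  then have "K \<noteq> {}" using unit by blast
  interpret a: bounded_bilinear a by (rule bilinear_imp_bounded[OF assms(3)])
  interpret b: bounded_bilinear b by (rule bilinear_imp_bounded[OF assms(4)])
  have "continuous_on K (\<lambda>x. a x x / b x x)"
    by (intro continuous_intros a.continuous_on b.continuous_on) (use b_pos K0 KV in fastforce)
  then obtain v where v: "v \<in> K" "\<And>y. y \<in> K \<Longrightarrow> a v v / b v v \<le> a y y / b y y"
    using continuous_attains_inf[OF \<open>compact K\<close> \<open>K \<noteq> {}\<close>] by blast
  define l where "l = a v v / b v v"
  have vV: "v \<in> V" "v \<noteq> 0" using v KV K0 by auto
  have min: "l * b w w \<le> a w w" if w: "w \<in> V" for w
  proof (cases "w = 0")
    case False
    have "l \<le> a w w / b w w"
      using v(2)[OF unit[OF w False]] False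
      by (simp add: l_def a.scaleR_left a.scaleR_right b.scaleR_left b.scaleR_right)
    then show ?thesis using b_pos[OF w False] by (simp add: field_simps)
  qed (simp add: a.zero_left b.zero_left)
  have "a v w = l * b v w" if w: "w \<in> V" for w
  proof -
    \<comment> \<open>\<open>2 * g\<close> and \<open>k\<close> are the linear and the quadratic
      coefficient of the nonnegative function a - l b along \<open>v + s *\<^sub>R w\<close>, whose
      value at s = 0 is 0.\<close>
    define g where "g = a v w - l * b v w"
    define k where "k = a w w - l * b w w"
    have vv: "a v v = l * b v v" using b_pos[OF vV] by (simp add: l_def)
    have k: "k \<ge> 0" using min[OF w] by (simp add: k_def)
    have ge: "0 \<le> 2 * s * g + s\<^sup>2 * k" for s
    proof -
      have "v + s *\<^sub>R w \<in> V" using vV w assms(1) by (simp add: subspace_add subspace_scale)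
      from min[OF this] show ?thesis
        using vv a_sym[OF w vV(1)] b_sym[OF w vV(1)]
        by (simp add: a.add_left a.add_right b.add_left b.add_right a.scaleR_left a.scaleR_right
            b.scaleR_left b.scaleR_right g_def k_def algebra_simps power2_eq_square)
    qed
    \<comment> \<open>The parabola has its minimum at -g/k; \<open>k + 1\<close> keeps the
      denominator positive when k = 0 and still gives a negative value unless g = 0.\<close>
    define s where "s = - g / (k + 1)"
    have s: "s * (k + 1) = - g" using k by (simp add: s_def)
    have "0 \<le> (2 * s * g + s\<^sup>2 * k) * (k + 1)\<^sup>2" using ge[of s] by simp
    also have "\<dots> = 2 * (s * (k + 1)) * g * (k + 1) + (s * (k + 1))\<^sup>2 * k"
      by (simp add: algebra_simps power2_eq_square)
    also have "\<dots> = - (g\<^sup>2 * (k + 2))" unfolding s by (simp add: algebra_simps power2_eq_square)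
    finally have "g\<^sup>2 * (k + 2) \<le> 0" by simp
    then have "g = 0" using k by (simp add: mult_le_0_iff)
    then show ?thesis by (simp add: g_def)
  qed
  then show thesis using that vV min by blast
qed

end

section \<open>Lie algebras with an invariant inner product\<close>

text \<open>Limit s to 0. The value s = 0 is excluded since the inequality arises after division by
  s^2.\<close>

lemma quadratic_nonpos_imp:
  fixes a b c :: real
  assumes "\<And>s. s \<noteq> 0 \<Longrightarrow> a + b * s + c * s\<^sup>2 \<le> 0"
  shows "a \<le> 0"
proof (rule tendsto_upperbound)
  show "((\<lambda>s. a + b * s + c * s\<^sup>2) \<longlongrightarrow> a) (at 0)"
    by (auto intro!: tendsto_eq_intros)
  show "\<forall>\<^sub>F s in at 0. a + b * s + c * s\<^sup>2 \<le> 0"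
    using assms by (auto simp: eventually_at_filter)
qed simp

text \<open>\<open>skew\<close> is the infinitesimal form of biinvariance, and \<open>jacobi\<close>
  says that each \<open>br x\<close> is a derivation.\<close>

locale compact_lie_algebra = finite_inner_product_form Q
  for Q :: "'e::real_inner \<Rightarrow> 'e \<Rightarrow> real" +
  fixes br :: "'e \<Rightarrow> 'e \<Rightarrow> 'e"
  assumes bilinear_br: "bilinear br"
    and antisym: "br x y = - br y x"
    and jacobi: "br x (br y z) = br (br x y) z + br y (br x z)"
    and skew: "Q (br x y) z = - Q y (br x z)"
begin

lemmas br_simps =
  bilinear_ladd[OF bilinear_br] bilinear_radd[OF bilinear_br]
  bilinear_lsub[OF bilinear_br] bilinear_rsub[OF bilinear_br]
  bilinear_lneg[OF bilinear_br] bilinear_rneg[OF bilinear_br]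
  bilinear_lmul[OF bilinear_br] bilinear_rmul[OF bilinear_br]
  bilinear_lzero[OF bilinear_br] bilinear_rzero[OF bilinear_br]

lemma br_self: "br x x = 0"
  by (metis antisym add.right_inverse scaleR_2 scaleR_eq_0_iff zero_neq_numeral)

lemma br_eq_0_commute: "br x y = 0 \<longleftrightarrow> br y x = 0"
  using antisym[of x y] by simp

lemma assoc: "Q (br x y) z = Q x (br y z)"
  by (metis antisym skew Q_simps(5) Q_commute)

lemma minimal_eigenvectorE:
  fixes V :: "'e set" and a b :: "'e \<Rightarrow> 'e \<Rightarrow> real"
  assumes "subspace V" "V \<noteq> {0}" "bilinear a" "bilinear b"
    "\<And>x y. x \<in> V \<Longrightarrow> y \<in> V \<Longrightarrow> a x y = a y x"
    "\<And>x y. x \<in> V \<Longrightarrow> y \<in> V \<Longrightarrow> b x y = b y x"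
    "\<And>x. x \<in> V \<Longrightarrow> x \<noteq> 0 \<Longrightarrow> b x x > 0"
  obtains v l where "v \<in> V" "v \<noteq> 0" "\<And>w. w \<in> V \<Longrightarrow> a v w = l * b v w"
    "\<And>w. w \<in> V \<Longrightarrow> l * b w w \<le> a w w"
proof -
  obtain B0 :: "'e set" where "finite B0" "span B0 = UNIV" using finite_dim by blast
  then obtain B :: "'e set" where "finite_dim_space B" by (rule finite_dim_space_exists)
  then interpret finite_dim_space B .
  show thesis
    by (rule minimal_eigenvector[of V a b]) (use assms that in blast)+
qed

lemma bilinear_Q_br: "bilinear (\<lambda>x y. Q (br a x) (br b y))"
  by (auto simp: bilinear_def br_simps Q_simps intro!: linearI)

text \<open>On \<open>V\<close> the map \<open>br X\<close> is skew and injective, so minus its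
  square is positive definite. An eigenvector \<open>Z\<close> for the smallest eigenvalue
  \<open>a\<^sup>2\<close> and its image span a plane that \<open>br X\<close> rotates with speed
  \<open>a\<close>. The minimality stays in the conclusion because
  \<open>rank_one_subalgebra\<close> has to exclude slower rotations.\<close>

lemma minimal_rotation:
  assumes V: "subspace V" "V \<noteq> {0}" "\<And>x. x \<in> V \<Longrightarrow> br X x \<in> V"
    "\<And>x. x \<in> V \<Longrightarrow> br X x = 0 \<Longrightarrow> x = 0"
  obtains Z Z' a where "a > 0" "Z \<in> V" "Z \<noteq> 0" "Z' \<in> V" "Q Z' Z' = Q Z Z"
    "br X Z = a *\<^sub>R Z'" "br X Z' = - (a *\<^sub>R Z)"
    "\<And>w. w \<in> V \<Longrightarrow> a\<^sup>2 * Q w w \<le> Q (br X w) (br X w)"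
proof -
  obtain Z l where Z: "Z \<in> V" "Z \<noteq> 0"
    and eq: "\<And>w. w \<in> V \<Longrightarrow> Q (br X Z) (br X w) = l * Q Z w"
    and min: "\<And>w. w \<in> V \<Longrightarrow> l * Q w w \<le> Q (br X w) (br X w)"
    by (rule minimal_eigenvectorE[OF V(1,2) bilinear_Q_br bilinear_Q, of X X])
      (auto intro: Q_commute Q_pos)
  have "br X Z \<noteq> 0" using Z V(4) by blast
  then have "l * Q Z Z > 0" using eq[OF Z(1)] Q_pos by metis
  then have l: "l > 0" using Q_pos[OF Z(2)] by (simp add: zero_less_mult_iff)
  define a where "a = sqrt l"
  have a: "a > 0" "a * a = l" using l by (auto simp: a_def)
  define Z' where "Z' = (1 / a) *\<^sub>R br X Z"
  have 1: "br X Z = a *\<^sub>R Z'" using a by (simp add: Z'_def)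
  have "br X (br X Z) + l *\<^sub>R Z \<in> V" using V Z by (simp add: subspace_add subspace_scale)
  moreover have "Q (br X (br X Z) + l *\<^sub>R Z) w = 0" if "w \<in> V" for w
    using eq[OF that] skew[of X "br X Z" w] by (simp add: Q_simps)
  ultimately have "br X (br X Z) = - (l *\<^sub>R Z)"
    using Q_eq_0_iff by (metis eq_neg_iff_add_eq_0)
  then have 2: "br X Z' = - (a *\<^sub>R Z)"
    using a(1) by (simp add: Z'_def br_simps flip: a(2))
  have "Q Z' Z' = (1 / a) * (1 / a) * Q (br X Z) (br X Z)"
    by (simp add: Z'_def Q_simps)
  also have "\<dots> = Q Z Z" using a l eq[OF Z(1)] by (simp add: field_simps)
  finally have 3: "Q Z' Z' = Q Z Z" .
  have "Z' \<in> V" unfolding Z'_def using V Z by (simp add: subspace_scale)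
  with that[OF a(1) Z _ 3 1 2] min show thesis
    using a(2) by (simp add: power2_eq_square)
qed

text \<open>Root theory of rank one in real form. Let a be the smallest frequency of
  \<open>br X\<close> orthogonally to \<open>X\<close>, and b the smallest one orthogonally to
  \<open>X\<close>, \<open>Z\<close>, \<open>Z'\<close>. The frequency b - a is smaller than b and
  does not occur there. For roots this would make the inner product of a and b nonpositive, although
  in rank one both are positive multiples of the same functional.\<close>

lemma rank_one_subalgebra:
  assumes l: "subspace l" "\<And>x y. x \<in> l \<Longrightarrow> y \<in> l \<Longrightarrow> br x y \<in> l"
    and X: "X \<in> l" "X \<noteq> 0"
    and cent: "\<And>Y. Y \<in> l \<Longrightarrow> br X Y = 0 \<Longrightarrow> \<exists>\<tau>. Y = \<tau> *\<^sub>R X"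
  shows "\<exists>Z Z'. l \<subseteq> span {X, Z, Z'}"
proof -
  define V where "V = l \<inter> orth_compl Q {X}"
  have V: "subspace V" unfolding V_def by (intro subspace_inter l subspace_orth_compl)
  have Vinv: "br X x \<in> V" if "x \<in> V" for x
    using that l X by (simp add: V_def orth_compl_def skew br_self Q_simps)
  have Vinj: "x = 0" if x: "x \<in> V" "br X x = 0" for x
  proof -
    obtain \<tau> where "x = \<tau> *\<^sub>R X" using x cent unfolding V_def by blast
    then show ?thesis using x(1) Q_pos[OF X(2)]
      by (auto simp: V_def orth_compl_def Q_simps)
  qed
  show ?thesis
  proof (cases "V = {0}")
    case True
    have "y \<in> span {X, 0, 0}" if "y \<in> l" for y
    proof -
      have "y - (Q y X / Q X X) *\<^sub>R X \<in> V"
        using that l X Q_pos[OF X(2)]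
        by (auto simp: V_def orth_compl_def Q_simps intro!: subspace_diff subspace_scale)
      then have "y = (Q y X / Q X X) *\<^sub>R X" using True by simp
      then show ?thesis by (metis insertI1 span_base span_scale)
    qed
    then show ?thesis by blast
  next
    case False
    obtain a Z Z' where a: "a > 0" and Z: "Z \<in> V" "Z \<noteq> 0" and Z': "Z' \<in> V" "Q Z' Z' = Q Z Z"
      and XZ: "br X Z = a *\<^sub>R Z'" and XZ': "br X Z' = - (a *\<^sub>R Z)"
      and min1: "\<And>w. w \<in> V \<Longrightarrow> a\<^sup>2 * Q w w \<le> Q (br X w) (br X w)"
      by (rule minimal_rotation[OF V False Vinv Vinj]) blast+
    have ZX: "br Z X = - (a *\<^sub>R Z')" and Z'X: "br Z' X = a *\<^sub>R Z"
      using XZ XZ' antisym[of Z X] antisym[of Z' X] by auto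
    have QX: "Q Z X = 0" "Q Z' X = 0"
      using Z Z' by (auto simp: V_def orth_compl_def)
    have QZZ': "Q Z Z' = 0"
    proof -
      have "a * Q Z Z' = Q Z (br X Z)" by (simp add: XZ Q_simps)
      also have "\<dots> = 0" using skew[of X Z Z] Q_commute[of "br X Z" Z] by simp
      finally show ?thesis using a by simp
    qed
    \<comment> \<open>[Z, Z'] commutes with X, hence is a multiple of X, and invariance of
      \<open>Q\<close> dictates the factor: its product with X is a |Z|^2.\<close>
    define k where "k = a * Q Z Z / Q X X"
    have k: "k > 0" using a Q_pos Z(2) X(2) by (simp add: k_def)
    have ZZ': "br Z Z' = k *\<^sub>R X"
    proof -
      have "br X (br Z Z') = 0"
        using jacobi[of X Z Z'] by (simp add: XZ XZ' br_simps br_self)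
      moreover have "br Z Z' \<in> l" using Z Z' l by (simp add: V_def)
      ultimately obtain \<tau> where \<tau>: "br Z Z' = \<tau> *\<^sub>R X" using cent by blast
      have "\<tau> * Q X X = Q (br Z Z') X" by (simp add: \<tau> Q_simps)
      also have "\<dots> = a * Q Z Z" by (simp add: assoc Z'X Q_simps)
      finally have "\<tau> = k" using Q_pos[OF X(2)] by (simp add: k_def field_simps)
      then show ?thesis using \<tau> by simp
    qed
    define W where "W = l \<inter> orth_compl Q {X, Z, Z'}"
    have W: "subspace W" unfolding W_def by (intro subspace_inter l subspace_orth_compl)
    have WV: "W \<subseteq> V" by (auto simp: W_def V_def orth_compl_def)
    have WD: "Q x X = 0" "Q x Z = 0" "Q x Z' = 0" "x \<in> l" if "x \<in> W" for x
      using that by (auto simp: W_def orth_compl_def)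
    have Winv: "br X x \<in> W" if "x \<in> W" for x
      using WD[OF that] l X by (simp add: W_def orth_compl_def skew XZ XZ' br_self Q_simps)
    have "W = {0}"
    proof (rule ccontr)
      assume "W \<noteq> {0}"
      obtain b C C' where b: "b > 0" and C: "C \<in> W" "C \<noteq> 0" and C': "C' \<in> W" "Q C' C' = Q C C"
        and XC: "br X C = b *\<^sub>R C'" and XC': "br X C' = - (b *\<^sub>R C)"
        and min2: "\<And>w. w \<in> W \<Longrightarrow> b\<^sup>2 * Q w w \<le> Q (br X w) (br X w)"
        by (rule minimal_rotation[OF W \<open>W \<noteq> {0}\<close> Winv]) (use WV Vinj in blast)+
      have CC: "Q C C > 0" by (rule Q_pos[OF C(2)])
      have "a\<^sup>2 * Q C C \<le> b\<^sup>2 * Q C C"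
        using min1[of C] C WV by (auto simp: XC Q_simps C' power2_eq_square mult.assoc)
      then have ab: "a \<le> b" using CC a b by (simp add: power_mono_iff)
      have "(b - a)\<^sup>2 < b\<^sup>2" using a b ab by (intro power_strict_mono) auto
      \<comment> \<open>In the complexification \<open>D - i D'\<close> is the bracket of
        \<open>Z + i Z'\<close> and \<open>C - i C'\<close>, eigenvectors of \<open>br X\<close> for
        -ia and ib; hence its frequency is b - a.\<close>
      define D where "D = br Z C + br Z' C'"
      define D' where "D' = br Z C' - br Z' C"
      have XD: "br X D = (b - a) *\<^sub>R D'"
        using jacobi[of X Z C] jacobi[of X Z' C']
        by (simp add: D_def D'_def XZ XZ' XC XC' br_simps algebra_simps)
      have XD': "br X D' = (a - b) *\<^sub>R D"
        using jacobi[of X Z C'] jacobi[of X Z' C]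
        by (simp add: D_def D'_def XZ XZ' XC XC' br_simps algebra_simps)
      have Q0: "Q C Z = 0" "Q C Z' = 0" "Q C' Z = 0" "Q C' Z' = 0" "Q C X = 0" "Q C' X = 0"
        using C C' WD by auto
      have Z'Z: "br Z' Z = - (k *\<^sub>R X)" using ZZ' antisym[of Z' Z] by simp
      have in_l: "Z \<in> l" "Z' \<in> l" "C \<in> l" "C' \<in> l"
        using Z(1) Z'(1) C(1) C'(1) by (simp_all add: V_def W_def)
      then have "D \<in> l" "D' \<in> l"
        unfolding D_def D'_def by (simp_all add: l subspace_add subspace_diff)
      then have DW: "D \<in> W" "D' \<in> W"
        unfolding W_def orth_compl_def
        by (simp_all add: D_def D'_def Q_simps skew ZX Z'X ZZ' Z'Z br_self Q0)
      have "Q (br X D) (br X D) = (b - a)\<^sup>2 * Q D D"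
        using skew[of X D "br X D"]
        by (simp add: XD XD' br_simps Q_simps power2_eq_square algebra_simps)
      then have "b\<^sup>2 * Q D D \<le> (b - a)\<^sup>2 * Q D D" using min2[OF DW(1)] by simp
      then have D0: "D = 0"
        using \<open>(b - a)\<^sup>2 < b\<^sup>2\<close> Q_pos[of D] by (auto simp: mult_le_cancel_right)
      have "b\<^sup>2 * Q D' D' \<le> 0" using min2[OF DW(2)] by (simp add: XD' D0 Q_simps)
      then have D'0: "D' = 0"
        using b Q_pos[of D'] by (auto simp: mult_le_0_iff)
      have e: "br Z C = - br Z' C'" "br Z' C = br Z C'"
        using D0 D'0 by (auto simp: D_def D'_def add_eq_0_iff)
      \<comment> \<open>As [[Z, Z'], C] = k b C', the left side is positive, while the vanishing of
        \<open>D\<close> and \<open>D'\<close> turns the right side into minus a sum of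
        squares.\<close>
      have "k * b * Q C' C' = Q (br (br Z Z') C) C'"
        by (simp add: ZZ' XC br_simps Q_simps)
      also have "br (br Z Z') C = br Z (br Z C') + br Z' (br Z' C')"
        using jacobi[of Z Z' C] by (simp add: e br_simps)
      also have "Q \<dots> C' = - Q (br Z C') (br Z C') - Q (br Z' C') (br Z' C')"
        by (simp add: Q_simps skew[of Z "br Z C'"] skew[of Z' "br Z' C'"])
      also have "\<dots> \<le> 0" using Q_nonneg[of "br Z C'"] Q_nonneg[of "br Z' C'"] by simp
      finally show False using k b CC C'(2) by (simp add: mult_le_0_iff)
    qed
    have "y \<in> span {X, Z, Z'}" if "y \<in> l" for y
    proof -
      let ?p = "(Q y X / Q X X) *\<^sub>R X + (Q y Z / Q Z Z) *\<^sub>R Z + (Q y Z' / Q Z' Z') *\<^sub>R Z'"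
      have p: "Q Z' Z = 0" "Q X Z = 0" "Q X Z' = 0" using QZZ' QX Q_commute by metis+
      have pos: "Q X X > 0" "Q Z Z > 0" "Q Z' Z' > 0"
        using Q_pos X(2) Z(2) Z'(2) by auto
      have "?p \<in> l" using l X Z Z' by (auto simp: V_def intro!: subspace_add subspace_scale)
      then have "y - ?p \<in> W"
        using that l pos by (auto simp: W_def orth_compl_def Q_simps QX QZZ' p intro!: subspace_diff)
      then have "y = ?p" using \<open>W = {0}\<close> by simp
      moreover have "?p \<in> span {X, Z, Z'}"
        by (intro span_add span_scale span_base) auto
      ultimately show ?thesis by metis
    qed
    then show ?thesis by blast
  qed
qed

section \<open>The bound on projected brackets and its consequences\<close>

lemma Q_span_orth: "y \<in> span S \<Longrightarrow> (\<And>s. s \<in> S \<Longrightarrow> Q x s = 0) \<Longrightarrow> Q x y = 0"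
  by (induction rule: span_induct_alt) (auto simp: Q_simps)

text \<open>An inequality rather than the implication from \<open>br X Y = 0\<close> alone: the
  constant also controls pairs that commute only up to second order, and these carry the first-order
  information.\<close>

definition proj_bounded :: "'e set \<Rightarrow> bool" where
  "proj_bounded J \<longleftrightarrow> (\<exists>K. \<forall>X Y. Q (br (orth_proj Q J X) (orth_proj Q J Y)) (br (orth_proj Q J X) (orth_proj Q J Y))
     \<le> K * Q (br X Y) (br X Y))"

lemma proj_bounded_commute:
  assumes "proj_bounded J" "br X Y = 0"
  shows "br (orth_proj Q J X) (orth_proj Q J Y) = 0"
proof -
  obtain K where "Q (br (orth_proj Q J X) (orth_proj Q J Y)) (br (orth_proj Q J X) (orth_proj Q J Y))
     \<le> K * Q (br X Y) (br X Y)"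
    using assms unfolding proj_bounded_def by blast
  then show ?thesis using assms(2) Q_pos by (force simp: Q_simps not_less[symmetric])
qed

text \<open>The pair \<open>(X + s[Z,X], Y + s[Z,Y])\<close> commutes up to \<open>O(s\<^sup>2)\<close>, hence so do the
  projections; the identity is the coefficient of \<open>s\<close>.\<close>

lemma proj_bounded_first_order:
  assumes J: "subspace J" and bd: "proj_bounded J" and XY: "br X Y = 0"
  defines "P \<equiv> orth_proj Q J"
  shows "br (P (br Z X)) (P Y) + br (P X) (P (br Z Y)) = 0"
proof -
  have lin: "P (x + y) = P x + P y" "P (r *\<^sub>R x) = r *\<^sub>R P x" for x y r
    unfolding P_def using orth_proj_linear[OF J] by (simp_all add: linear_add linear_scale)
  obtain K where K: "\<And>X Y. Q (br (P X) (P Y)) (br (P X) (P Y)) \<le> K * Q (br X Y) (br X Y)"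
    using bd unfolding proj_bounded_def P_def by blast
  define F1 where "F1 = br (P (br Z X)) (P Y) + br (P X) (P (br Z Y))"
  define F2 where "F2 = br (P (br Z X)) (P (br Z Y))"
  define G where "G = br (br Z X) (br Z Y)"
  have F: "br (P (X + s *\<^sub>R br Z X)) (P (Y + s *\<^sub>R br Z Y)) = s *\<^sub>R (F1 + s *\<^sub>R F2)" for s
    using proj_bounded_commute[OF bd XY, folded P_def]
    by (simp add: lin br_simps F1_def F2_def scaleR_add_right)
  have G: "br (X + s *\<^sub>R br Z X) (Y + s *\<^sub>R br Z Y) = (s * s) *\<^sub>R G" for s
  proof -
    have "br (X + s *\<^sub>R br Z X) (Y + s *\<^sub>R br Z Y) = s *\<^sub>R (br (br Z X) Y + br X (br Z Y)) + (s * s) *\<^sub>R G"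
      by (simp add: br_simps XY G_def scaleR_add_right)
    then show ?thesis using jacobi[of Z X Y] XY by (simp add: br_simps)
  qed
  \<comment> \<open>The bound compares s^2 |F1 + s F2|^2 with a multiple of s^4; after division by
    s^2 the constant term is |F1|^2.\<close>
  have "Q F1 F1 \<le> 0"
  proof (rule quadratic_nonpos_imp)
    fix s :: real assume s: "s \<noteq> 0"
    have "s\<^sup>2 * Q (F1 + s *\<^sub>R F2) (F1 + s *\<^sub>R F2) \<le> s\<^sup>2 * (K * (s\<^sup>2 * Q G G))"
      using K[of "X + s *\<^sub>R br Z X" "Y + s *\<^sub>R br Z Y"] unfolding F G
      by (simp add: Q_simps power2_eq_square algebra_simps)
    then have "Q (F1 + s *\<^sub>R F2) (F1 + s *\<^sub>R F2) \<le> K * (s\<^sup>2 * Q G G)"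
      using s by simp
    then show "Q F1 F1 + (2 * Q F1 F2) * s + (Q F2 F2 - K * Q G G) * s\<^sup>2 \<le> 0"
      by (simp add: Q_simps Q_commute[of F2 F1] power2_eq_square algebra_simps)
  qed
  then have "F1 = 0" using Q_pos[of F1] by force
  then show ?thesis by (simp add: F1_def)
qed

definition centralizer :: "'e set \<Rightarrow> 'e set" where
  "centralizer S = {x. \<forall>s\<in>S. br s x = 0}"

lemma subspace_centralizer: "subspace (centralizer S)"
  by (auto simp: centralizer_def subspace_def br_simps)

lemma centralizer_br:
  "x \<in> centralizer S \<Longrightarrow> y \<in> centralizer S \<Longrightarrow> br x y \<in> centralizer S"
  by (simp add: centralizer_def jacobi[of _ x y] br_simps)

text \<open>Together with \<open>centralizer_br\<close> this makes the vectors that centralize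
  \<open>S\<close> and are orthogonal to \<open>S\<close> closed under the bracket.\<close>

lemma centralizer_br_orth:
  "x \<in> centralizer S \<Longrightarrow> y \<in> centralizer S \<Longrightarrow> br x y \<in> orth_compl Q S"
  using br_eq_0_commute[of _ y] by (auto simp: centralizer_def orth_compl_def assoc Q_simps)

text \<open>Zorn's lemma for commuting subsets of \<open>T\<close>. A vector of \<open>T\<close>
  that commutes with a maximal \<open>S\<close> belongs to \<open>S\<close>; if it is also
  orthogonal to \<open>S\<close>, it is orthogonal to itself. Such a set acts as a maximal
  torus.\<close>

lemma maximal_abelian_subset:
  obtains S where "S \<subseteq> T" "\<And>x y. x \<in> S \<Longrightarrow> y \<in> S \<Longrightarrow> br x y = 0"
    "T \<inter> centralizer S \<inter> orth_compl Q S \<subseteq> {0}"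
proof -
  let ?A = "{S. S \<subseteq> T \<and> (\<forall>x\<in>S. \<forall>y\<in>S. br x y = 0)}"
  have "\<exists>M\<in>?A. \<forall>X\<in>?A. M \<subseteq> X \<longrightarrow> X = M"
  proof (rule subset_Zorn_nonempty)
    show "?A \<noteq> {}" by blast
    fix C assume C: "C \<noteq> {}" "subset.chain ?A C"
    have "br x y = 0" if "x \<in> U" "U \<in> C" "y \<in> V" "V \<in> C" for x y U V
    proof -
      have "U \<in> ?A" "V \<in> ?A" "U \<subseteq> V \<or> V \<subseteq> U"
        using C(2) that by (auto simp: subset_chain_def)
      then show ?thesis using that(1,3) by blast
    qed
    moreover have "\<Union>C \<subseteq> T" using C(2) by (auto simp: subset_chain_def)
    ultimately show "\<Union>C \<in> ?A" by blast
  qed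
  then obtain S where S: "S \<in> ?A" "\<forall>X\<in>?A. S \<subseteq> X \<longrightarrow> X = S" by (rule bexE)
  have "w = 0" if w: "w \<in> T \<inter> centralizer S \<inter> orth_compl Q S" for w
  proof -
    have "br w s = 0 \<and> br s w = 0" if "s \<in> S" for s
      using w that br_eq_0_commute[of w s] by (auto simp: centralizer_def)
    then have "insert w S \<in> ?A"
      using w S(1) by (simp add: br_self)
    then have "insert w S = S" by (rule S(2)[rule_format]) (rule subset_insertI)
    then have "w \<in> S" by blast
    then show ?thesis using w Q_eq_0_iff by (auto simp: orth_compl_def)
  qed
  then have "T \<inter> centralizer S \<inter> orth_compl Q S \<subseteq> {0}" by blast
  moreover have "S \<subseteq> T" "\<And>x y. x \<in> S \<Longrightarrow> y \<in> S \<Longrightarrow> br x y = 0" using S(1) by simp_all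
  ultimately show thesis by (intro that)
qed

text \<open>The aim is that \<open>J\<close> and its centralizer together leave no orthogonal
  complement \<open>M\<close>. The dichotomy for vectors orthogonal to \<open>J\<close> makes every
  nonzero element of \<open>J\<close> act injectively on \<open>M\<close>; a nonzero
  \<open>M\<close> then forces rank one on a subalgebra that is too large for it.\<close>

lemma simple_proj_bounded_commutes:
  assumes J: "subspace J" "\<And>x y. x \<in> J \<Longrightarrow> y \<in> J \<Longrightarrow> br x y \<in> J"
    and simple: "\<And>I. subspace I \<Longrightarrow> I \<subseteq> J \<Longrightarrow> (\<And>x y. x \<in> J \<Longrightarrow> y \<in> I \<Longrightarrow> br x y \<in> I) \<Longrightarrow>
      I = {0} \<or> I = J"
    and nonabelian: "A0 \<in> J" "C0 \<in> J" "br A0 C0 \<noteq> 0"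
    and bd: "proj_bounded J"
    and x: "x \<in> J" and m: "m \<in> orth_compl Q J"
  shows "br x m = 0"
proof -
  define P where "P = orth_proj Q J"
  have P: "P y \<in> J" "y - P y \<in> orth_compl Q J" "z \<in> J \<Longrightarrow> Q (P y) z = Q y z" for y z
    by (simp_all add: P_def J orth_proj_in orth_proj_diff Q_orth_proj_left)
  have P0: "P y = 0 \<longleftrightarrow> y \<in> orth_compl Q J" for y
    using P(2)[of y] orth_proj_eq_0[OF J(1)] by (auto simp: P_def)
  have "linear P" unfolding P_def by (rule orth_proj_linear[OF J(1)])
  \<comment> \<open>The brackets span an ideal of \<open>J\<close>, which is nonzero because
    \<open>J\<close> is not abelian.\<close>
  have perfect: "J \<subseteq> span {br x y |x y. x \<in> J \<and> y \<in> J}" (is "J \<subseteq> span ?D")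
  proof -
    have sub: "span ?D \<subseteq> J" using J by (intro span_minimal) auto
    have "br x y \<in> span ?D" if "x \<in> J" "y \<in> span ?D" for x y
      using that sub by (intro span_base) blast
    then have "span ?D = {0} \<or> span ?D = J" by (intro simple sub subspace_span)
    moreover have "br A0 C0 \<in> span ?D" using nonabelian by (intro span_base) blast
    ultimately show ?thesis using nonabelian(3) by auto
  qed
  define cJ where "cJ = centralizer J"
  \<comment> \<open>Since \<open>J\<close> is spanned by brackets, invariance of \<open>Q\<close>
    makes its centralizer orthogonal to it.\<close>
  have cJ_orth: "y \<in> orth_compl Q J" if "y \<in> cJ" for y
  proof -
    have "Q y s = 0" if "s \<in> ?D" for s
      using that \<open>y \<in> cJ\<close> by (auto simp: cJ_def centralizer_def Q_simps Q_commute[of y] assoc)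
    then have "Q y z = 0" if "z \<in> J" for z
      using Q_span_orth[of z ?D y] perfect that by blast
    then show ?thesis by (simp add: orth_compl_def)
  qed
  have step1: "J \<subseteq> centralizer {X} \<or> centralizer {X} \<subseteq> orth_compl Q J" if X: "X \<in> orth_compl Q J" for X
  proof -
    have PX: "P X = 0" using X P0 by simp
    \<comment> \<open>With P X = 0 the first-order identity loses a term and reads [P[Z, X], P Y] =
      0. Pairing it with \<open>C\<close> and moving brackets by invariance isolates the arbitrary
      \<open>Z\<close>.\<close>
    have comm: "br X (br (P Y) C) = 0" if Y: "br X Y = 0" and C: "C \<in> J" for Y C
    proof -
      have "Q Z (br X (br (P Y) C)) = 0" for Z
      proof -
        have "br (P (br Z X)) (P Y) = 0"
          using proj_bounded_first_order[OF J(1) bd Y, of Z] PX by (simp add: P_def br_simps)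
        then have "Q (P (br Z X)) (br (P Y) C) = 0"
          by (metis assoc Q_simps(9))
        then have "Q (br Z X) (br (P Y) C) = 0"
          using P(3) J(2)[OF P(1) C] by simp
        then show ?thesis by (simp add: assoc)
      qed
      then show ?thesis using Q_eq_0_iff by blast
    qed
    \<comment> \<open>By \<open>comm\<close> this image is an ideal of \<open>J\<close>; the two
      cases of simplicity are the two alternatives.\<close>
    define I where "I = P ` centralizer {X}"
    have cI: "br a (P Y) \<in> I" if "a \<in> J" "br X Y = 0" for a Y
    proof -
      have "br X (br a (P Y)) = 0" using comm[OF that(2,1)] antisym[of a "P Y"] by (simp add: br_simps)
      moreover have "P (br a (P Y)) = br a (P Y)"
        unfolding P_def by (rule orth_proj_id) (use J that P(1) P_def in auto)
      ultimately show ?thesis unfolding I_def centralizer_def by (intro image_eqI) auto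
    qed
    have "subspace I"
      unfolding I_def using \<open>linear P\<close> subspace_centralizer by (rule linear_subspace_image)
    moreover have "I \<subseteq> J" using P(1) by (auto simp: I_def)
    moreover have "br a y \<in> I" if "a \<in> J" "y \<in> I" for a y
      using that cI by (auto simp: I_def centralizer_def)
    ultimately consider "I = {0}" | "I = J" using simple by blast
    then show ?thesis
    proof cases
      case 1
      then have "P y = 0" if "y \<in> centralizer {X}" for y using that by (auto simp: I_def)
      then show ?thesis using P0 by blast
    next
      case 2
      have "?D \<subseteq> centralizer {X}"
      proof clarify
        fix a b assume ab: "a \<in> J" "b \<in> J"
        then obtain Y where "a = P Y" "br X Y = 0" using 2 by (auto simp: I_def centralizer_def)
        then show "br a b \<in> centralizer {X}" using comm ab by (simp add: centralizer_def)
      qed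
      then show ?thesis
        using span_minimal[OF _ subspace_centralizer] perfect by blast
    qed
  qed
  have J_cJ: "X \<in> cJ" if "J \<subseteq> centralizer {X}" for X
    using that br_eq_0_commute by (auto simp: cJ_def centralizer_def)
  define M where "M = orth_compl Q J \<inter> orth_compl Q cJ"
  have sM: "subspace M" unfolding M_def by (intro subspace_inter subspace_orth_compl)
  have M_cJ: "X = 0" if "X \<in> M" "X \<in> cJ" for X
    using that Q_eq_0_iff by (auto simp: M_def orth_compl_def)
  have M_inv: "br a X \<in> M" if "a \<in> J" "X \<in> M" for a X
    using that J by (auto simp: M_def orth_compl_def skew cJ_def centralizer_def Q_simps)
  \<comment> \<open>An element \<open>a\<close> of \<open>J\<close> that commutes with
    \<open>X\<close> rules out the second alternative, so \<open>X\<close> lies in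
    \<open>cJ\<close>, to which it is also orthogonal.\<close>
  have M_inj: "X = 0" if "a \<in> J" "a \<noteq> 0" "X \<in> M" "br a X = 0" for a X
  proof -
    have "a \<notin> orth_compl Q J" using that Q_eq_0_iff by (auto simp: orth_compl_def)
    moreover have "a \<in> centralizer {X}" using that br_eq_0_commute by (auto simp: centralizer_def)
    ultimately show ?thesis using step1[of X] that M_cJ J_cJ by (auto simp: M_def)
  qed
  have "M \<subseteq> {0}"
  proof (rule ccontr)
    assume "\<not> M \<subseteq> {0}"
    then have M0: "M \<noteq> {0}" by auto
    \<comment> \<open>\<open>br a\<close> and \<open>br b\<close> are commuting skew maps, so
      Q([b, v], [a, w]) is symmetric on \<open>M\<close> and has an eigenvector v relative to
      Q([a, v], [a, w]). There [b, v] = l [a, v], so b - l a annihilates v and is 0 by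
      \<open>M_inj\<close>.\<close>
    have parallel: "\<exists>\<tau>. b = \<tau> *\<^sub>R a" if ab: "a \<in> J" "b \<in> J" "a \<noteq> 0" "br a b = 0" for a b
    proof -
      have ab_comm: "br a (br b w) = br b (br a w)" for w
        using jacobi[of a b w] ab by (simp add: br_simps)
      have sym: "Q (br b v) (br a w) = Q (br a v) (br b w)" for v w
        using skew[of b v "br a w"] skew[of a v "br b w"] ab_comm[of w] by simp
      obtain v l where v: "v \<in> M" "v \<noteq> 0" and eq: "\<And>w. w \<in> M \<Longrightarrow> Q (br b v) (br a w) = l * Q (br a v) (br a w)"
        by (rule minimal_eigenvectorE[OF sM M0 bilinear_Q_br bilinear_Q_br, of b a a a])
          (use sym Q_commute Q_pos M_inj ab in metis)+
      let ?u = "br b v - l *\<^sub>R br a v"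
      have "?u \<in> M" using M_inv ab v sM by (simp add: subspace_diff subspace_scale)
      moreover have "br a ?u = 0"
      proof -
        have "Q (br a ?u) w = 0" if "w \<in> M" for w
          using eq[OF that] by (simp add: skew[of a ?u w]) (simp add: Q_simps Q_commute)
        moreover have "br a ?u \<in> M" using M_inv ab \<open>?u \<in> M\<close> by blast
        ultimately show ?thesis using Q_eq_0_iff by blast
      qed
      ultimately have "?u = 0" using M_inj ab by blast
      then have "br (b - l *\<^sub>R a) v = 0" by (simp add: br_simps)
      moreover have "b - l *\<^sub>R a \<in> J" using ab J by (simp add: subspace_diff subspace_scale)
      ultimately have "b - l *\<^sub>R a = 0" using M_inj v by blast
      then show ?thesis by (intro exI[of _ l]) simp
    qed
    \<comment> \<open>The projections commute, hence are parallel. Subtracting the matching multiple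
      of \<open>X\<close> leaves a vector orthogonal to \<open>J\<close> that commutes with
      \<open>X\<close>; as \<open>X\<close> has a component in \<open>J\<close>, the dichotomy puts
      this vector into \<open>cJ\<close>.\<close>
    have step3: "\<exists>\<tau>. Y - \<tau> *\<^sub>R X \<in> cJ" if X: "P X \<noteq> 0" "br X Y = 0" for X Y
    proof -
      have "br (P X) (P Y) = 0" using proj_bounded_commute[OF bd X(2)] by (simp add: P_def)
      then obtain \<tau> where \<tau>: "P Y = \<tau> *\<^sub>R P X" using parallel P(1) X by blast
      let ?W = "Y - \<tau> *\<^sub>R X"
      have "P ?W = 0" using \<tau> \<open>linear P\<close> by (simp add: linear_diff linear_scale)
      then have W: "?W \<in> orth_compl Q J" using P0 by simp
      have "br X ?W = 0" using X by (simp add: br_simps br_self)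
      then have "X \<in> centralizer {?W}" using br_eq_0_commute by (simp add: centralizer_def)
      moreover have "X \<notin> orth_compl Q J" using P0 X by blast
      ultimately show ?thesis using step1[OF W] J_cJ by blast
    qed
    obtain \<xi> where \<xi>: "\<xi> \<in> M" "\<xi> \<noteq> 0" using \<open>\<not> M \<subseteq> {0}\<close> by blast
    \<comment> \<open>What commutes with \<open>J\<close> and \<xi> also commutes with every vector
      A + \<xi>, A in \<open>J\<close>. A maximal commuting set of such elements is split off to
      shrink the centralizer.\<close>
    obtain S where S: "S \<subseteq> cJ \<inter> centralizer {\<xi>}" "\<And>x y. x \<in> S \<Longrightarrow> y \<in> S \<Longrightarrow> br x y = 0"
      "cJ \<inter> centralizer {\<xi>} \<inter> centralizer S \<inter> orth_compl Q S \<subseteq> {0}"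
      using maximal_abelian_subset by metis
    define l where "l = centralizer S \<inter> orth_compl Q S"
    have sl: "subspace l"
      unfolding l_def by (intro subspace_inter subspace_centralizer subspace_orth_compl)
    have l_br: "br x y \<in> l" if "x \<in> l" "y \<in> l" for x y
      using that centralizer_br centralizer_br_orth by (auto simp: l_def)
    have Jl: "J \<subseteq> l"
    proof
      fix a assume a: "a \<in> J"
      have "a \<in> centralizer S"
        using S(1) a br_eq_0_commute by (auto simp: centralizer_def cJ_def)
      moreover have "a \<in> orth_compl Q S"
        using S(1) cJ_orth a Q_commute by (auto simp: orth_compl_def)
      ultimately show "a \<in> l" by (simp add: l_def)
    qed
    have \<xi>l: "\<xi> \<in> l"
    proof -
      have "\<xi> \<in> centralizer S"
        using S(1) br_eq_0_commute by (auto simp: centralizer_def)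
      moreover have "\<xi> \<in> orth_compl Q S"
        using S(1) \<xi>(1) by (auto simp: orth_compl_def M_def)
      ultimately show ?thesis by (simp add: l_def)
    qed
    have A0: "A0 \<noteq> 0" using nonabelian by (auto simp: br_simps)
    define X where "X = A0 + \<xi>"
    have PX: "P X = A0"
      unfolding P_def by (rule orth_proj_eqI[OF J(1)]) (use nonabelian \<xi> in \<open>auto simp: X_def M_def\<close>)
    have Xl: "X \<in> l" using nonabelian Jl \<xi>l sl by (auto simp: X_def intro: subspace_add)
    \<comment> \<open>By \<open>step3\<close>, up to a multiple of \<open>X\<close> such a vector
      lies in \<open>cJ\<close>. It then commutes with \<open>A0\<close>, hence with \<xi>, and
      maximality of \<open>S\<close> leaves only 0.\<close>
    have cent: "\<exists>\<tau>. Y = \<tau> *\<^sub>R X" if Y: "Y \<in> l" "br X Y = 0" for Y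
    proof -
      obtain \<tau> where \<tau>: "Y - \<tau> *\<^sub>R X \<in> cJ" using step3[of X Y] PX A0 Y by auto
      let ?W = "Y - \<tau> *\<^sub>R X"
      have "br A0 ?W = 0" using \<tau> nonabelian by (auto simp: cJ_def centralizer_def)
      moreover have "br (A0 + \<xi>) ?W = 0" using Y by (simp add: br_simps br_self flip: X_def)
      ultimately have "br \<xi> ?W = 0" by (simp only: bilinear_ladd[OF bilinear_br] add_0)
      moreover have "?W \<in> l" using Y Xl sl by (simp add: subspace_diff subspace_scale)
      ultimately have "?W = 0" using S(3) \<tau> by (auto simp: l_def centralizer_def)
      then show ?thesis by (intro exI[of _ \<tau>]) simp
    qed
    have "X \<noteq> 0" using PX A0 linear_0[OF \<open>linear P\<close>] by auto
    then obtain Z Z' where lsp: "l \<subseteq> span {X, Z, Z'}"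
      using rank_one_subalgebra[OF sl l_br Xl _ cent] by blast
    \<comment> \<open>\<open>A0\<close>, the part of \<open>C0\<close> orthogonal to it, their
      bracket and \<xi> are four orthogonal nonzero vectors of \<open>l\<close>, one too many for a
      span of three.\<close>
    define E where "E = br A0 C0"
    define C1 where "C1 = C0 - (Q C0 A0 / Q A0 A0) *\<^sub>R A0"
    have E: "E \<in> J" "E \<noteq> 0" "Q E A0 = 0" "Q E C0 = 0"
      using nonabelian J(2) skew[of A0 C0 A0] assoc[of A0 C0 C0] by (auto simp: E_def br_self Q_simps)
    have C1: "C1 \<in> J" "br A0 C1 = E" "Q A0 C1 = 0" "Q C1 A0 = 0"
      using nonabelian J Q_pos[OF A0]
      by (auto simp: C1_def E_def br_simps br_self Q_simps Q_commute[of A0 C0] intro!: subspace_diff subspace_scale)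
    have "C1 \<noteq> 0" using C1(2) E(2) by (auto simp: br_simps)
    let ?I = "{A0, C1, E, \<xi>}"
    have orth: "pairwise (\<lambda>x y. Q x y = 0) ?I" "0 \<notin> ?I" "card ?I = 4"
    proof -
      have EC1: "Q E C1 = 0" using E by (simp add: C1_def Q_simps)
      have x: "Q \<xi> a = 0" "Q a \<xi> = 0" if "a \<in> J" for a
        using \<xi>(1) that Q_commute by (auto simp: M_def orth_compl_def)
      show "pairwise (\<lambda>x y. Q x y = 0) ?I"
        using E C1 EC1 x nonabelian Q_commute[of A0 E] Q_commute[of C1 E]
        by (auto simp: pairwise_insert)
      show "0 \<notin> ?I" using A0 \<open>C1 \<noteq> 0\<close> E \<xi> by auto
      have "A0 \<noteq> C1" "A0 \<noteq> E" "A0 \<noteq> \<xi>" "C1 \<noteq> E" "C1 \<noteq> \<xi>" "E \<noteq> \<xi>"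
        using Q_pos[OF A0] Q_pos[OF \<open>C1 \<noteq> 0\<close>] Q_pos[OF E(2)] E C1 EC1 x nonabelian(1)
        by (metis less_irrefl)+
      then show "card ?I = 4" by simp
    qed
    have "independent ?I"
    proof (rule independent_if_scalars_zero)
      fix f y assume s: "(\<Sum>z\<in>?I. f z *\<^sub>R z) = 0" and y: "y \<in> ?I"
      have "0 = Q (\<Sum>z\<in>?I. f z *\<^sub>R z) y" by (simp add: s Q_simps)
      also have "\<dots> = (\<Sum>z\<in>?I. if z = y then f y * Q y y else 0)"
        unfolding Q_sum_left
        by (rule sum.cong) (use orth(1) y in \<open>auto simp: Q_simps pairwise_def\<close>)
      also have "\<dots> = f y * Q y y" using y by (subst sum.delta) auto
      finally show "f y = 0" using orth(2) y Q_pos[of y] by auto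
    qed simp
    moreover have "?I \<subseteq> span {X, Z, Z'}"
      using lsp Jl \<xi>l nonabelian C1 E by blast
    ultimately have "card ?I \<le> card {X, Z, Z'}"
      using independent_span_bound[of "{X, Z, Z'}" ?I] by simp
    also have "\<dots> \<le> 3" by (simp add: card_insert_if)
    finally show False using orth(3) by simp
  qed
  \<comment> \<open>A vector orthogonal to \<open>cJ\<close> has its component off \<open>J\<close>
    in \<open>M\<close>, which is zero; so it lies in \<open>J\<close> and is orthogonal to
    \<open>m\<close>.\<close>
  have "m \<in> cJ"
  proof (rule orth_compl_orth_compl)
    show "subspace cJ" unfolding cJ_def by (rule subspace_centralizer)
    fix y assume y: "y \<in> orth_compl Q cJ"
    have "y - P y \<in> M"
      using P(1)[of y] P(2)[of y] y cJ_orth Q_commute by (auto simp: M_def orth_compl_def Q_simps)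
    then have "y = P y" using \<open>M \<subseteq> {0}\<close> by auto
    then have "y \<in> J" using P(1)[of y] by simp
    then show "Q m y = 0" using m by (auto simp: orth_compl_def)
  qed
  then show ?thesis using x by (simp add: cJ_def centralizer_def)
qed

end

section \<open>Ideals of a subalgebra and the derived algebra\<close>

lemma subspace_dim_le_imp_eq:
  fixes B I J :: "'e::real_vector set"
  assumes "finite B" "span B = UNIV" "subspace I" "subspace J" "I \<subseteq> J" "dim J \<le> dim I"
  shows "I = J"
proof (rule ccontr)
  assume "I \<noteq> J"
  then obtain x where x: "x \<in> J" "x \<notin> I" using assms(5) by blast
  obtain C where C: "C \<subseteq> I" "independent C" "I \<subseteq> span C" "card C = dim I"
    by (rule basis_exists)
  obtain D where D: "D \<subseteq> J" "independent D" "J \<subseteq> span D" "card D = dim J"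
    by (rule basis_exists)
  have fin: "finite C" "finite D"
    using independent_span_bound[of B C] independent_span_bound[of B D] C D assms by auto
  have "x \<notin> span C" using C(1) x(2) assms(3) span_minimal by blast
  then have "independent (insert x C)" "x \<notin> C"
    using C(2) span_base by (auto simp: independent_insert)
  moreover have "insert x C \<subseteq> span D" using C(1) D(3) x(1) assms(5) by blast
  ultimately have "card (insert x C) \<le> card D"
    using independent_span_bound[of D "insert x C"] fin by blast
  then show False using \<open>x \<notin> C\<close> fin C(4) D(4) assms(6) by simp
qed

context compact_lie_algebra
begin

definition ideal_in :: "'e set \<Rightarrow> 'e set \<Rightarrow> bool" where
  "ideal_in I h \<longleftrightarrow> subspace I \<and> I \<subseteq> h \<and> (\<forall>x\<in>h. \<forall>y\<in>I. br x y \<in> I)"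

lemma ideal_in_complement:
  assumes "subspace h" "\<And>x y. x \<in> h \<Longrightarrow> y \<in> h \<Longrightarrow> br x y \<in> h" "ideal_in I h" "ideal_in J h"
  shows "ideal_in (J \<inter> orth_compl Q I) h"
  using assms unfolding ideal_in_def
  by (auto simp: orth_compl_def skew Q_simps intro!: subspace_inter subspace_orth_compl[unfolded orth_compl_def])

lemma ideal_in_proj:
  assumes "subspace h" "ideal_in I h" "z \<in> h"
  shows "orth_proj Q I z \<in> I" "z - orth_proj Q I z \<in> h \<inter> orth_compl Q I"
  using assms unfolding ideal_in_def
  by (auto simp: orth_proj_in orth_proj_diff intro!: subspace_diff)

text \<open>The ideal contains [x, [x, y]], which is therefore orthogonal to y; by skewness
  |[x, y]|^2 = 0.\<close>

lemma ideal_in_commutes: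
  assumes "ideal_in I h" "x \<in> I" "y \<in> h" "y \<in> orth_compl Q I"
  shows "br x y = 0" "br y x = 0"
proof -
  have yx: "br y x \<in> I" using assms by (auto simp: ideal_in_def)
  have "x \<in> h" using assms by (auto simp: ideal_in_def)
  have "Q (br x y) (br x y) = - Q y (br x (br x y))" by (rule skew)
  also have "br x (br x y) = - br x (br y x)" using antisym[of x y] by (simp add: br_simps)
  also have "br x (br y x) \<in> I" using yx \<open>x \<in> h\<close> assms(1) by (auto simp: ideal_in_def)
  then have "- Q y (- br x (br y x)) = 0" using assms(4) by (auto simp: orth_compl_def Q_simps)
  finally show "br x y = 0" using Q_eq_0_iff by blast
  then show "br y x = 0" using br_eq_0_commute by blast
qed

lemma br_ideal_decomp:
  assumes "subspace h" "ideal_in I h" "x \<in> h" "y \<in> h"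
  defines "p \<equiv> orth_proj Q I"
  shows "br x y = br (p x) (p y) + br (x - p x) (y - p y)"
proof -
  have "br (p x) (y - p y) = 0" "br (x - p x) (p y) = 0"
    using ideal_in_proj[OF assms(1,2)] assms(3,4) ideal_in_commutes[OF assms(2)]
    unfolding p_def by auto
  then show ?thesis by (simp add: br_simps)
qed

text \<open>The component of an element of \<open>h\<close> orthogonal to \<open>J\<close> commutes
  with \<open>J\<close>, so only the component in \<open>J\<close> acts on \<open>I\<close>.\<close>

lemma ideal_in_ideal:
  assumes h: "subspace h" and J: "ideal_in J h"
    and I: "subspace I" "I \<subseteq> J" "\<And>x y. x \<in> J \<Longrightarrow> y \<in> I \<Longrightarrow> br x y \<in> I"
  shows "ideal_in I h"
proof -
  have "br z i \<in> I" if z: "z \<in> h" and i: "i \<in> I" for z i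
  proof -
    let ?p = "orth_proj Q J z"
    have "br (z - ?p) i = 0"
      using ideal_in_proj[OF h J z] ideal_in_commutes[OF J, of i "z - ?p"] i I by auto
    then have "br z i = br ?p i" by (simp add: br_simps)
    then show ?thesis using I(3) i ideal_in_proj[OF h J z] by simp
  qed
  then show ?thesis using I J by (auto simp: ideal_in_def)
qed

text \<open>Projecting to \<open>J\<close> factors through the projection to \<open>h\<close>, and
  in \<open>h\<close> brackets split orthogonally along \<open>J\<close> and its complement. The
  same constant works.\<close>

lemma proj_bounded_ideal:
  assumes h: "subspace h" "\<And>x y. x \<in> h \<Longrightarrow> y \<in> h \<Longrightarrow> br x y \<in> h"
    and J: "ideal_in J h" and bd: "proj_bounded h"
  shows "proj_bounded J"
proof -
  let ?P = "orth_proj Q h" and ?p = "orth_proj Q J"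
  have sJ: "subspace J" "J \<subseteq> h" using J by (auto simp: ideal_in_def)
  have pP: "?p (?P X) = ?p X" for X
  proof (rule orth_proj_eqI[OF sJ(1) orth_proj_in[OF sJ(1)], symmetric])
    have "Q X w = Q (?p (?P X)) w" if "w \<in> J" for w
    proof -
      have "Q (?p (?P X)) w = Q (?P X) w" by (rule Q_orth_proj_left[OF sJ(1) that])
      also have "\<dots> = Q X w" using Q_orth_proj_left[OF h(1)] that sJ by auto
      finally show ?thesis by simp
    qed
    then show "X - ?p (?P X) \<in> orth_compl Q J" by (simp add: orth_compl_def Q_simps)
  qed
  have le: "Q (br (?p x) (?p y)) (br (?p x) (?p y)) \<le> Q (br x y) (br x y)" if "x \<in> h" "y \<in> h" for x y
  proof -
    let ?a = "br (?p x) (?p y)" and ?b = "br (x - ?p x) (y - ?p y)"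
    have e: "br x y = ?a + ?b" by (rule br_ideal_decomp[OF h(1) J that])
    have "ideal_in (h \<inter> orth_compl Q J) h"
      by (rule ideal_in_complement[OF h J]) (use h in \<open>auto simp: ideal_in_def\<close>)
    then have "?b \<in> orth_compl Q J"
      using ideal_in_proj(2)[OF h(1) J] that unfolding ideal_in_def by blast
    moreover have "?a \<in> J" using J ideal_in_proj(1)[OF h(1) J] that by (auto simp: ideal_in_def)
    ultimately have "Q ?b ?a = 0" by (auto simp: orth_compl_def)
    then show ?thesis
      unfolding e using Q_nonneg[of ?b] Q_commute[of ?a ?b] by (simp add: Q_simps)
  qed
  obtain K where K: "\<And>X Y. Q (br (?P X) (?P Y)) (br (?P X) (?P Y)) \<le> K * Q (br X Y) (br X Y)"
    using bd unfolding proj_bounded_def by blast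
  have "Q (br (?p X) (?p Y)) (br (?p X) (?p Y)) \<le> K * Q (br X Y) (br X Y)" for X Y
    using le[OF orth_proj_in[OF h(1)] orth_proj_in[OF h(1)], of X Y] K[of X Y] unfolding pP by simp
  then show ?thesis unfolding proj_bounded_def by blast
qed

text \<open>The ideal \<open>N\<close> of elements commuting with the normal space of
  \<open>h\<close> has an abelian complement \<open>h'\<close> in \<open>h\<close>, so every bracket
  in \<open>h\<close> is a bracket in \<open>N\<close>. Otherwise a nonabelian ideal of least
  dimension in \<open>h'\<close> would be simple, hence commute with its own orthogonal complement
  and so lie in \<open>N\<close>.\<close>

lemma proj_bounded_derived_commutes:
  assumes h: "subspace h" "\<And>x y. x \<in> h \<Longrightarrow> y \<in> h \<Longrightarrow> br x y \<in> h"
    and bd: "proj_bounded h" and x: "x \<in> h" and y: "y \<in> h" and m: "m \<in> orth_compl Q h"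
  shows "br (br x y) m = 0"
proof -
  define N where "N = {b \<in> h. \<forall>m\<in>orth_compl Q h. br b m = 0}"
  have h_perp: "br a k \<in> orth_compl Q h" if "a \<in> h" "k \<in> orth_compl Q h" for a k
    using that h(2) by (auto simp: orth_compl_def skew Q_simps)
  have N: "ideal_in N h"
    unfolding ideal_in_def
  proof (intro conjI ballI)
    show "subspace N"
      using h(1) by (auto simp: N_def subspace_def br_simps)
    fix a b assume ab: "a \<in> h" "b \<in> N"
    have "br (br a b) k = 0" if "k \<in> orth_compl Q h" for k
      using jacobi[of a b k] ab that h_perp by (simp add: N_def br_simps)
    then show "br a b \<in> N" using ab h by (simp add: N_def)
  qed (auto simp: N_def)
  have hh: "ideal_in h h" using h by (simp add: ideal_in_def)
  define h' where "h' = h \<inter> orth_compl Q N"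
  have h': "ideal_in h' h" unfolding h'_def by (rule ideal_in_complement[OF h N hh])
  have abelian: "br a b = 0" if "a \<in> h'" "b \<in> h'" for a b
  proof (rule ccontr)
    assume "br a b \<noteq> 0"
    let ?A = "\<lambda>J. ideal_in J h \<and> J \<subseteq> h' \<and> (\<exists>a\<in>J. \<exists>b\<in>J. br a b \<noteq> 0)"
    have "?A h'" using that h' \<open>br a b \<noteq> 0\<close> by blast
    from ex_has_least_nat[of ?A, OF this, of dim] obtain J
      where J: "?A J" and min: "\<And>I. ?A I \<Longrightarrow> dim J \<le> dim I" by blast
    obtain B :: "'e set" where B: "finite B" "span B = UNIV" using finite_dim by blast
    have min_eq: "I = J" if "?A I" "I \<subseteq> J" for I
      using subspace_dim_le_imp_eq[OF B _ _ that(2)] min[OF that(1)] J that(1)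
      by (auto simp: ideal_in_def)
    have J1: "ideal_in J h" "subspace J" "J \<subseteq> h" "J \<subseteq> h'"
      using J by (auto simp: ideal_in_def)
    obtain a b where ab: "a \<in> J" "b \<in> J" "br a b \<noteq> 0" using J by blast
    have simple: "I = {0} \<or> I = J"
      if I: "subspace I" "I \<subseteq> J" "\<And>x y. x \<in> J \<Longrightarrow> y \<in> I \<Longrightarrow> br x y \<in> I" for I
    proof (cases "\<exists>a\<in>I. \<exists>b\<in>I. br a b \<noteq> 0")
      case True
      then have "I = J" using ideal_in_ideal[OF h(1) J1(1) I] I J1 by (intro min_eq) blast+
      then show ?thesis ..
    next
      case False
      have Ih: "ideal_in I h" by (rule ideal_in_ideal[OF h(1) J1(1) I])
      \<comment> \<open>\<open>I\<close> is abelian here, and |[z, i]|^2 = Q(z, [i, [z, i]])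
        contains a bracket of two of its elements.\<close>
      have central: "br i z = 0 \<and> br z i = 0" if "z \<in> h" "i \<in> I" for z i
      proof -
        have "br z i \<in> I" using that Ih by (auto simp: ideal_in_def)
        then have "Q (br z i) (br z i) = 0"
          using False that unfolding assoc[of z i] by (auto simp: Q_simps)
        then show ?thesis using Q_eq_0_iff br_eq_0_commute by blast
      qed
      \<comment> \<open>Splitting off a central ideal keeps all brackets, so by minimality the
        complement is all of \<open>J\<close> and \<open>I\<close> is orthogonal to itself.\<close>
      let ?I' = "J \<inter> orth_compl Q I" and ?p = "orth_proj Q I"
      have I': "ideal_in ?I' h" by (rule ideal_in_complement[OF h Ih J1(1)])
      have abh: "a \<in> h" "b \<in> h" using ab J1 by auto
      have "br a b = br (a - ?p a) (b - ?p b)"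
        using br_ideal_decomp[OF h(1) Ih abh] central[of "?p b" "?p a"]
          ideal_in_proj(1)[OF h(1) Ih] abh Ih by (auto simp: ideal_in_def)
      moreover have "a - ?p a \<in> ?I'" "b - ?p b \<in> ?I'"
        using ideal_in_proj[OF h(1) Ih] abh ab I J1 by (auto intro!: subspace_diff)
      ultimately have "\<exists>a\<in>?I'. \<exists>b\<in>?I'. br a b \<noteq> 0" using ab(3) by metis
      then have "?I' = J" using I' J1 by (intro min_eq) blast+
      then have "I \<subseteq> orth_compl Q I" using I by blast
      then have "I \<subseteq> {0}" using Q_eq_0_iff by (auto simp: orth_compl_def)
      then show ?thesis using subspace_0[OF I(1)] by auto
    qed
    have "br z k = 0" if "z \<in> J" "k \<in> orth_compl Q J" for z k
    proof (rule simple_proj_bounded_commutes[OF J1(2) _ simple ab _ that])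
      show "br x y \<in> J" if "x \<in> J" "y \<in> J" for x y using that J1 by (auto simp: ideal_in_def)
      show "proj_bounded J" by (rule proj_bounded_ideal[OF h J1(1) bd])
    qed
    then have "J \<subseteq> N" using J1(3) by (auto simp: N_def orth_compl_def)
    moreover have "J \<subseteq> orth_compl Q N" using J1(4) by (auto simp: h'_def)
    ultimately have "J \<subseteq> {0}" using Q_eq_0_iff by (fastforce simp: orth_compl_def)
    then show False using ab by (auto simp: br_simps)
  qed
  let ?p = "orth_proj Q N"
  have "br x y = br (?p x) (?p y)"
    using br_ideal_decomp[OF h(1) N x y] abelian ideal_in_proj(2)[OF h(1) N] x y
    by (simp add: h'_def)
  moreover have "br (?p x) (?p y) \<in> N"
    using N ideal_in_proj(1)[OF h(1) N] x y by (auto simp: ideal_in_def)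
  ultimately show ?thesis using m by (simp add: N_def)
qed

text \<open>Substituting \<open>u = \<phi>\<^sup>-\<^sup>1 X\<close>, \<open>v = \<phi>\<^sup>-\<^sup>1 Y\<close>, where \<open>Q\<^sub>t(x,y) = Q(\<phi> x,y)\<close>, makes the coefficient of
  \<open>|[P X, P Y]|\<^sup>2\<close> in the curvature \<open>\<langle>R(u,v)v,u\<rangle>\<close> negative, while all other terms contain \<open>[X,Y]\<close>.\<close>

lemma nonneg_curvature_imp_proj_bounded:
  assumes h: "subspace h" "\<And>x y. x \<in> h \<Longrightarrow> y \<in> h \<Longrightarrow> br x y \<in> h"
    and t: "t > 1"
    and koszul: "\<And>u v w. 2 * rescaled_product Q h t (nab u v) w =
      rescaled_product Q h t (br u v) w - rescaled_product Q h t v (br u w) - rescaled_product Q h t u (br v w)"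
    and nonneg: "\<And>u v. rescaled_product Q h t (nab u (nab v v) - nab v (nab u v) - nab (br u v) v) u \<ge> 0"
  shows "proj_bounded h"
proof -
  define P where "P = orth_proj Q h"
  \<comment> \<open>Chosen so that \<open>x - r *\<^sub>R P x\<close> inverts \<phi>: on
    \<open>h\<close> the map \<phi> is multiplication by \<open>t\<close>, and 1 - r = 1/t.\<close>
  define r where "r = 1 - 1 / t"
  have r: "0 < r" "r < 1" "t * (1 - r) = 1" using t by (auto simp: r_def)
  define \<phi> where "\<phi> x = x + (t - 1) *\<^sub>R P x" for x
  have linP: "P (x + y) = P x + P y" "P (x - y) = P x - P y" "P (a *\<^sub>R x) = a *\<^sub>R P x" "P (- x) = - P x" for x y a
    unfolding P_def using orth_proj_linear[OF h(1)]
    by (simp_all add: linear_add linear_scale linear_diff linear_neg)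
  have Ph: "P x \<in> h" "z \<in> h \<Longrightarrow> P z = z" "z \<in> h \<Longrightarrow> Q (P x) z = Q x z" "z \<in> h \<Longrightarrow> Q z (P x) = Q z x" for x z
    by (simp_all add: P_def h orth_proj_in orth_proj_id Q_orth_proj_left Q_orth_proj_right)
  have PP: "P (P x) = P x" for x by (simp add: Ph)
  have PbrP: "P (br a (P y)) = br a (P y)" if "a \<in> h" for a y
    using Ph h that by simp
  have Pbr: "P (br a y) = br a (P y)" if a: "a \<in> h" for a y
  proof (rule Q_nondegenerate)
    fix z
    have "Q (P (br a y)) z = Q (br a y) (P z)"
      using Ph(3)[of "P z" "br a y"] Ph(4)[of "P (br a y)" z] Ph(1) by simp
    also have "\<dots> = - Q y (br a (P z))" by (rule skew)
    also have "\<dots> = - Q (P y) (br a (P z))" using Ph(3)[of "br a (P z)" y] Ph(1) h(2) a by simp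
    also have "\<dots> = Q (br a (P y)) (P z)" by (simp add: skew)
    also have "\<dots> = Q (br a (P y)) z" using Ph(4)[of "br a (P y)" z] Ph(1) h(2) a by simp
    finally show "Q (P (br a y)) z = Q (br a (P y)) z" .
  qed
  have Qt: "rescaled_product Q h t x y = Q (\<phi> x) y" for x y
    using Ph(3)[of "P y" x] Ph(4)[of "P x" y] Ph(1)
    by (simp add: rescaled_product_def \<phi>_def Q_simps algebra_simps flip: P_def)
  have \<phi>_sym: "Q (\<phi> x) y = Q x (\<phi> y)" for x y
    using Ph(3)[of "P y" x] Ph(4)[of "P x" y] Ph(1) by (simp add: \<phi>_def Q_simps)
  have \<phi>_lin: "\<phi> (x + y) = \<phi> x + \<phi> y" "\<phi> (x - y) = \<phi> x - \<phi> y" "\<phi> (a *\<^sub>R x) = a *\<^sub>R \<phi> x" for x y a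
    by (simp_all add: \<phi>_def linP algebra_simps)
  have \<phi>_inj: "x = 0" if "\<phi> x = 0" for x
  proof -
    have "0 = Q (\<phi> x) x" by (simp add: that Q_simps)
    also have "\<dots> = Q x x + (t - 1) * Q (P x) (P x)"
      using Ph(4)[of "P x" x] Ph(1) by (simp add: \<phi>_def Q_simps)
    finally have "Q x x \<le> 0" using t Q_nonneg[of "P x"] by (smt (verit) mult_nonneg_nonneg)
    then show ?thesis using Q_pos[of x] by force
  qed
  \<comment> \<open>\<alpha> and \<beta> are the coefficients of \<open>Q c E\<close> and
    \<open>Q E E\<close> in the expanded curvature.\<close>
  define \<alpha> where "\<alpha> = - 3 * r + 3 * t / 2 * (2 * r - r\<^sup>2)"
  define \<beta> where "\<beta> = r * (2 * r - r\<^sup>2) - 3 * t / 4 * (2 * r - r\<^sup>2)\<^sup>2 + r\<^sup>2"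
  \<comment> \<open>Multiplication by 1 - r = 1/t removes \<open>t\<close> and leaves -r^3 (1 -
    r/4). It is negative because t > 1 makes r positive; for t < 1 the sign would be
    reversed.\<close>
  have \<beta>: "\<beta> < 0"
  proof -
    have tr: "t * x * (1 - r) = x" for x using r(3) by (metis mult.commute mult.left_commute mult.right_neutral)
    have "(a - 3 * t / 4 * q + b) * (1 - r) = (a + b) * (1 - r) - 3 / 4 * (t * q * (1 - r))" for a b q
      by (simp add: field_simps)
    then have "\<beta> * (1 - r) = (r * (2 * r - r\<^sup>2) + r\<^sup>2) * (1 - r) - 3 / 4 * (t * (2 * r - r\<^sup>2)\<^sup>2 * (1 - r))"
      unfolding \<beta>_def .
    also have "\<dots> = - (r ^ 3 * (1 - r / 4))"
      unfolding tr by (simp add: algebra_simps power2_eq_square power3_eq_cube)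
    also have "\<dots> < 0" using r by simp
    finally show ?thesis using r by (simp add: mult_less_0_iff)
  qed
  \<comment> \<open>The right side is the curvature term at u = X - r P X, v = Y - r P Y, so a
    negative \<beta> lets \<open>c\<close> bound \<open>E\<close>.\<close>
  have key: "0 \<le> 1 / 4 * (Q c c - Q (P c) (P c)) + (1 - 3 * t / 4) * Q (P c) (P c) + \<alpha> * Q c E + \<beta> * Q E E"
    if "c = br X Y" "E = br (P X) (P Y)" for X Y c E
  proof -
    define u where "u = X - r *\<^sub>R P X"
    define v where "v = Y - r *\<^sub>R P Y"
    define a1 where "a1 = br (P X) Y"
    define a2 where "a2 = br X (P Y)"
    have \<phi>uv: "\<phi> u = X" "\<phi> v = Y"
    proof -
      have "(t - 1) * (1 - r) = r" using r(3) by (simp add: algebra_simps)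
      moreover have "\<phi> (x - r *\<^sub>R P x) = x + ((t - 1) * (1 - r) - r) *\<^sub>R P x" for x
        by (simp add: \<phi>_def linP PP algebra_simps)
      ultimately show "\<phi> u = X" "\<phi> v = Y" by (simp_all add: u_def v_def)
    qed
    \<comment> \<open>The Koszul formula gives 2 \<phi>(nab u v) = \<phi>[u, v] + r S with S =
      [x, P y] - [P x, y]. Since S has no component in \<open>h\<close>, \<phi> fixes it and can be
      cancelled.\<close>
    have nab: "2 *\<^sub>R nab (x - r *\<^sub>R P x) (y - r *\<^sub>R P y) =
      br (x - r *\<^sub>R P x) (y - r *\<^sub>R P y) + r *\<^sub>R (br x (P y) - br (P x) y)"
      if "\<phi> (x - r *\<^sub>R P x) = x" "\<phi> (y - r *\<^sub>R P y) = y" for x y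
    proof -
      let ?u = "x - r *\<^sub>R P x" and ?v = "y - r *\<^sub>R P y"
      let ?S = "br x (P y) - br (P x) y"
      have "P (br x (P y)) = P (br (P x) y)"
        using Pbr[OF Ph(1), of x y] Pbr[OF Ph(1), of y x] antisym[of x "P y"] antisym[of "P x" "P y"]
        by (simp add: linP)
      then have \<phi>S: "\<phi> ?S = ?S" by (simp add: \<phi>_def linP)
      have "\<phi> (2 *\<^sub>R nab ?u ?v) = \<phi> (br ?u ?v + r *\<^sub>R ?S)"
      proof (rule Q_nondegenerate)
        fix w
        have "Q (\<phi> (2 *\<^sub>R nab ?u ?v)) w = Q (\<phi> (br ?u ?v)) w - Q y (br ?u w) - Q x (br ?v w)"
          using koszul[of ?u ?v w, unfolded Qt that]
          by (simp only: \<phi>_lin(3) bilinear_lmul[OF bilinear_Q] real_scaleR_def)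
        also have "\<dots> = Q (\<phi> (br ?u ?v)) w - Q (br y ?u + br x ?v) w"
          by (simp add: assoc Q_simps)
        also have "br y ?u + br x ?v = - (r *\<^sub>R ?S)"
          using antisym[of y x] antisym[of y "P x"] by (simp add: br_simps algebra_simps)
        finally show "Q (\<phi> (2 *\<^sub>R nab ?u ?v)) w = Q (\<phi> (br ?u ?v + r *\<^sub>R ?S)) w"
          unfolding \<phi>_lin(1)[of "br ?u ?v"] \<phi>_lin(3)[of r ?S] \<phi>S
          by (simp only: bilinear_ladd[OF bilinear_Q] bilinear_lneg[OF bilinear_Q] diff_minus_eq_add)
      qed
      then have "\<phi> (2 *\<^sub>R nab ?u ?v - (br ?u ?v + r *\<^sub>R ?S)) = 0" by (simp add: \<phi>_lin)
      then show ?thesis using \<phi>_inj by fastforce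
    qed
    define w where "w = br u v"
    define S where "S = a2 - a1"
    have Pa: "P a1 = E" "P a2 = E"
      using Pbr[OF Ph(1), of X Y] Pbr[OF Ph(1), of Y X] antisym[of X "P Y"] antisym[of "P X" "P Y"]
      by (simp_all add: linP a1_def a2_def that)
    have Ep: "E \<in> h" using Ph h by (simp add: that)
    have \<phi>S: "\<phi> S = S" by (simp add: \<phi>_def S_def linP Pa)
    have w: "w = c - r *\<^sub>R a1 - r *\<^sub>R a2 + r\<^sup>2 *\<^sub>R E"
      by (simp add: w_def u_def v_def a1_def a2_def that br_simps power2_eq_square algebra_simps)
    have wv: "br v u = - w" unfolding w_def by (rule antisym)
    have half: "x = (1/2) *\<^sub>R y" if "2 *\<^sub>R x = y" for x y :: 'e
      using that[symmetric] by simp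
    have nuv: "nab u v = (1/2) *\<^sub>R (w + r *\<^sub>R S)"
      unfolding w_def S_def a1_def a2_def
      by (rule half) (rule nab[of X Y, folded u_def v_def, OF \<phi>uv])
    have "2 *\<^sub>R nab v u = br v u + r *\<^sub>R (br Y (P X) - br (P Y) X)"
      by (rule nab[of Y X, folded u_def v_def, OF \<phi>uv(2,1)])
    also have "\<dots> = - w + r *\<^sub>R S"
      using antisym[of Y "P X"] antisym[of "P Y" X] by (simp add: wv S_def a1_def a2_def)
    finally have nvu: "nab v u = (1/2) *\<^sub>R (- w + r *\<^sub>R S)" by (rule half)
    have nself: "nab (x - r *\<^sub>R P x) (x - r *\<^sub>R P x) = r *\<^sub>R br x (P x)" if "\<phi> (x - r *\<^sub>R P x) = x" for x
      using half[OF nab[OF that that]] antisym[of "P x" x] by (simp add: br_self flip: scaleR_2)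
    have nuu: "nab u u = r *\<^sub>R br X (P X)" and nvv: "nab v v = r *\<^sub>R br Y (P Y)"
      by (rule nself[of X, folded u_def, OF \<phi>uv(1)], rule nself[of Y, folded v_def, OF \<phi>uv(2)])
    have P0: "P (br x (P x)) = 0" for x
      using Pbr[OF Ph(1), of x x] antisym[of x "P x"] by (simp add: br_self linP)
    \<comment> \<open>\<open>nab a\<close> is skew for the rescaled product. This moves the outer
      \<open>nab\<close> of an iterated one to the other factor, so that \<open>t1\<close> and
      \<open>t2\<close> involve only the computed values.\<close>
    have metric: "Q (\<phi> (nab a b)) d = - Q (\<phi> (nab a d)) b" for a b d
    proof -
      have sym: "Q (\<phi> x) y = Q (\<phi> y) x" for x y using \<phi>_sym Q_commute by metis
      show ?thesis
        using koszul[of a b d, unfolded Qt] koszul[of a d b, unfolded Qt]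
          sym[of d "br a b"] sym[of b "br a d"] antisym[of d b]
        by (simp add: Q_simps)
    qed
    have t1: "Q (\<phi> (nab u (nab v v))) u = - r\<^sup>2 * Q (br X (P X)) (br Y (P Y))"
      using metric[of u "nab v v" u]
      by (simp add: nuu nvv \<phi>_lin Q_simps power2_eq_square) (simp add: \<phi>_def P0)
    have t2: "Q (\<phi> (nab v (nab u v))) u = - (1/4) * (r\<^sup>2 * Q S S - Q (\<phi> w) w)"
      using metric[of v "nab u v" u] \<phi>_sym[of w S] Q_commute[of S w]
      by (simp add: nuv nvu \<phi>_lin \<phi>S Q_simps power2_eq_square algebra_simps)
    have t3: "2 * Q (\<phi> (nab w v)) u = Q w (- 2 *\<^sub>R c + r *\<^sub>R a1 + r *\<^sub>R a2) + Q (\<phi> w) w"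
    proof -
      have "2 * Q (\<phi> (nab w v)) u = Q (br w v) X - Q (br w u) Y + Q (\<phi> w) w"
        using koszul[of w v u] by (simp add: Qt wv \<phi>_sym \<phi>uv Q_simps Q_commute[of Y])
      also have "Q (br w v) X - Q (br w u) Y = Q w (br v X - br u Y)" by (simp add: assoc Q_simps)
      also have "br v X - br u Y = - 2 *\<^sub>R c + r *\<^sub>R a1 + r *\<^sub>R a2"
        using antisym[of Y X] antisym[of "P Y" X]
        by (simp add: u_def v_def a1_def a2_def that br_simps algebra_simps scaleR_2)
      finally show ?thesis .
    qed
    \<comment> \<open>The Jacobi identity trades the brackets [X, P X] and [Y, P Y] for
      \<open>a1\<close>, \<open>a2\<close>, \<open>c\<close> and \<open>E\<close>.\<close>
    have t4: "Q (br X (P X)) (br Y (P Y)) = - Q a1 a2 + Q c E"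
    proof -
      have "Q (br X (P X)) (br Y (P Y)) = Q X (br (P X) (br Y (P Y)))" by (rule assoc)
      also have "br (P X) (br Y (P Y)) = br a1 (P Y) + br Y E"
        by (simp add: jacobi[of "P X" Y "P Y"] a1_def that)
      also have "Q X (br a1 (P Y)) = - Q a1 a2"
        using assoc[of X a1 "P Y"] skew[of a1 X "P Y"] skew[of X a1 "P Y"] antisym[of X a1]
        by (simp add: a2_def Q_simps)
      then have "Q X (br a1 (P Y) + br Y E) = - Q a1 a2 + Q c E"
        by (simp add: Q_simps that assoc)
      finally show ?thesis .
    qed
    have "0 \<le> Q (\<phi> (nab u (nab v v) - nab v (nab u v) - nab w v)) u"
      using nonneg[of u v] by (simp add: Qt w_def)
    also have "\<dots> = - r\<^sup>2 * (- Q a1 a2 + Q c E) + (1/4) * (r\<^sup>2 * Q S S - Q (\<phi> w) w)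
        - (1/2) * (Q w (- 2 *\<^sub>R c + r *\<^sub>R a1 + r *\<^sub>R a2) + Q (\<phi> w) w)"
      using t1 t2 t3 t4 by (simp add: \<phi>_lin Q_simps)
    also have "Q (\<phi> w) w = Q w w + (t - 1) * Q (P w) (P w)"
      using Ph(4)[of "P w" w] Ph(1) by (simp add: \<phi>_def Q_simps)
    also have "P w = P c - (2 * r - r\<^sup>2) *\<^sub>R E"
      using Ph(2)[OF Ep] by (simp add: w linP Pa algebra_simps scaleR_2 flip: scaleR_scaleR)
    finally have ge: "0 \<le> - r\<^sup>2 * (- Q a1 a2 + Q c E)
      + (1/4) * (r\<^sup>2 * Q S S - (Q w w + (t - 1) * Q (P c - (2 * r - r\<^sup>2) *\<^sub>R E) (P c - (2 * r - r\<^sup>2) *\<^sub>R E)))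
      - (1/2) * (Q w (- 2 *\<^sub>R c + r *\<^sub>R a1 + r *\<^sub>R a2)
          + (Q w w + (t - 1) * Q (P c - (2 * r - r\<^sup>2) *\<^sub>R E) (P c - (2 * r - r\<^sup>2) *\<^sub>R E)))" .
    have aE: "Q a1 E = Q E E" "Q a2 E = Q E E" "Q E a1 = Q E E" "Q E a2 = Q E E"
      "Q (P c) E = Q c E" "Q E (P c) = Q c E" "Q E c = Q c E"
      using Ph(3)[OF Ep, of a1] Ph(3)[OF Ep, of a2] Ph(4)[OF Ep, of a1] Ph(4)[OF Ep, of a2]
        Ph(3)[OF Ep, of c] Ph(4)[OF Ep, of c] Q_commute[of E c] by (simp_all add: Pa)
    \<comment> \<open>The products of \<open>a1\<close> and \<open>a2\<close> with each other, with
      themselves and with \<open>c\<close> cancel; their products with \<open>E\<close> equal |E|^2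
      by \<open>aE\<close> and enter \<beta>.\<close>
    show ?thesis
      using ge unfolding w S_def \<alpha>_def \<beta>_def
      by (simp add: Q_simps aE Q_commute[of a2 a1] Q_commute[of a1 c] Q_commute[of a2 c])
        (simp add: field_simps power2_eq_square)
  qed
  define k where "k = - \<beta>"
  have k: "k > 0" using \<beta> by (simp add: k_def)
  \<comment> \<open>Completing the square bounds \<alpha> Q(c, E) by \<alpha>^2/(2k) |c|^2 + (k/2)
    |E|^2, which uses up half of k |E|^2. The other summands bound the terms in \<open>c\<close> and
    \<open>P c\<close>, as |P c| \<le> |c|.\<close>
  define M where "M = 1/4 + \<bar>1 - 3 * t / 4\<bar> + \<alpha>\<^sup>2 / (2 * k)"
  have "Q E E \<le> (2 * M / k) * Q c c" if "c = br X Y" "E = br (P X) (P Y)" for X Y c E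
  proof -
    have pp: "0 \<le> Q (P c) (P c)" "Q (P c) (P c) \<le> Q c c"
    proof -
      have "Q (P c) (P c) = Q (P c) c" using Ph(4)[of "P c" c] Ph(1) by simp
      moreover have "0 \<le> Q (c - P c) (c - P c)" by (rule Q_nonneg)
      ultimately show "Q (P c) (P c) \<le> Q c c" by (simp add: Q_simps Q_commute[of c "P c"])
    qed (rule Q_nonneg)
    have "0 \<le> Q (\<alpha> *\<^sub>R c - k *\<^sub>R E) (\<alpha> *\<^sub>R c - k *\<^sub>R E)" by (rule Q_nonneg)
    then have "2 * k * (\<alpha> * Q c E) \<le> \<alpha>\<^sup>2 * Q c c + k\<^sup>2 * Q E E"
      by (simp add: Q_simps Q_commute[of E c] power2_eq_square algebra_simps)
    then have "\<alpha> * Q c E \<le> (\<alpha>\<^sup>2 * Q c c + k\<^sup>2 * Q E E) / (2 * k)"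
      using k by (simp add: field_simps)
    also have "\<dots> = \<alpha>\<^sup>2 / (2 * k) * Q c c + k / 2 * Q E E"
      using k by (simp add: field_simps power2_eq_square)
    finally have 1: "\<alpha> * Q c E \<le> \<alpha>\<^sup>2 / (2 * k) * Q c c + k / 2 * Q E E" .
    have "(1 - 3 * t / 4) * Q (P c) (P c) \<le> \<bar>1 - 3 * t / 4\<bar> * Q (P c) (P c)"
      using pp(1) by (intro mult_right_mono) auto
    also have "\<dots> \<le> \<bar>1 - 3 * t / 4\<bar> * Q c c" using pp by (intro mult_left_mono) auto
    finally have 2: "(1 - 3 * t / 4) * Q (P c) (P c) \<le> \<bar>1 - 3 * t / 4\<bar> * Q c c" .
    have "k * Q E E \<le> M * Q c c + k / 2 * Q E E"
    proof -
      have "M * Q c c = 1/4 * Q c c + \<bar>1 - 3 * t / 4\<bar> * Q c c + \<alpha>\<^sup>2 / (2 * k) * Q c c"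
        by (simp only: M_def distrib_right)
      moreover have "\<beta> * Q E E = - (k * Q E E)" by (simp add: k_def)
      moreover have "k / 2 * Q E E = k * Q E E / 2" by simp
      ultimately show ?thesis using key[OF that] 1 2 pp by argo
    qed
    then have "k / 2 * Q E E \<le> M * Q c c" by simp
    then show ?thesis using k by (simp add: field_simps)
  qed
  then show ?thesis unfolding proj_bounded_def P_def by blast
qed

end

section \<open>Calculus of \<open>C\<^sup>k\<close> maps\<close>

lemma frechet_derivative_eq:
  "(f has_derivative f') (at x) \<Longrightarrow> frechet_derivative f (at x) = f'"
  using frechet_derivative_at by metis

lemma Ck_on_subset: "Ck_on k S f \<Longrightarrow> T \<subseteq> S \<Longrightarrow> Ck_on k T f"
  by (induction k arbitrary: f) (auto intro: continuous_on_subset)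

text \<open>The congruence property is a hypothesis because \<open>Ck_on_cong\<close> is itself
  proved by induction through this lemma; \<open>Ck_on_SucI'\<close> discharges it.\<close>

lemma Ck_on_SucI:
  fixes f :: "'a::real_normed_vector \<Rightarrow> 'b::real_normed_vector"
  assumes "open S" "\<And>x. x \<in> S \<Longrightarrow> (f has_derivative f' x) (at x)"
    and "\<And>v. Ck_on k S (\<lambda>x. f' x v)"
    and cong: "\<And>(f::'a \<Rightarrow> 'b) g. (\<And>x. x \<in> S \<Longrightarrow> f x = g x) \<Longrightarrow> Ck_on k S f \<Longrightarrow> Ck_on k S g"
  shows "Ck_on (Suc k) S f"
proof -
  have "f' x v = frechet_derivative f (at x) v" if "x \<in> S" for x v
    using frechet_derivative_eq[OF assms(2)[OF that]] by simp
  then have "Ck_on k S (\<lambda>x. frechet_derivative f (at x) v)" for v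
    by (intro cong[OF _ assms(3), of v]) auto
  then show ?thesis using assms(2) by (auto simp: differentiable_def)
qed

lemma Ck_on_SucD:
  assumes "Ck_on (Suc k) S f" "x \<in> S"
  shows "(f has_derivative frechet_derivative f (at x)) (at x)"
  using assms by (simp add: frechet_derivative_works)

lemma Ck_on_cong:
  assumes "open S" "\<And>x. x \<in> S \<Longrightarrow> f x = g x" "Ck_on k S f"
  shows "Ck_on k S g"
  using assms(2,3)
proof (induction k arbitrary: f g)
  case 0
  then show ?case using continuous_on_cong[of S S f g] by simp
next
  case (Suc k)
  show ?case
  proof (rule Ck_on_SucI[OF assms(1)])
    fix x assume x: "x \<in> S"
    show "(g has_derivative frechet_derivative f (at x)) (at x)"
      by (rule has_derivative_transform_within_open[OF Ck_on_SucD[OF Suc.prems(2) x] assms(1) x Suc.prems(1)])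
  qed (use Suc in auto)
qed

lemma Ck_on_SucI':
  assumes "open S" "\<And>x. x \<in> S \<Longrightarrow> (f has_derivative f' x) (at x)"
    and "\<And>v. Ck_on k S (\<lambda>x. f' x v)"
  shows "Ck_on (Suc k) S f"
  by (rule Ck_on_SucI) (use assms Ck_on_cong[OF assms(1)] in blast)+

lemma Ck_on_Suc_imp: "Ck_on (Suc k) S f \<Longrightarrow> Ck_on k S f"
proof (induction k arbitrary: f)
  case 0
  then show ?case
    by (auto intro!: continuous_at_imp_continuous_on differentiable_imp_continuous_within)
qed auto

lemma Ck_on_const: "open S \<Longrightarrow> Ck_on k S (\<lambda>x. c)"
  by (induction k arbitrary: c) (auto intro: Ck_on_SucI' continuous_intros)

lemma Ck_on_add:
  assumes "open S"
  shows "Ck_on k S f \<Longrightarrow> Ck_on k S g \<Longrightarrow> Ck_on k S (\<lambda>x. f x + g x)"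
proof (induction k arbitrary: f g)
  case (Suc k)
  show ?case
    by (rule Ck_on_SucI'[OF assms has_derivative_add[OF Ck_on_SucD[OF Suc.prems(1)] Ck_on_SucD[OF Suc.prems(2)]]])
      (use Suc assms in auto)
qed (auto intro: continuous_intros)

lemma Ck_on_sum:
  assumes "open S" "finite I" "\<And>i. i \<in> I \<Longrightarrow> Ck_on k S (f i)"
  shows "Ck_on k S (\<lambda>x. \<Sum>i\<in>I. f i x)"
  using assms(2,3)
  by (induction I rule: finite_induct) (auto intro: Ck_on_add Ck_on_const assms(1))

lemma Ck_on_bounded_linear:
  assumes "open S" "bounded_linear L"
  shows "Ck_on k S f \<Longrightarrow> Ck_on k S (\<lambda>x. L (f x))"
proof (induction k arbitrary: f)
  case 0
  then show ?case using bounded_linear.continuous_on[OF assms(2)] by simp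
next
  case (Suc k)
  show ?case
    by (rule Ck_on_SucI'[OF assms(1) bounded_linear.has_derivative[OF assms(2) Ck_on_SucD[OF Suc.prems]]])
      (use Suc assms in auto)
qed

lemma Ck_on_bounded_bilinear:
  assumes "open S" "bounded_bilinear m"
  shows "Ck_on k S f \<Longrightarrow> Ck_on k S g \<Longrightarrow> Ck_on k S (\<lambda>x. m (f x) (g x))"
proof (induction k arbitrary: f g)
  case 0
  then show ?case using bounded_bilinear.continuous_on[OF assms(2)] by simp
next
  case (Suc k)
  show ?case
    by (rule Ck_on_SucI'[OF assms(1) bounded_bilinear.FDERIV[OF assms(2) Ck_on_SucD[OF Suc.prems(1)] Ck_on_SucD[OF Suc.prems(2)]]])
      (use Suc Ck_on_Suc_imp[OF Suc.prems(1)] Ck_on_Suc_imp[OF Suc.prems(2)] assms in \<open>auto intro!: Ck_on_add\<close>)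
qed

lemma Ck_on_id: "open S \<Longrightarrow> Ck_on k S (\<lambda>x. x)"
  by (cases k) (auto intro!: Ck_on_SucI'[of S "\<lambda>x. x" "\<lambda>x v. v"] Ck_on_const)

lemma Ck_on_Pair:
  assumes "open S" "Ck_on k S f" "Ck_on k S g"
  shows "Ck_on k S (\<lambda>x. (f x, g x))"
proof -
  have "bounded_linear (\<lambda>x. (x, 0))" "bounded_linear (\<lambda>y. (0, y))"
    by (auto intro!: bounded_linear_Pair bounded_linear_ident bounded_linear_zero)
  then have "Ck_on k S (\<lambda>x. (f x, 0) + (0, g x))"
    using assms by (intro Ck_on_add) (auto intro: Ck_on_bounded_linear[where L = "\<lambda>x. (x, 0)"] Ck_on_bounded_linear[where L = "\<lambda>y. (0, y)"])
  then show ?thesis by simp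
qed

lemma Ck_on_frechet_derivative:
  "Ck_on (Suc k) S f \<Longrightarrow> Ck_on k S (\<lambda>x. frechet_derivative f (at x) v)"
  by simp

lemma frechet_derivative_cong_nhds:
  assumes "\<forall>\<^sub>F y in nhds x. f y = g y"
  shows "frechet_derivative f (at x) = frechet_derivative g (at x)"
proof -
  obtain S where S: "open S" "x \<in> S" "\<And>y. y \<in> S \<Longrightarrow> f y = g y"
    using assms unfolding eventually_nhds by blast
  have "(f has_derivative f') (at x) \<longleftrightarrow> (g has_derivative f') (at x)" for f'
    using S has_derivative_transform_within_open[of f f' x UNIV S g]
      has_derivative_transform_within_open[of g f' x UNIV S f] by auto
  then show ?thesis by (simp add: frechet_derivative_def)
qed

context finite_dim_space
begin

text \<open>The derivative of the composite applies a varying operator to a varying vector.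
  Expanding the vector in \<open>B\<close> turns it into a finite sum of products of scalar
  functions with derivatives in fixed directions, to which the induction applies.\<close>

lemma Ck_on_compose:
  fixes f :: "'d::real_normed_vector \<Rightarrow> 'e" and g :: "'e \<Rightarrow> 'f::real_normed_vector"
  assumes "open S" "open T" "f ` S \<subseteq> T"
  shows "Ck_on k T g \<Longrightarrow> Ck_on k S f \<Longrightarrow> Ck_on k S (\<lambda>x. g (f x))"
proof (induction k arbitrary: g)
  case 0
  then show ?case using assms(3) continuous_on_compose2 by auto
next
  case (Suc k)
  have fT: "f x \<in> T" if "x \<in> S" for x using assms(3) that by auto
  have lin: "linear (frechet_derivative g (at (f x)))" if "x \<in> S" for x
    using Ck_on_SucD[OF Suc.prems(1) fT[OF that]] has_derivative_linear by blast
  show ?case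
  proof (rule Ck_on_SucI'[OF assms(1)])
    fix x assume x: "x \<in> S"
    have "((\<lambda>x. g (f x)) has_derivative
        (\<lambda>v. frechet_derivative g (at (f x)) (frechet_derivative f (at x) v))) (at x)"
      by (rule has_derivative_compose[OF Ck_on_SucD[OF Suc.prems(2) x] Ck_on_SucD[OF Suc.prems(1) fT[OF x]]])
    then show "((\<lambda>x. g (f x)) has_derivative (\<lambda>v. \<Sum>b\<in>B. (frechet_derivative f (at x) v \<bullet> b) *\<^sub>R
        frechet_derivative g (at (f x)) b)) (at x)"
      by (subst (asm) linear_expand[OF lin[OF x]])
  next
    fix v
    show "Ck_on k S (\<lambda>x. \<Sum>b\<in>B. (frechet_derivative f (at x) v \<bullet> b) *\<^sub>R frechet_derivative g (at (f x)) b)"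
    proof (intro Ck_on_sum assms(1) finite_B Ck_on_bounded_bilinear[OF assms(1) bounded_bilinear_scaleR])
      fix b
      show "Ck_on k S (\<lambda>x. frechet_derivative f (at x) v \<bullet> b)"
        by (rule Ck_on_bounded_linear[OF assms(1) bounded_linear_inner_left]) (use Suc.prems in simp)
      show "Ck_on k S (\<lambda>x. frechet_derivative g (at (f x)) b)"
        by (rule Suc.IH) (use Suc.prems in \<open>auto intro: Ck_on_Suc_imp\<close>)
    qed
  qed
qed

text \<open>Product rule for an operator-valued map that is known only through its values at fixed
  vectors.\<close>

lemma has_derivative_op_apply:
  fixes A :: "'d::real_normed_vector \<Rightarrow> 'e \<Rightarrow> 'f::real_normed_vector"
  assumes S: "open S" "x \<in> S" "\<And>y. y \<in> S \<Longrightarrow> linear (A y)"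
    and A: "\<And>v. ((\<lambda>y. A y v) has_derivative A' v) (at x)"
    and f: "(f has_derivative f') (at x)"
  shows "((\<lambda>y. A y (f y)) has_derivative (\<lambda>u. A' (f x) u + A x (f' u))) (at x)"
proof -
  have D: "((\<lambda>y. \<Sum>b\<in>B. (f y \<bullet> b) *\<^sub>R A y b) has_derivative
      (\<lambda>u. \<Sum>b\<in>B. (f x \<bullet> b) *\<^sub>R A' b u + (f' u \<bullet> b) *\<^sub>R A x b)) (at x)" if "(f has_derivative f') (at x)" for f f'
    by (auto intro!: derivative_eq_intros A that)
  have e: "(\<Sum>b\<in>B. (w \<bullet> b) *\<^sub>R A y b) = A y w" if "y \<in> S" for y w
    using linear_expand[OF S(3)[OF that], of w] by simp
  have tr: "((\<lambda>y. A y (f y)) has_derivative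
      (\<lambda>u. \<Sum>b\<in>B. (f x \<bullet> b) *\<^sub>R A' b u + (f' u \<bullet> b) *\<^sub>R A x b)) (at x)" if "(f has_derivative f') (at x)" for f f'
    by (rule has_derivative_transform_within_open[OF D[OF that] S(1,2)]) (rule e)
  \<comment> \<open>The case of a constant \<open>f\<close> identifies the expanded sum with
    \<open>A' v\<close>, although linearity of \<open>A'\<close> is not yet available.\<close>
  have "(\<Sum>b\<in>B. (v \<bullet> b) *\<^sub>R A' b u) = A' v u" for v u
    using has_derivative_unique[OF A[of v] tr[OF has_derivative_const[of v]]] by (auto dest: fun_cong)
  then show ?thesis
    using tr[OF f] e[OF S(2)] by (simp add: sum.distrib)
qed

lemma linear_derivative_parameter:
  fixes A :: "'d::real_normed_vector \<Rightarrow> 'e \<Rightarrow> 'f::real_normed_vector"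
  assumes S: "open S" "x \<in> S" "\<And>y. y \<in> S \<Longrightarrow> linear (A y)"
    and A: "\<And>v. ((\<lambda>y. A y v) has_derivative A' v) (at x)"
  shows "linear (\<lambda>v. A' v u)"
proof (rule linearI)
  have tr: "(g has_derivative g') (at x)" if "(f has_derivative g') (at x)" "\<And>y. y \<in> S \<Longrightarrow> f y = g y"
    for f g :: "'d \<Rightarrow> 'f" and g'
    by (rule has_derivative_transform_within_open[OF that(1) S(1,2) that(2)])
  fix v w :: 'e and r :: real
  have "((\<lambda>y. A y (v + w)) has_derivative (\<lambda>u. A' v u + A' w u)) (at x)"
    by (rule tr[OF has_derivative_add[OF A[of v] A[of w]]]) (simp add: S(3) linear_add)
  then show "A' (v + w) u = A' v u + A' w u"
    using has_derivative_unique[OF A[of "v + w"]] by metis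
  have "((\<lambda>y. A y (r *\<^sub>R v)) has_derivative (\<lambda>u. r *\<^sub>R A' v u)) (at x)"
    by (rule tr[OF has_derivative_scaleR_right[OF A[of v]]]) (simp add: S(3) linear_scale)
  then show "A' (r *\<^sub>R v) u = r *\<^sub>R A' v u"
    using has_derivative_unique[OF A[of "r *\<^sub>R v"]] by metis
qed

lemma finite_dim_space_Pair:
  obtains C :: "('e \<times> 'e) set" where "finite_dim_space C"
proof (rule finite_dim_space_exists)
  let ?C = "(\<lambda>b. (b, 0)) ` B \<union> (\<lambda>b. (0, b)) ` B :: ('e \<times> 'e) set"
  show "finite ?C" using finite_B by simp
  have "(x, y) \<in> span ?C" for x y
  proof -
    have "(\<Sum>b\<in>B. (x \<bullet> b) *\<^sub>R (b, 0)) + (\<Sum>b\<in>B. (y \<bullet> b) *\<^sub>R (0, b)) \<in> span ?C"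
      by (intro span_add span_sum span_scale span_base) auto
    also have "(\<Sum>b\<in>B. (x \<bullet> b) *\<^sub>R (b, 0)) + (\<Sum>b\<in>B. (y \<bullet> b) *\<^sub>R (0, b)) = (x, y)"
      using expand[of x] expand[of y] by (simp add: prod_eq_iff fst_sum snd_sum)
    finally show ?thesis .
  qed
  then show "span ?C = UNIV" by auto
qed

lemma Ck_on_compose_Pair:
  fixes f g :: "'d::real_normed_vector \<Rightarrow> 'e" and h :: "'e \<times> 'e \<Rightarrow> 'f::real_normed_vector"
  assumes "open S" "open T" "\<And>x. x \<in> S \<Longrightarrow> (f x, g x) \<in> T" "Ck_on k T h" "Ck_on k S f" "Ck_on k S g"
  shows "Ck_on k S (\<lambda>x. h (f x, g x))"
proof -
  obtain C :: "('e \<times> 'e) set" where "finite_dim_space C" by (rule finite_dim_space_Pair)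
  then show ?thesis
    by (rule finite_dim_space.Ck_on_compose[OF _ assms(1,2) _ assms(4) Ck_on_Pair[OF assms(1,5,6)]])
      (use assms(3) in auto)
qed

end

text \<open>Two applications of the mean value theorem turn the quotient into a value of the
  continuous function \<open>D\<close> at a nearby point. Its numerator is symmetric in
  \<open>u\<close> and \<open>v\<close>, which yields the symmetry of second derivatives.\<close>

lemma second_difference_limit:
  fixes F :: "'e::real_normed_vector \<Rightarrow> real" and u v :: 'e
  assumes F: "Ck_on 2 S F" and S: "open S" "x \<in> S" and e: "e > 0"
  defines "D \<equiv> \<lambda>y. frechet_derivative (\<lambda>y. frechet_derivative F (at y) u) (at y) v"
  shows "\<exists>d>0. \<forall>s. 0 < s \<and> s < d \<longrightarrow>
    \<bar>(F (x + s *\<^sub>R u + s *\<^sub>R v) - F (x + s *\<^sub>R u) - F (x + s *\<^sub>R v) + F x) / s\<^sup>2 - D x\<bar> < e"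
proof -
  define G where "G = (\<lambda>y. frechet_derivative F (at y) u)"
  have F2: "Ck_on (Suc (Suc 0)) S F" using F by (simp add: numeral_2_eq_2)
  have G1: "Ck_on (Suc 0) S G" using F2 unfolding G_def Ck_on.simps by blast
  have "continuous_on S D" using F2 unfolding D_def by simp
  then have "isCont D x" using S continuous_on_eq_continuous_at by blast
  then obtain d1 where d1: "d1 > 0" "\<And>y. dist y x < d1 \<Longrightarrow> \<bar>D y - D x\<bar> < e"
    using e unfolding continuous_at_eps_delta dist_real_def by blast
  obtain d2 where d2: "d2 > 0" "ball x d2 \<subseteq> S" using S open_contains_ball by blast
  \<comment> \<open>The summand 1 makes \<open>K\<close> positive and \<open>s * K\<close> strictly
    larger than the distances of the sample points from \<open>x\<close>.\<close>
  define K where "K = norm u + norm v + 1"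
  define d where "d = min d1 d2 / K"
  have K: "K > 0" by (simp add: K_def add_nonneg_pos)
  have near: "dist (x + a *\<^sub>R u + b *\<^sub>R v) x < min d1 d2" if "0 \<le> a" "a \<le> s" "0 \<le> b" "b \<le> s" "s < d" "0 < s" for a b s
  proof -
    have "dist (x + a *\<^sub>R u + b *\<^sub>R v) x = norm (a *\<^sub>R u + b *\<^sub>R v)" by (simp add: dist_norm add.assoc)
    also have "\<dots> \<le> a * norm u + b * norm v"
      using norm_triangle_ineq[of "a *\<^sub>R u" "b *\<^sub>R v"] that by simp
    also have "\<dots> \<le> s * norm u + s * norm v" using that by (intro add_mono mult_right_mono) auto
    also have "\<dots> < s * K" using that by (simp add: K_def distrib_left)
    also have "\<dots> < min d1 d2" using that K by (simp add: d_def field_simps)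
    finally show ?thesis .
  qed
  have inS: "x + a *\<^sub>R u + b *\<^sub>R v \<in> S" if "0 \<le> a" "a \<le> s" "0 \<le> b" "b \<le> s" "s < d" "0 < s" for a b s
    using near[OF that] d2(2) by (auto simp: dist_commute)
  show ?thesis
  proof (intro exI[of _ d] conjI allI impI)
    show "d > 0" using d1 d2 K by (simp add: d_def)
    fix s :: real assume s: "0 < s \<and> s < d"
    define f where "f a = F (x + a *\<^sub>R u + s *\<^sub>R v) - F (x + a *\<^sub>R u + 0 *\<^sub>R v)" for a
    have DF: "((\<lambda>a. F (x + a *\<^sub>R u + b *\<^sub>R v)) has_real_derivative G (x + a *\<^sub>R u + b *\<^sub>R v)) (at a)"
      if "0 \<le> a" "a \<le> s" "0 \<le> b" "b \<le> s" for a b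
    proof -
      let ?y = "x + a *\<^sub>R u + b *\<^sub>R v"
      have "(F has_derivative frechet_derivative F (at ?y)) (at ?y)"
        using Ck_on_SucD[OF F2] inS[of a s b] that s by blast
      moreover have "((\<lambda>a. x + a *\<^sub>R u + b *\<^sub>R v) has_derivative (\<lambda>h. h *\<^sub>R u)) (at a)"
        by (auto intro!: derivative_eq_intros)
      ultimately have "((\<lambda>a. F (x + a *\<^sub>R u + b *\<^sub>R v)) has_derivative (\<lambda>h. frechet_derivative F (at ?y) (h *\<^sub>R u))) (at a)"
        by (rule has_derivative_compose[rotated])
      moreover have "frechet_derivative F (at ?y) (h *\<^sub>R u) = G ?y * h" for h
        using has_derivative_linear[OF \<open>(F has_derivative _) _\<close>] by (simp add: G_def linear_scale)
      ultimately show ?thesis by (simp add: has_field_derivative_def)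
    qed
    have "\<exists>z>0. z < s \<and> f s - f 0 = (s - 0) * (G (x + z *\<^sub>R u + s *\<^sub>R v) - G (x + z *\<^sub>R u + 0 *\<^sub>R v))"
      unfolding f_def by (rule MVT2) (use s in \<open>auto intro!: DERIV_diff DF[simplified] DF[of _ 0, simplified]\<close>)
    then obtain a where a: "0 < a" "a < s"
      "f s - f 0 = s * (G (x + a *\<^sub>R u + s *\<^sub>R v) - G (x + a *\<^sub>R u + 0 *\<^sub>R v))"
      by auto
    have DG: "((\<lambda>b. G (x + a *\<^sub>R u + b *\<^sub>R v)) has_real_derivative D (x + a *\<^sub>R u + b *\<^sub>R v)) (at b)"
      if "0 \<le> b" "b \<le> s" for b
    proof -
      let ?y = "x + a *\<^sub>R u + b *\<^sub>R v"
      have "(G has_derivative frechet_derivative G (at ?y)) (at ?y)"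
        using Ck_on_SucD[OF G1] inS[of a s b] that s a by simp
      moreover have "((\<lambda>b. x + a *\<^sub>R u + b *\<^sub>R v) has_derivative (\<lambda>h. h *\<^sub>R v)) (at b)"
        by (auto intro!: derivative_eq_intros)
      ultimately have "((\<lambda>b. G (x + a *\<^sub>R u + b *\<^sub>R v)) has_derivative (\<lambda>h. frechet_derivative G (at ?y) (h *\<^sub>R v))) (at b)"
        by (rule has_derivative_compose[rotated])
      moreover have "frechet_derivative G (at ?y) (h *\<^sub>R v) = D ?y * h" for h
        using has_derivative_linear[OF \<open>(G has_derivative _) _\<close>] by (simp add: D_def G_def linear_scale)
      ultimately show ?thesis by (simp add: has_field_derivative_def)
    qed
    have "\<exists>z>0. z < s \<and> G (x + a *\<^sub>R u + s *\<^sub>R v) - G (x + a *\<^sub>R u + 0 *\<^sub>R v) = (s - 0) * D (x + a *\<^sub>R u + z *\<^sub>R v)"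
      by (rule MVT2) (use s in \<open>auto intro!: DG\<close>)
    then obtain b where b: "0 < b" "b < s"
      "G (x + a *\<^sub>R u + s *\<^sub>R v) - G (x + a *\<^sub>R u + 0 *\<^sub>R v) = s * D (x + a *\<^sub>R u + b *\<^sub>R v)"
      by auto
    have "f s - f 0 = s * (s * D (x + a *\<^sub>R u + b *\<^sub>R v))" unfolding a(3) b(3) ..
    then have "(F (x + s *\<^sub>R u + s *\<^sub>R v) - F (x + s *\<^sub>R u) - F (x + s *\<^sub>R v) + F x) / s\<^sup>2 = D (x + a *\<^sub>R u + b *\<^sub>R v)"
      using s by (simp add: f_def power2_eq_square algebra_simps)
    then show "\<bar>(F (x + s *\<^sub>R u + s *\<^sub>R v) - F (x + s *\<^sub>R u) - F (x + s *\<^sub>R v) + F x) / s\<^sup>2 - D x\<bar> < e"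
      using d1(2) near[of a s b] a b s by auto
  qed
qed

lemma symmetric_second_derivative_real:
  fixes F :: "'e::real_normed_vector \<Rightarrow> real"
  assumes F: "Ck_on 2 S F" and S: "open S" "x \<in> S"
  shows "frechet_derivative (\<lambda>y. frechet_derivative F (at y) u) (at x) v =
    frechet_derivative (\<lambda>y. frechet_derivative F (at y) v) (at x) u" (is "?a = ?b")
proof (rule ccontr)
  assume "?a \<noteq> ?b"
  define e where "e = \<bar>?a - ?b\<bar> / 2"
  have e: "e > 0" using \<open>?a \<noteq> ?b\<close> by (simp add: e_def)
  obtain d1 where d1: "d1 > 0" "\<And>s. 0 < s \<Longrightarrow> s < d1 \<Longrightarrow>
    \<bar>(F (x + s *\<^sub>R u + s *\<^sub>R v) - F (x + s *\<^sub>R u) - F (x + s *\<^sub>R v) + F x) / s\<^sup>2 - ?a\<bar> < e"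
    using second_difference_limit[OF F S e, of u v] by blast
  obtain d2 where d2: "d2 > 0" "\<And>s. 0 < s \<Longrightarrow> s < d2 \<Longrightarrow>
    \<bar>(F (x + s *\<^sub>R v + s *\<^sub>R u) - F (x + s *\<^sub>R v) - F (x + s *\<^sub>R u) + F x) / s\<^sup>2 - ?b\<bar> < e"
    using second_difference_limit[OF F S e, of v u] by blast
  define s where "s = min d1 d2 / 2"
  have s: "0 < s" "s < d1" "s < d2" using d1(1) d2(1) by (auto simp: s_def)
  have swap: "F (x + s *\<^sub>R u + s *\<^sub>R v) - F (x + s *\<^sub>R u) - F (x + s *\<^sub>R v) + F x =
    F (x + s *\<^sub>R v + s *\<^sub>R u) - F (x + s *\<^sub>R v) - F (x + s *\<^sub>R u) + F x"
    by (simp add: add_ac)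
  have "\<bar>?a - ?b\<bar> < 2 * e"
    using d1(2)[OF s(1,2), unfolded swap] d2(2)[OF s(1,3)] by argo
  then show False by (simp add: e_def)
qed

lemma symmetric_second_derivative:
  fixes F :: "'e::real_normed_vector \<Rightarrow> 'f::real_inner"
  assumes F: "Ck_on 2 S F" and S: "open S" "x \<in> S"
  shows "frechet_derivative (\<lambda>y. frechet_derivative F (at y) u) (at x) v =
    frechet_derivative (\<lambda>y. frechet_derivative F (at y) v) (at x) u"
proof (rule vector_eq_rdot[THEN iffD1], intro allI)
  fix w
  have F2: "Ck_on (Suc (Suc 0)) S F" using F by (simp add: numeral_2_eq_2)
  have 1: "frechet_derivative (\<lambda>y. F y \<bullet> w) (at y) u = frechet_derivative F (at y) u \<bullet> w" if "y \<in> S" for y u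
    using frechet_derivative_eq[OF bounded_linear.has_derivative[OF bounded_linear_inner_left Ck_on_SucD[OF F2 that]]] by simp
  have "frechet_derivative (\<lambda>y. frechet_derivative (\<lambda>y. F y \<bullet> w) (at y) u) (at x) v =
    frechet_derivative (\<lambda>y. frechet_derivative F (at y) u) (at x) v \<bullet> w" for u v
  proof -
    have "((\<lambda>y. frechet_derivative F (at y) u) has_derivative frechet_derivative (\<lambda>y. frechet_derivative F (at y) u) (at x)) (at x)"
      using F2 S by (intro Ck_on_SucD[of 0 S]) auto
    then have "((\<lambda>y. frechet_derivative F (at y) u \<bullet> w) has_derivative
        (\<lambda>v. frechet_derivative (\<lambda>y. frechet_derivative F (at y) u) (at x) v \<bullet> w)) (at x)"
      by (rule bounded_linear.has_derivative[OF bounded_linear_inner_left])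
    then have "((\<lambda>y. frechet_derivative (\<lambda>y. F y \<bullet> w) (at y) u) has_derivative
        (\<lambda>v. frechet_derivative (\<lambda>y. frechet_derivative F (at y) u) (at x) v \<bullet> w)) (at x)"
      by (rule has_derivative_transform_within_open[OF _ S]) (simp add: 1)
    then show ?thesis using frechet_derivative_eq by metis
  qed
  moreover have "Ck_on 2 S (\<lambda>y. F y \<bullet> w)"
    by (rule Ck_on_bounded_linear[OF S(1) bounded_linear_inner_left F])
  ultimately show "frechet_derivative (\<lambda>y. frechet_derivative F (at y) u) (at x) v \<bullet> w =
    frechet_derivative (\<lambda>y. frechet_derivative F (at y) v) (at x) u \<bullet> w"
    using symmetric_second_derivative_real[OF _ S, of "\<lambda>y. F y \<bullet> w" u v] by simp
qed

section \<open>Local Lie groups\<close>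

text \<open>Lie group laws in coordinates around the identity \<open>x0\<close>: \<Omega> stands for
  the pairs whose product stays in the chart, \<open>W\<close> for the points whose inverse does.
  Associativity enters through cancellation, translation and conjugation, each restricted to such
  arguments.\<close>

locale local_lie_group = finite_dim_space B for B :: "'e::real_inner set" +
  fixes mu :: "'e \<Rightarrow> 'e \<Rightarrow> 'e" and io :: "'e \<Rightarrow> 'e" and \<Omega> :: "('e \<times> 'e) set"
    and W :: "'e set" and x0 :: 'e
  assumes open_\<Omega>: "open \<Omega>" and open_W: "open W" and x0_W: "x0 \<in> W"
    and Ck_mu: "\<And>k. Ck_on k \<Omega> (\<lambda>p. mu (fst p) (snd p))"
    and Ck_io: "\<And>k. Ck_on k W io"
    and unit_right: "x \<in> W \<Longrightarrow> (x, x0) \<in> \<Omega> \<and> mu x x0 = x"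
    and unit_left: "x \<in> W \<Longrightarrow> (x0, x) \<in> \<Omega> \<and> mu x0 x = x"
    and inverse_left: "x \<in> W \<Longrightarrow> (io x, x) \<in> \<Omega> \<and> mu (io x) x = x0"
    and inverse_right: "x \<in> W \<Longrightarrow> (x, io x) \<in> \<Omega> \<and> mu x (io x) = x0"
    and cancel_left: "x \<in> W \<Longrightarrow> (x, y) \<in> \<Omega> \<Longrightarrow> mu (io x) (mu x y) = y"
    and cancel_right: "x \<in> W \<Longrightarrow> (io x, y) \<in> \<Omega> \<Longrightarrow> mu x (mu (io x) y) = y"
    and translate: "x \<in> W \<Longrightarrow> (x, y) \<in> \<Omega> \<Longrightarrow> mu x y \<in> W \<Longrightarrow> y \<in> W \<Longrightarrow> (x, z) \<in> \<Omega> \<Longrightarrow>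
      (io y, z) \<in> \<Omega> \<Longrightarrow> mu (io (mu x y)) (mu x z) = mu (io y) z"
    and conjugate: "x \<in> W \<Longrightarrow> (x, y) \<in> \<Omega> \<Longrightarrow> (mu x y, io x) \<in> \<Omega> \<Longrightarrow>
      mu (mu (mu x y) (io x)) x = mu x y"
begin

definition DM :: "'e \<times> 'e \<Rightarrow> 'e \<times> 'e \<Rightarrow> 'e" where
  "DM p = frechet_derivative (\<lambda>p. mu (fst p) (snd p)) (at p)"

definition L :: "'e \<Rightarrow> 'e \<Rightarrow> 'e" where
  "L x = frechet_derivative (mu x) (at x0)"

text \<open>The left Maurer--Cartan form.\<close>

definition \<theta> :: "'e \<Rightarrow> 'e \<Rightarrow> 'e" where
  "\<theta> x = frechet_derivative (mu (io x)) (at x)"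

definition R :: "'e \<Rightarrow> 'e \<Rightarrow> 'e" where
  "R x = frechet_derivative (\<lambda>y. mu y x) (at x0)"

text \<open>The adjoint action Ad(x) in coordinates.\<close>

definition conj_deriv :: "'e \<Rightarrow> 'e \<Rightarrow> 'e" where
  "conj_deriv x = frechet_derivative (\<lambda>y. mu (mu x y) (io x)) (at x0)"

definition DL :: "'e \<Rightarrow> 'e \<Rightarrow> 'e" where
  "DL v = frechet_derivative (\<lambda>x. L x v) (at x0)"

definition D\<theta> :: "'e \<Rightarrow> 'e \<Rightarrow> 'e \<Rightarrow> 'e" where
  "D\<theta> x v = frechet_derivative (\<lambda>x. \<theta> x v) (at x)"

text \<open>\<open>L x v\<close> is the left invariant field with value \<open>v\<close> at
  \<open>x0\<close>, and this is the commutator of two such fields at \<open>x0\<close>.\<close>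

definition br :: "'e \<Rightarrow> 'e \<Rightarrow> 'e" where
  "br u v = DL v u - DL u v"

lemma mu_deriv: "p \<in> \<Omega> \<Longrightarrow> ((\<lambda>p. mu (fst p) (snd p)) has_derivative DM p) (at p)"
  unfolding DM_def by (rule Ck_on_SucD[OF Ck_mu])

lemma mu_deriv_right:
  assumes "(x, y) \<in> \<Omega>"
  shows "(mu x has_derivative (\<lambda>v. DM (x, y) (0, v))) (at y)"
proof -
  have "((\<lambda>y. (x, y)) has_derivative (\<lambda>v. (0, v))) (at y)"
    by (auto intro!: derivative_eq_intros)
  from has_derivative_compose[OF this mu_deriv[OF assms]] show ?thesis by simp
qed

lemma mu_deriv_left:
  assumes "(x, y) \<in> \<Omega>"
  shows "((\<lambda>x. mu x y) has_derivative (\<lambda>v. DM (x, y) (v, 0))) (at x)"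
proof -
  have "((\<lambda>x. (x, y)) has_derivative (\<lambda>v. (v, 0))) (at x)"
    by (auto intro!: derivative_eq_intros)
  from has_derivative_compose[OF this mu_deriv[OF assms]] show ?thesis by simp
qed

lemma Ck_DM: "Ck_on k \<Omega> (\<lambda>p. DM p w)"
  unfolding DM_def by (rule Ck_on_frechet_derivative[OF Ck_mu])

lemma L_eq: "x \<in> W \<Longrightarrow> L x v = DM (x, x0) (0, v)"
  unfolding L_def using frechet_derivative_eq[OF mu_deriv_right] unit_right by metis

lemma \<theta>_eq: "x \<in> W \<Longrightarrow> \<theta> x v = DM (io x, x) (0, v)"
  unfolding \<theta>_def using frechet_derivative_eq[OF mu_deriv_right] inverse_left by metis

lemma R_eq: "x \<in> W \<Longrightarrow> R x v = DM (x0, x) (v, 0)"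
  unfolding R_def using frechet_derivative_eq[OF mu_deriv_left] unit_left by metis

lemma L_deriv: "x \<in> W \<Longrightarrow> (mu x has_derivative L x) (at x0)"
  using mu_deriv_right[of x x0] unit_right L_eq by presburger

lemma \<theta>_deriv: "x \<in> W \<Longrightarrow> (mu (io x) has_derivative \<theta> x) (at x)"
  using mu_deriv_right[of "io x" x] inverse_left \<theta>_eq by presburger

lemma R_deriv: "x \<in> W \<Longrightarrow> ((\<lambda>y. mu y x) has_derivative R x) (at x0)"
  using mu_deriv_left[of x0 x] unit_left R_eq by presburger

lemma linear_L: "x \<in> W \<Longrightarrow> linear (L x)"
  using L_deriv has_derivative_linear by blast

lemma linear_\<theta>: "x \<in> W \<Longrightarrow> linear (\<theta> x)"
  using \<theta>_deriv has_derivative_linear by blast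

lemma linear_R: "x \<in> W \<Longrightarrow> linear (R x)"
  using R_deriv has_derivative_linear by blast

lemma Ck_L: "Ck_on k W (\<lambda>x. L x v)"
proof (rule Ck_on_cong[OF open_W])
  show "Ck_on k W (\<lambda>x. DM (x, x0) (0, v))"
    by (rule Ck_on_compose_Pair[OF open_W open_\<Omega> _ Ck_DM])
      (auto simp: unit_right intro: Ck_on_id Ck_on_const open_W)
qed (simp add: L_eq)

lemma Ck_\<theta>: "Ck_on k W (\<lambda>x. \<theta> x v)"
proof (rule Ck_on_cong[OF open_W])
  show "Ck_on k W (\<lambda>x. DM (io x, x) (0, v))"
    by (rule Ck_on_compose_Pair[OF open_W open_\<Omega> _ Ck_DM])
      (auto simp: inverse_left intro: Ck_on_id Ck_io open_W)
qed (simp add: \<theta>_eq)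

lemma DL_deriv: "((\<lambda>x. L x v) has_derivative DL v) (at x0)"
  unfolding DL_def by (rule Ck_on_SucD[OF Ck_L x0_W])

lemma D\<theta>_deriv: "x \<in> W \<Longrightarrow> ((\<lambda>x. \<theta> x v) has_derivative D\<theta> x v) (at x)"
  unfolding D\<theta>_def by (rule Ck_on_SucD[OF Ck_\<theta>])

lemma Ck_D\<theta>: "Ck_on k W (\<lambda>x. D\<theta> x v u)"
  unfolding D\<theta>_def by (rule Ck_on_frechet_derivative[OF Ck_\<theta>])

lemma open_slices: "open {y. (x, y) \<in> \<Omega>}" "open {x. (x, y) \<in> \<Omega>}"
proof -
  have "open (Pair x -` \<Omega>)" "open ((\<lambda>x. (x, y)) -` \<Omega>)"
    by (intro open_vimage open_\<Omega> continuous_intros)+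
  then show "open {y. (x, y) \<in> \<Omega>}" "open {x. (x, y) \<in> \<Omega>}" by (simp_all add: vimage_def)
qed

text \<open>The device by which group laws that hold only near a point are differentiated.\<close>

lemma has_derivative_unique_open:
  assumes "(f has_derivative f') (at x)" "(g has_derivative g') (at x)" "open S" "x \<in> S"
    "\<And>y. y \<in> S \<Longrightarrow> f y = g y"
  shows "f' = g'"
  using has_derivative_unique[OF has_derivative_transform_within_open[OF assms(1,3,4,5)] assms(2)] .

lemma \<theta>_L:
  assumes x: "x \<in> W"
  shows "\<theta> x (L x v) = v"
proof -
  have "(mu (io x) has_derivative \<theta> x) (at (mu x x0))" using \<theta>_deriv x unit_right by simp
  from has_derivative_compose[OF L_deriv[OF x] this]
  have "((\<lambda>y. mu (io x) (mu x y)) has_derivative (\<lambda>v. \<theta> x (L x v))) (at x0)" .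
  from has_derivative_unique_open[OF this has_derivative_ident open_slices(1)[of x]]
  show ?thesis using cancel_left unit_right x by (auto dest: fun_cong)
qed

lemma L_\<theta>:
  assumes x: "x \<in> W"
  shows "L x (\<theta> x v) = v"
proof -
  have "(mu x has_derivative L x) (at (mu (io x) x))" using L_deriv x inverse_left by simp
  from has_derivative_compose[OF \<theta>_deriv[OF x] this]
  have "((\<lambda>y. mu x (mu (io x) y)) has_derivative (\<lambda>v. L x (\<theta> x v))) (at x)" .
  from has_derivative_unique_open[OF this has_derivative_ident open_slices(1)[of "io x"]]
  show ?thesis using cancel_right inverse_left x by (auto dest: fun_cong)
qed

lemma L_x0: "L x0 v = v"
  using has_derivative_unique_open[OF L_deriv[OF x0_W] has_derivative_ident open_W x0_W]
    unit_left by (auto dest: fun_cong)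

lemma R_x0: "R x0 v = v"
  using has_derivative_unique_open[OF R_deriv[OF x0_W] has_derivative_ident open_W x0_W]
    unit_right by (auto dest: fun_cong)

lemma \<theta>_x0: "\<theta> x0 v = v"
  using \<theta>_L[OF x0_W, of v] L_x0 by simp

lemma D\<theta>_x0: "D\<theta> x0 v u = - DL v u"
proof -
  have "((\<lambda>x. \<theta> x (L x v)) has_derivative (\<lambda>u. D\<theta> x0 (L x0 v) u + \<theta> x0 (DL v u))) (at x0)"
    by (rule has_derivative_op_apply[OF open_W x0_W linear_\<theta> D\<theta>_deriv[OF x0_W] DL_deriv])
  from has_derivative_unique_open[OF this has_derivative_const[of v] open_W x0_W]
  have "D\<theta> x0 (L x0 v) u + \<theta> x0 (DL v u) = 0" using \<theta>_L by (auto dest: fun_cong)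
  then show ?thesis by (simp add: L_x0 \<theta>_x0 eq_neg_iff_add_eq_0)
qed

text \<open>Left invariance of the Maurer--Cartan form, obtained as the derivative of (a y)^-1 (a z)
  = y^-1 z at z = y.\<close>

lemma \<theta>_translate:
  assumes "a \<in> W" "(a, y) \<in> \<Omega>" "mu a y \<in> W" "y \<in> W"
  shows "\<theta> (mu a y) (DM (a, y) (0, v)) = \<theta> y v"
proof -
  have "((\<lambda>z. mu (io (mu a y)) (mu a z)) has_derivative (\<lambda>v. \<theta> (mu a y) (DM (a, y) (0, v)))) (at y)"
    by (rule has_derivative_compose[OF mu_deriv_right[OF assms(2)] \<theta>_deriv[OF assms(3)]])
  from has_derivative_unique_open[OF this \<theta>_deriv[OF assms(4)] open_Int[OF open_slices(1)[of a] open_slices(1)[of "io y"]]]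
  show ?thesis using assms inverse_left translate by (auto dest: fun_cong)
qed

text \<open>Differentiating the left invariance \<open>\<theta>(a y) \<circ> d(L\<^sub>a) = \<theta>(y)\<close> at the identity, the second
  derivatives of the multiplication cancel by symmetry.\<close>

lemma maurer_cartan:
  assumes a: "a \<in> W"
  shows "D\<theta> a v u - D\<theta> a u v = - br (\<theta> a u) (\<theta> a v)"
proof -
  define D2 where "D2 v u = frechet_derivative (\<lambda>p. DM p (0, v)) (at (a, x0)) (0, u)" for v u
  have ax0: "(a, x0) \<in> \<Omega>" "mu a x0 = a" using unit_right a by auto
  have sym: "D2 v u = D2 u v" for u v
    unfolding D2_def DM_def by (rule symmetric_second_derivative[OF Ck_mu open_\<Omega> ax0(1)])
  have D2: "((\<lambda>y. DM (a, y) (0, v)) has_derivative D2 v) (at x0)" for v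
  proof -
    have "((\<lambda>y. (a, y)) has_derivative (\<lambda>u. (0, u))) (at x0)"
      by (auto intro!: derivative_eq_intros)
    from has_derivative_compose[OF this Ck_on_SucD[OF Ck_DM[of "Suc 0"] ax0(1)]]
    show ?thesis by (simp add: D2_def[abs_def])
  qed
  define V where "V = ({y. (a, y) \<in> \<Omega>} \<inter> mu a -` W) \<inter> W"
  have "continuous_on {y. (a, y) \<in> \<Omega>} (mu a)"
    by (auto intro!: continuous_at_imp_continuous_on has_derivative_continuous[OF mu_deriv_right])
  then have "open ({y. (a, y) \<in> \<Omega>} \<inter> mu a -` W)"
    by (intro continuous_open_preimage open_slices open_W)
  then have V: "open V" "x0 \<in> V"
    using ax0 a x0_W unfolding V_def by (auto intro: open_W)
  have eq: "D\<theta> a (L a v) (L a u) + \<theta> a (D2 v u) = D\<theta> x0 v u" for u v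
  proof -
    have 1: "((\<lambda>y. \<theta> (mu a y) w) has_derivative (\<lambda>u. D\<theta> a w (L a u))) (at x0)" for w
      using has_derivative_compose[OF L_deriv[OF a], of "\<lambda>x. \<theta> x w"] D\<theta>_deriv[OF a, of w] ax0(2) by simp
    have "((\<lambda>y. \<theta> (mu a y) (DM (a, y) (0, v))) has_derivative
       (\<lambda>u. D\<theta> a (DM (a, x0) (0, v)) (L a u) + \<theta> (mu a x0) (D2 v u))) (at x0)"
      by (rule has_derivative_op_apply[OF V _ 1 D2]) (auto simp: V_def intro: linear_\<theta>)
    from has_derivative_unique_open[OF this D\<theta>_deriv[OF x0_W, of v] V]
    have "(\<lambda>u. D\<theta> a (DM (a, x0) (0, v)) (L a u) + \<theta> (mu a x0) (D2 v u)) = D\<theta> x0 v"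
      using \<theta>_translate a by (auto simp: V_def)
    then show ?thesis using L_eq[OF a] ax0(2) by (auto dest: fun_cong)
  qed
  have "D\<theta> a (L a v) (L a u) - D\<theta> a (L a u) (L a v) = - br u v" for u v
  proof -
    have "D\<theta> a (L a v) (L a u) = D\<theta> x0 v u - \<theta> a (D2 v u)" for u v
      unfolding eq[symmetric] by simp
    then show ?thesis using sym[of v u] by (simp add: D\<theta>_x0 br_def)
  qed
  from this[of "\<theta> a v" "\<theta> a u"] show ?thesis by (simp add: L_\<theta> a)
qed

lemma bilinear_br: "bilinear br"
proof -
  have "linear (\<lambda>v. DL v u)" for u
    by (rule linear_derivative_parameter[OF open_W x0_W linear_L DL_deriv])
  moreover have "linear (DL v)" for v using DL_deriv has_derivative_linear by blast
  ultimately show ?thesis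
    unfolding bilinear_def br_def by (auto intro: linear_compose_sub)
qed

lemma br_antisym: "br x y = - br y x"
  by (simp add: br_def)

lemma D\<theta>_second_symmetric:
  "frechet_derivative (\<lambda>x. D\<theta> x v u) (at x0) w = frechet_derivative (\<lambda>x. D\<theta> x v w) (at x0) u"
  unfolding D\<theta>_def by (rule symmetric_second_derivative[OF Ck_\<theta> open_W x0_W])

lemma D\<theta>_second_deriv:
  "((\<lambda>x. D\<theta> x v u) has_derivative frechet_derivative (\<lambda>x. D\<theta> x v u) (at x0)) (at x0)"
  by (rule Ck_on_SucD[OF Ck_D\<theta> x0_W])

text \<open>Differentiating the Maurer--Cartan equation at \<open>x0\<close> gives \<open>E\<close>.
  In the cyclic sum the second derivatives of \<theta> cancel by symmetry, and what remains is the
  Jacobi identity.\<close>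

lemma br_jacobi: "br x (br y z) = br (br x y) z + br y (br x z)"
proof -
  define H where "H w u v = frechet_derivative (\<lambda>x. D\<theta> x v u) (at x0) w" for w u v
  have E: "H w u v - H w v u = br (D\<theta> x0 v w) u - br (D\<theta> x0 u w) v" for u v w
  proof -
    have "((\<lambda>x. D\<theta> x v u - D\<theta> x u v) has_derivative (\<lambda>w. H w u v - H w v u)) (at x0)"
      unfolding H_def by (rule has_derivative_diff[OF D\<theta>_second_deriv D\<theta>_second_deriv])
    moreover have "((\<lambda>x. - br (\<theta> x u) (\<theta> x v)) has_derivative
        (\<lambda>w. - (br (\<theta> x0 u) (D\<theta> x0 v w) + br (D\<theta> x0 u w) (\<theta> x0 v)))) (at x0)"
      by (rule has_derivative_minus[OF bounded_bilinear.FDERIV[OF bilinear_imp_bounded[OF bilinear_br]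
        D\<theta>_deriv[OF x0_W] D\<theta>_deriv[OF x0_W]]])
    ultimately have "(\<lambda>w. H w u v - H w v u) = (\<lambda>w. - (br (\<theta> x0 u) (D\<theta> x0 v w) + br (D\<theta> x0 u w) (\<theta> x0 v)))"
      by (rule has_derivative_unique_open[OF _ _ open_W x0_W]) (rule maurer_cartan)
    then show ?thesis using br_antisym[of u "D\<theta> x0 v w"] by (auto simp: \<theta>_x0 dest!: fun_cong[of _ _ w])
  qed
  have H: "H w u v = H u w v" for u v w
    unfolding H_def by (rule D\<theta>_second_symmetric)
  note sub = bilinear_lsub[OF bilinear_br] bilinear_lneg[OF bilinear_br]
  have MC: "D\<theta> x0 u w - D\<theta> x0 w u = br u w" for u w
    using maurer_cartan[OF x0_W, of u w] br_antisym[of w u] by (simp add: \<theta>_x0)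
  have "0 = (H z x y - H z y x) + (H x y z - H x z y) + (H y z x - H y x z)"
    using H[of z x y] H[of z y x] H[of y x z] by simp
  also have "\<dots> = br (D\<theta> x0 y z - D\<theta> x0 z y) x + br (D\<theta> x0 z x - D\<theta> x0 x z) y + br (D\<theta> x0 x y - D\<theta> x0 y x) z"
    unfolding E by (simp add: sub)
  finally have "br (br x y) z + br (br y z) x + br (br z x) y = 0"
    unfolding MC by (simp add: add_ac)
  moreover have "br (br y z) x = - br x (br y z)" by (rule br_antisym)
  moreover have "br (br z x) y = br y (br x z)"
    using br_antisym[of "br z x" y] br_antisym[of z x] by (simp add: bilinear_rneg[OF bilinear_br])
  ultimately have "(br (br x y) z + br y (br x z)) - br x (br y z) = 0"
    by (simp add: algebra_simps)
  then show ?thesis by (simp only: right_minus_eq)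
qed

lemma conj_deriv_deriv:
  assumes x: "x \<in> W"
  shows "((\<lambda>y. mu (mu x y) (io x)) has_derivative conj_deriv x) (at x0)"
    and "conj_deriv x v = DM (x, io x) (L x v, 0)"
proof -
  have "((\<lambda>z. mu z (io x)) has_derivative (\<lambda>v. DM (x, io x) (v, 0))) (at (mu x x0))"
    using mu_deriv_left[of x "io x"] inverse_right x unit_right by simp
  from has_derivative_compose[OF L_deriv[OF x] this]
  have 1: "((\<lambda>y. mu (mu x y) (io x)) has_derivative (\<lambda>v. DM (x, io x) (L x v, 0))) (at x0)" .
  then show "conj_deriv x v = DM (x, io x) (L x v, 0)"
    unfolding conj_deriv_def using frechet_derivative_eq by metis
  show "((\<lambda>y. mu (mu x y) (io x)) has_derivative conj_deriv x) (at x0)"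
    unfolding conj_deriv_def frechet_derivative_eq[OF 1] by (rule 1)
qed

lemma open_conj_domain:
  assumes x: "x \<in> W"
  defines "N \<equiv> {y. (x, y) \<in> \<Omega> \<and> (mu x y, io x) \<in> \<Omega>}"
  shows "open N" "x0 \<in> N"
proof -
  have "continuous_on {y. (x, y) \<in> \<Omega>} (mu x)"
    by (auto intro!: continuous_at_imp_continuous_on has_derivative_continuous[OF mu_deriv_right])
  then have "open ({y. (x, y) \<in> \<Omega>} \<inter> mu x -` {z. (z, io x) \<in> \<Omega>})"
    by (intro continuous_open_preimage open_slices)
  also have "{y. (x, y) \<in> \<Omega>} \<inter> mu x -` {z. (z, io x) \<in> \<Omega>} = N" by (auto simp: N_def)
  finally show "open N" .
  show "x0 \<in> N" using x unit_right inverse_right by (simp add: N_def)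
qed

lemma Ck_conj:
  assumes x: "x \<in> W"
  shows "Ck_on k {y. (x, y) \<in> \<Omega> \<and> (mu x y, io x) \<in> \<Omega>} (\<lambda>y. mu (mu x y) (io x))"
proof -
  let ?N = "{y. (x, y) \<in> \<Omega> \<and> (mu x y, io x) \<in> \<Omega>}"
  note N = open_conj_domain(1)[OF x]
  have "Ck_on k ?N (\<lambda>y. mu (fst (x, y)) (snd (x, y)))"
    by (rule Ck_on_compose_Pair[OF N open_\<Omega> _ Ck_mu]) (auto intro: Ck_on_id Ck_on_const N)
  then have "Ck_on k ?N (mu x)" by simp
  then have "Ck_on k ?N (\<lambda>y. mu (fst (mu x y, io x)) (snd (mu x y, io x)))"
    by (intro Ck_on_compose_Pair[OF N open_\<Omega> _ Ck_mu]) (auto intro: Ck_on_const N)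
  then show ?thesis by simp
qed

text \<open>From (x y x^-1) x = x y. It ties Ad to the left and right translations, so that Ad can
  be differentiated without computing the derivative of the inversion.\<close>

lemma R_conj_deriv:
  assumes x: "x \<in> W"
  shows "R x (conj_deriv x v) = L x v"
proof -
  have C0: "mu (mu x x0) (io x) = x0" using unit_right inverse_right x by simp
  have "((\<lambda>y. mu y x) has_derivative R x) (at (mu (mu x x0) (io x)))" unfolding C0 by (rule R_deriv[OF x])
  from has_derivative_compose[OF conj_deriv_deriv(1)[OF x] this]
  have 1: "((\<lambda>y. mu (mu (mu x y) (io x)) x) has_derivative (\<lambda>v. R x (conj_deriv x v))) (at x0)" .
  from has_derivative_unique_open[OF 1 L_deriv[OF x] open_conj_domain[OF x]]
  show ?thesis using conjugate x by (auto dest: fun_cong)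
qed

text \<open>The derivative of Ad is ad. In \<open>R_conj_deriv\<close>, symmetry of the second
  derivatives of \<open>mu\<close> makes \<open>DL u w\<close> the derivative of
  \<open>R x w\<close> in direction \<open>u\<close>; solving for the derivative of
  \<open>conj_deriv\<close> leaves \<open>DL v u - DL u v\<close>.\<close>

lemma conj_deriv_has_derivative:
  "((\<lambda>x. conj_deriv x v) has_derivative (\<lambda>u. br u v)) (at x0)"
proof -
  have DM_deriv: "((\<lambda>x. DM (x, io x) (w, 0)) has_derivative
      frechet_derivative (\<lambda>x. DM (x, io x) (w, 0)) (at x0)) (at x0)" for w
  proof (rule Ck_on_SucD[OF _ x0_W])
    show "Ck_on (Suc 0) W (\<lambda>x. DM (x, io x) (w, 0))"
      by (rule Ck_on_compose_Pair[OF open_W open_\<Omega> _ Ck_DM])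
        (auto simp: inverse_right simp del: Ck_on.simps intro: Ck_on_id Ck_io open_W)
  qed
  have lin: "linear (\<lambda>w. DM (x, io x) (w, 0))" if "x \<in> W" for x
    using has_derivative_linear[OF mu_deriv_left] inverse_right that by blast
  \<comment> \<open>Only the existence of a derivative is taken from this formula; its value comes
    from the identity with \<open>R\<close>.\<close>
  obtain A' where "((\<lambda>x. DM (x, io x) (L x v, 0)) has_derivative A') (at x0)"
    using has_derivative_op_apply[OF open_W x0_W lin DM_deriv DL_deriv[of v]] by blast
  then have A': "((\<lambda>x. conj_deriv x v) has_derivative A') (at x0)"
    by (rule has_derivative_transform_within_open[OF _ open_W x0_W]) (simp add: conj_deriv_deriv)
  have x00: "(x0, x0) \<in> \<Omega>" using unit_right x0_W by blast
  have "((\<lambda>x. (x0, x)) has_derivative (\<lambda>u. (0, u))) (at x0)" "((\<lambda>x. (x, x0)) has_derivative (\<lambda>u. (u, 0))) (at x0)"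
    by (auto intro!: derivative_eq_intros)
  note comps = this[THEN has_derivative_compose, OF Ck_on_SucD[OF Ck_DM[of "Suc 0"] x00]]
  have DR: "((\<lambda>x. R x w) has_derivative (\<lambda>u. DL u w)) (at x0)" for w
  proof -
    have "DL u w = frechet_derivative (\<lambda>p. DM p (0, u)) (at (x0, x0)) (w, 0)" for u
    proof -
      have "((\<lambda>x. L x u) has_derivative (\<lambda>w. frechet_derivative (\<lambda>p. DM p (0, u)) (at (x0, x0)) (w, 0))) (at x0)"
        by (rule has_derivative_transform_within_open[OF comps(2) open_W x0_W]) (simp add: L_eq)
      then show ?thesis unfolding DL_def using frechet_derivative_eq by metis
    qed
    also have "frechet_derivative (\<lambda>p. DM p (0, u)) (at (x0, x0)) (w, 0) =
        frechet_derivative (\<lambda>p. DM p (w, 0)) (at (x0, x0)) (0, u)" for u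
      unfolding DM_def by (rule symmetric_second_derivative[OF Ck_mu open_\<Omega> x00])
    finally have e: "(\<lambda>u. DL u w) = (\<lambda>u. frechet_derivative (\<lambda>p. DM p (w, 0)) (at (x0, x0)) (0, u))" by blast
    show ?thesis
      unfolding e
      by (rule has_derivative_transform_within_open[OF comps(1) open_W x0_W]) (simp add: R_eq)
  qed
  have c0: "conj_deriv x0 v = v"
    using R_conj_deriv[OF x0_W, of v] by (simp add: R_x0 L_x0)
  have "((\<lambda>x. R x (conj_deriv x v)) has_derivative (\<lambda>u. DL u (conj_deriv x0 v) + R x0 (A' u))) (at x0)"
    by (rule has_derivative_op_apply[OF open_W x0_W linear_R DR A'])
  from has_derivative_unique_open[OF this DL_deriv[of v] open_W x0_W R_conj_deriv]
  have "A' u = br u v" for u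
    by (auto simp: c0 R_x0 br_def algebra_simps dest!: fun_cong[of _ _ u])
  then have "A' = (\<lambda>u. br u v)" by blast
  then show ?thesis using A' by simp
qed

end

text \<open>\<open>nab\<close> is the Levi-Civita connection on left invariant fields. Their inner
  products are constant, so the Koszul formula retains only bracket terms.\<close>

locale left_invariant_local_metric = local_lie_group B mu io \<Omega> W x0 + P: inner_product_form P
  for B :: "'e::real_inner set" and mu io \<Omega> W x0 and P :: "'e \<Rightarrow> 'e \<Rightarrow> real" +
  fixes nab :: "'e \<Rightarrow> 'e \<Rightarrow> 'e" and g :: "'e local_metric"
  assumes bilinear_nab: "bilinear nab"
    and koszul: "2 * P (nab u v) w = P (br u v) w - P v (br u w) - P u (br v w)"
    and g_eq: "x \<in> W \<Longrightarrow> g x v w = P (\<theta> x v) (\<theta> x w)"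
begin

lemma metric_deriv_eq:
  assumes x: "x \<in> W"
  shows "metric_deriv g x u v w = P (D\<theta> x v u) (\<theta> x w) + P (\<theta> x v) (D\<theta> x w u)"
proof -
  have "((\<lambda>y. P (\<theta> y v) (\<theta> y w)) has_derivative
      (\<lambda>u. P (\<theta> x v) (D\<theta> x w u) + P (D\<theta> x v u) (\<theta> x w))) (at x)"
    by (rule bounded_bilinear.FDERIV[OF bilinear_imp_bounded[OF P.bilinear_Q] D\<theta>_deriv[OF x] D\<theta>_deriv[OF x]])
  then have "((\<lambda>y. g y v w) has_derivative
      (\<lambda>u. P (\<theta> x v) (D\<theta> x w u) + P (D\<theta> x v u) (\<theta> x w))) (at x)"
    by (rule has_derivative_transform_within_open[OF _ open_W x]) (simp add: g_eq)
  from frechet_derivative_eq[OF this] show ?thesis unfolding metric_deriv_def by simp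
qed

text \<open>In the frame of left invariant fields a constant field \<open>v\<close> has the
  coefficients \<open>\<theta> x v\<close>; the Leibniz rule differentiates these and applies
  \<open>nab\<close> to the frame. The Koszul formula for the result is checked with the
  Maurer--Cartan equation.\<close>

lemma christoffel_eq:
  assumes x: "x \<in> W"
  shows "christoffel g x u v = L x (D\<theta> x v u + nab (\<theta> x u) (\<theta> x v))" (is "_ = ?z")
proof -
  have "2 * g x ?z w = metric_deriv g x u v w + metric_deriv g x v u w - metric_deriv g x w u v" for w
  proof -
    have mc: "D\<theta> x u v = D\<theta> x v u + br (\<theta> x u) (\<theta> x v)"
      "D\<theta> x w u = D\<theta> x u w - br (\<theta> x u) (\<theta> x w)" "D\<theta> x w v = D\<theta> x v w - br (\<theta> x v) (\<theta> x w)"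
      using maurer_cartan[OF x, of v u] maurer_cartan[OF x, of w u] maurer_cartan[OF x, of w v]
      by (simp_all add: algebra_simps)
    show ?thesis
      using koszul[of "\<theta> x u" "\<theta> x v" "\<theta> x w"]
        P.Q_commute[of "\<theta> x v" "D\<theta> x u w"] P.Q_commute[of "\<theta> x u" "D\<theta> x v w"]
      by (simp add: metric_deriv_eq x g_eq \<theta>_L mc P.Q_simps)
  qed
  moreover have "z = ?z"
    if z: "\<forall>w. 2 * g x z w = metric_deriv g x u v w + metric_deriv g x v u w - metric_deriv g x w u v" for z
  proof -
    have "P (\<theta> x z) (\<theta> x w) = P (\<theta> x ?z) (\<theta> x w)" for w
      using calculation[of w] z g_eq[OF x] by (metis mult_cancel_left zero_neq_numeral)
    from this[of "L x w" for w] have "\<theta> x z = \<theta> x ?z"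
      by (intro P.Q_nondegenerate) (simp add: \<theta>_L x)
    then show ?thesis using L_\<theta>[OF x] by metis
  qed
  ultimately show ?thesis unfolding christoffel_def by (intro the_equality) blast+
qed

text \<open>The derivatives of \<open>L\<close> cancel within each iterated covariant derivative,
  and the second derivatives of \<theta> cancel by symmetry. The asymmetry of
  \<open>D\<theta>\<close> is a bracket by the Maurer--Cartan equation and supplies the last
  term.\<close>

lemma curvature_tensor_eq:
  "curvature_tensor g x0 u v w = nab u (nab v w) - nab v (nab u w) - nab (br u v) w"
proof -
  interpret nab: bounded_bilinear nab by (rule bilinear_imp_bounded[OF bilinear_nab])
  define H where "H w u v = frechet_derivative (\<lambda>x. D\<theta> x v u) (at x0) w" for w u v
  define \<Gamma> where "\<Gamma> u v = christoffel g x0 u v" for u v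
  have \<Gamma>: "\<Gamma> u v = D\<theta> x0 v u + nab u v" for u v
    by (simp add: \<Gamma>_def christoffel_eq x0_W L_x0 \<theta>_x0)
  have D\<Gamma>: "frechet_derivative (\<lambda>y. christoffel g y v w) (at x0) u =
      DL (\<Gamma> v w) u + (H u v w + (nab v (D\<theta> x0 w u) + nab (D\<theta> x0 v u) w))" for u v w
  proof -
    have "((\<lambda>x. D\<theta> x w v + nab (\<theta> x v) (\<theta> x w)) has_derivative
        (\<lambda>u. H u v w + (nab (\<theta> x0 v) (D\<theta> x0 w u) + nab (D\<theta> x0 v u) (\<theta> x0 w)))) (at x0)"
      unfolding H_def by (intro has_derivative_add D\<theta>_second_deriv nab.FDERIV D\<theta>_deriv x0_W)
    from has_derivative_op_apply[OF open_W x0_W linear_L DL_deriv this]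
    have "((\<lambda>x. L x (D\<theta> x w v + nab (\<theta> x v) (\<theta> x w))) has_derivative
        (\<lambda>u. DL (D\<theta> x0 w v + nab (\<theta> x0 v) (\<theta> x0 w)) u +
          L x0 (H u v w + (nab (\<theta> x0 v) (D\<theta> x0 w u) + nab (D\<theta> x0 v u) (\<theta> x0 w))))) (at x0)"
      by simp
    then have "((\<lambda>x. christoffel g x v w) has_derivative
        (\<lambda>u. DL (D\<theta> x0 w v + nab (\<theta> x0 v) (\<theta> x0 w)) u +
          L x0 (H u v w + (nab (\<theta> x0 v) (D\<theta> x0 w u) + nab (D\<theta> x0 v u) (\<theta> x0 w))))) (at x0)"
      by (rule has_derivative_transform_within_open[OF _ open_W x0_W]) (simp add: christoffel_eq)
    from frechet_derivative_eq[OF this] show ?thesis by (simp add: \<Gamma> L_x0 \<theta>_x0)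
  qed
  have \<Gamma>\<Gamma>: "christoffel g x0 u (christoffel g x0 v w) = - DL (\<Gamma> v w) u + nab u (D\<theta> x0 w v) + nab u (nab v w)" for u v w
    by (simp add: \<Gamma>[unfolded \<Gamma>_def] D\<theta>_x0 nab.add_right nab.diff_right nab.minus_right \<Gamma>)
  have mc: "D\<theta> x0 v u = D\<theta> x0 u v - br u v"
    using maurer_cartan[OF x0_W, of v u] by (simp add: \<theta>_x0 algebra_simps)
  have H: "H u v w = H v u w" unfolding H_def by (rule D\<theta>_second_symmetric)
  show ?thesis
    unfolding curvature_tensor_def D\<Gamma> \<Gamma>\<Gamma> mc H by (simp add: nab.diff_left algebra_simps)
qed

end

section \<open>Charts and tangent spaces\<close>

lemma chart_inj: "is_chart T c \<Longrightarrow> inj_on (snd c) (fst c)"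
  unfolding is_chart_def
  by (metis homeomorphic_imp_injective_map openin_subset topspace_subtopology_subset)

lemma chart_inv_chart: "is_chart T c \<Longrightarrow> p \<in> fst c \<Longrightarrow> chart_inv c (snd c p) = p"
  unfolding chart_inv_def by (rule inv_into_f_f[OF chart_inj])

lemma
  assumes "x \<in> snd c ` fst c"
  shows chart_inv_in: "chart_inv c x \<in> fst c"
    and chart_chart_inv: "snd c (chart_inv c x) = x"
  using assms unfolding chart_inv_def by (rule inv_into_into, rule f_inv_into_f)

lemma chart_open_image:
  assumes "is_chart T c" "openin T A"
  shows "open (snd c ` (fst c \<inter> A))"
proof -
  have "openin (subtopology T (fst c)) (fst c \<inter> A)"
    using assms(2) by (rule openin_subtopology_Int2)
  then have "openin (top_of_set (snd c ` fst c)) (snd c ` (fst c \<inter> A))"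
    using assms(1) homeomorphic_imp_open_map unfolding is_chart_def open_map_def by blast
  then show ?thesis using assms(1) openin_open_eq unfolding is_chart_def by blast
qed

lemma open_coord_dom:
  assumes "is_chart T c" "is_chart S d" "continuous_map T S f"
  shows "open (coord_dom c d f)"
proof -
  have "fst c \<subseteq> topspace T" using assms(1) by (simp add: is_chart_def openin_subset)
  then have "fst c \<inter> f -` fst d = fst c \<inter> {x \<in> topspace T. f x \<in> fst d}" by auto
  moreover have "openin T {x \<in> topspace T. f x \<in> fst d}"
    using assms(2,3) openin_continuous_map_preimage by (auto simp: is_chart_def)
  ultimately show ?thesis
    unfolding coord_dom_def using chart_open_image[OF assms(1)] by simp
qed

lemma coord_dom_iff:
  "is_chart T c \<Longrightarrow> x \<in> coord_dom c d f \<longleftrightarrow> x \<in> snd c ` fst c \<and> f (chart_inv c x) \<in> fst d"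
  unfolding coord_dom_def by (auto simp: chart_inv_chart)

text \<open>Pairing the curve with a normal vector of \<open>V\<close> gives a function that
  vanishes near 0, hence so does its derivative.\<close>

lemma vector_derivative_in_subspace:
  fixes q :: "real \<Rightarrow> 'e::real_inner"
  assumes V: "subspace V" and fin: "\<exists>B::'e set. finite B \<and> span B = UNIV"
    and q: "(q has_vector_derivative v) (at 0)" and e: "e > 0" "\<And>s. \<bar>s\<bar> < e \<Longrightarrow> q s \<in> V"
  shows "v \<in> V"
proof -
  interpret finite_inner_product_form "inner :: 'e \<Rightarrow> 'e \<Rightarrow> real"
    by unfold_locales (use inner_product_inner fin in auto)
  show ?thesis
  proof (rule orth_compl_orth_compl[OF V])
    fix n assume n: "n \<in> orth_compl inner V"
    have "((\<lambda>s. q s \<bullet> n) has_derivative (\<lambda>h. (h *\<^sub>R v) \<bullet> n)) (at 0)"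
      using q unfolding has_vector_derivative_def
      by (rule bounded_linear.has_derivative[OF bounded_linear_inner_left])
    then have "((\<lambda>s::real. 0::real) has_derivative (\<lambda>h. (h *\<^sub>R v) \<bullet> n)) (at 0)"
    proof (rule has_derivative_transform_within_open)
      show "q s \<bullet> n = 0" if "s \<in> {-e<..<e}" for s
      proof -
        have "\<bar>s\<bar> < e" using that by auto
        then show ?thesis
          using n e(2)[of s] unfolding inner_commute[of "q s"] by (auto simp: orth_compl_def)
      qed
    qed (use e in auto)
    from has_derivative_unique[OF this has_derivative_const[of 0]]
    have "(1 *\<^sub>R v) \<bullet> n = 0" by (rule fun_cong)
    then show "v \<bullet> n = 0" by simp
  qed
qed

lemma has_vector_derivative_compose:
  assumes "(q has_vector_derivative v) (at s)" "(f has_derivative f') (at (q s))"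
  shows "((\<lambda>s. f (q s)) has_vector_derivative f' v) (at s)"
proof -
  have "linear f'" using assms(2) has_derivative_linear by blast
  then show ?thesis
    using has_derivative_compose[OF assms(1)[unfolded has_vector_derivative_def] assms(2)]
    by (simp add: has_vector_derivative_def linear_scale)
qed

lemma vector_derivative_eventually_in:
  assumes "(q has_vector_derivative v) (at 0)" "open S" "q 0 \<in> S"
  obtains e :: real where "e > 0" "\<And>s. \<bar>s\<bar> < e \<Longrightarrow> q s \<in> S"
proof -
  have "isCont q 0" using assms(1) has_vector_derivative_continuous by blast
  then have "(q \<longlongrightarrow> q 0) (nhds 0)"
    by (simp add: isCont_def tendsto_at_iff_tendsto_nhds)
  then have "\<forall>\<^sub>F s in nhds 0. q s \<in> S" using assms(2,3) by (rule topological_tendstoD)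
  then obtain e where "e > 0" "\<forall>s. dist s 0 < e \<longrightarrow> q s \<in> S"
    unfolding eventually_nhds_metric by blast
  then show thesis by (intro that[of e]) (auto simp: dist_real_def)
qed

text \<open>Closure under sums is not visible from velocities of curves. In a slice chart, however,
  the velocities fill the slice subspace, straight lines realizing each vector, and the derivative
  of the transition map carries this to \<open>c\<close>.\<close>

lemma subspace_tangent_space_of:
  fixes A :: "('m, 'e::real_inner) chart set"
  assumes man: "smooth_manifold T A" and H: "embedded_submanifold T A H"
    and p: "p \<in> H" and c: "c \<in> A" "p \<in> fst c"
  shows "subspace (tangent_space_of c H p)"
proof -
  have fin: "\<exists>B::'e set. finite B \<and> span B = UNIV"
    using man by (simp add: smooth_manifold_def)
  then obtain B :: "'e set" where "finite_dim_space B" using finite_dim_space_exists by metis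
  then interpret finite_dim_space B .
  obtain d S where d: "d \<in> A" "p \<in> fst d" and S: "subspace S" "snd d ` (fst d \<inter> H) = snd d ` fst d \<inter> S"
    using H p unfolding embedded_submanifold_def by blast
  have charts: "is_chart T c" "is_chart T d" "compatible_charts c d"
    using man c d by (auto simp: smooth_manifold_def smooth_structure_def)
  define \<sigma> where "\<sigma> = coord_rep c d (\<lambda>p. p)"
  define \<tau> where "\<tau> = coord_rep d c (\<lambda>p. p)"
  define D1 where "D1 = coord_dom c d (\<lambda>p. p)"
  define D2 where "D2 = coord_dom d c (\<lambda>p. p)"
  have open_D: "open D1" "open D2"
    unfolding D1_def D2_def using charts by (auto intro!: open_coord_dom)
  have smooth: "\<And>k. Ck_on k D1 \<sigma>" "\<And>k. Ck_on k D2 \<tau>"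
    using charts(3) by (auto simp: compatible_charts_def smooth_on_def D1_def D2_def \<sigma>_def \<tau>_def)
  have pD: "snd c p \<in> D1" "snd d p \<in> D2"
    using c d by (auto simp: D1_def D2_def coord_dom_def)
  have \<sigma>p: "\<sigma> (snd c p) = snd d p" "\<tau> (snd d p) = snd c p"
    using chart_inv_chart[OF charts(1) c(2)] chart_inv_chart[OF charts(2) d(2)]
    by (auto simp: \<sigma>_def \<tau>_def coord_rep_def)
  have \<tau>\<sigma>: "\<tau> (\<sigma> x) = x" if "x \<in> D1" for x
  proof -
    have "x \<in> snd c ` fst c" "chart_inv c x \<in> fst d"
      using that by (simp_all add: D1_def coord_dom_iff[OF charts(1)])
    then show ?thesis
      by (simp add: \<sigma>_def \<tau>_def coord_rep_def chart_inv_chart[OF charts(2)] chart_chart_inv)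
  qed
  define \<sigma>' where "\<sigma>' = frechet_derivative \<sigma> (at (snd c p))"
  define \<tau>' where "\<tau>' = frechet_derivative \<tau> (at (snd d p))"
  have \<sigma>': "(\<sigma> has_derivative \<sigma>') (at (snd c p))" and \<tau>': "(\<tau> has_derivative \<tau>') (at (snd d p))"
    unfolding \<sigma>'_def \<tau>'_def using Ck_on_SucD smooth pD by blast+
  have \<tau>'\<sigma>': "\<tau>' (\<sigma>' v) = v" for v
  proof -
    have "((\<lambda>x. \<tau> (\<sigma> x)) has_derivative (\<lambda>v. \<tau>' (\<sigma>' v))) (at (snd c p))"
      using has_derivative_compose[OF \<sigma>'] \<tau>' \<sigma>p by simp
    then have "((\<lambda>x. x) has_derivative (\<lambda>v. \<tau>' (\<sigma>' v))) (at (snd c p))"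
      by (rule has_derivative_transform_within_open[OF _ open_D(1) pD(1)]) (rule \<tau>\<sigma>)
    from has_derivative_unique[OF this has_derivative_ident] show ?thesis by (rule fun_cong)
  qed
  have "tangent_space_of c H p = {v. \<sigma>' v \<in> S}"
  proof (intro subset_antisym subsetI)
    fix v assume "v \<in> tangent_space_of c H p"
    then obtain \<gamma> :: "real \<Rightarrow> 'm" and e where e: "e > 0" and \<gamma>: "\<gamma> 0 = p" "\<gamma> ` {-e<..<e} \<subseteq> H \<inter> fst c"
      "((snd c \<circ> \<gamma>) has_vector_derivative v) (at 0)"
      unfolding tangent_space_of_def by blast
    obtain e' where e': "e' > 0" "\<And>s. \<bar>s\<bar> < e' \<Longrightarrow> (snd c \<circ> \<gamma>) s \<in> D1"
      using vector_derivative_eventually_in[OF \<gamma>(3) open_D(1)] pD(1) \<gamma>(1) by auto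
    have "((\<lambda>s. \<sigma> ((snd c \<circ> \<gamma>) s)) has_vector_derivative \<sigma>' v) (at 0)"
      by (rule has_vector_derivative_compose[OF \<gamma>(3)]) (simp add: \<gamma>(1) \<sigma>')
    moreover have "\<sigma> ((snd c \<circ> \<gamma>) s) \<in> S" if s: "\<bar>s\<bar> < min e e'" for s
    proof -
      have "s \<in> {-e<..<e}" using s by auto
      then have g: "\<gamma> s \<in> H" "\<gamma> s \<in> fst c" using \<gamma>(2) by blast+
      then have "\<gamma> s \<in> fst d"
        using e'(2)[of s] s unfolding D1_def coord_dom_iff[OF charts(1)]
        by (simp add: chart_inv_chart[OF charts(1)])
      then have "snd d (\<gamma> s) \<in> S" using g S(2) by blast
      then show ?thesis using g by (simp add: \<sigma>_def coord_rep_def chart_inv_chart[OF charts(1)])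
    qed
    ultimately show "v \<in> {v. \<sigma>' v \<in> S}"
      using vector_derivative_in_subspace[OF S(1) fin, of _ "\<sigma>' v" "min e e'"] e e'(1) by auto
  next
    fix v assume v: "v \<in> {v. \<sigma>' v \<in> S}"
    define w where "w = \<sigma>' v"
    define l where "l s = snd d p + s *\<^sub>R w" for s :: real
    have l: "(l has_vector_derivative w) (at 0)"
      unfolding l_def[abs_def] has_vector_derivative_def by (auto intro!: derivative_eq_intros)
    obtain e where e: "e > 0" "\<And>s. \<bar>s\<bar> < e \<Longrightarrow> l s \<in> D2"
      using vector_derivative_eventually_in[OF l open_D(2)] pD(2) by (auto simp: l_def)
    define \<gamma> where "\<gamma> s = chart_inv d (l s)" for s
    have in_D2: "l s \<in> snd d ` fst d" "\<gamma> s \<in> fst c" "\<gamma> s \<in> fst d" "snd d (\<gamma> s) = l s" if "\<bar>s\<bar> < e" for s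
      using e(2)[OF that] unfolding D2_def coord_dom_iff[OF charts(2)] \<gamma>_def
      by (simp_all add: chart_inv_in chart_chart_inv)
    have "snd d p \<in> S" using S(2) d p by blast
    then have lS: "l s \<in> S" for s
      using v S(1) by (simp add: l_def w_def subspace_add subspace_scale)
    have \<gamma>H: "\<gamma> s \<in> H" if "\<bar>s\<bar> < e" for s
    proof -
      have "l s \<in> snd d ` (fst d \<inter> H)" using in_D2[OF that] lS S(2) by blast
      then obtain q where q: "q \<in> fst d" "q \<in> H" "l s = snd d q" by auto
      then show ?thesis by (simp add: \<gamma>_def chart_inv_chart[OF charts(2)])
    qed
    have comp: "snd c \<circ> \<gamma> = (\<lambda>s. \<tau> (l s))"
      by (auto simp: \<tau>_def coord_rep_def \<gamma>_def)
    have "Ck_on k {-e<..<e} l" for k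
      unfolding l_def[abs_def]
      by (intro Ck_on_add Ck_on_const Ck_on_bounded_linear[OF _ bounded_linear_scaleR_left] Ck_on_id) auto
    then have "smooth_on {-e<..<e} (snd c \<circ> \<gamma>)"
      unfolding comp smooth_on_def using e(2)
      by (intro allI Ck_on_compose[OF _ open_D(2) _ smooth(2)]) auto
    moreover have "((snd c \<circ> \<gamma>) has_vector_derivative v) (at 0)"
      using has_vector_derivative_compose[OF l, of \<tau> \<tau>'] \<tau>' \<tau>'\<sigma>'[of v]
      unfolding comp by (simp add: l_def w_def)
    moreover have "\<gamma> ` {-e<..<e} \<subseteq> H \<inter> fst c" using \<gamma>H in_D2 by auto
    moreover have "\<gamma> 0 = p" by (simp add: \<gamma>_def l_def chart_inv_chart[OF charts(2) d(2)])
    ultimately show "v \<in> tangent_space_of c H p"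
      unfolding tangent_space_of_def using e(1) by blast
  qed
  moreover have "linear \<sigma>'" using \<sigma>' has_derivative_linear by blast
  ultimately show ?thesis
    using S(1) by (auto simp: subspace_def linear_add linear_scale linear_0)
qed

section \<open>Lie groups in a chart around the identity\<close>

lemma (in group) inv_mult_cancel_left:
  assumes "a \<in> carrier G" "b \<in> carrier G" "d \<in> carrier G"
  shows "inv (a \<otimes> b) \<otimes> (a \<otimes> d) = inv b \<otimes> d"
proof -
  have "inv (a \<otimes> b) \<otimes> (a \<otimes> d) = inv b \<otimes> (inv a \<otimes> (a \<otimes> d))"
    using assms by (simp add: inv_mult_group m_assoc)
  also have "inv a \<otimes> (a \<otimes> d) = d" using assms by (simp flip: m_assoc)
  finally show ?thesis .
qed

lemma (in group) inv_mult_cancel: "a \<in> carrier G \<Longrightarrow> b \<in> carrier G \<Longrightarrow> inv a \<otimes> (a \<otimes> b) = b"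
  by (simp flip: m_assoc)

lemma (in group) mult_inv_cancel: "a \<in> carrier G \<Longrightarrow> b \<in> carrier G \<Longrightarrow> a \<otimes> (inv a \<otimes> b) = b"
  by (simp flip: m_assoc)

locale lie_group_chart = G: group G
  for G :: "('m, 'b) monoid_scheme" (structure) +
  fixes T :: "'m topology" and A :: "('m, 'e::real_inner) chart set" and c :: "('m, 'e) chart"
  assumes lie_group: "lie_group G T A" and c: "c \<in> A" "\<one> \<in> fst c"
begin

definition V :: "'m set" where "V = fst c"
definition \<kappa> :: "'m \<Rightarrow> 'e" where "\<kappa> = snd c"
definition \<psi> :: "'e \<Rightarrow> 'm" where "\<psi> = chart_inv c"
definition mu :: "'e \<Rightarrow> 'e \<Rightarrow> 'e" where "mu x y = \<kappa> (\<psi> x \<otimes> \<psi> y)"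
definition io :: "'e \<Rightarrow> 'e" where "io x = \<kappa> (inv (\<psi> x))"
definition \<Omega> :: "('e \<times> 'e) set" where "\<Omega> = {(x, y). x \<in> \<kappa> ` V \<and> y \<in> \<kappa> ` V \<and> \<psi> x \<otimes> \<psi> y \<in> V}"
definition W :: "'e set" where "W = {x \<in> \<kappa> ` V. inv (\<psi> x) \<in> V}"
definition x0 :: 'e where "x0 = \<kappa> \<one>"

lemma manifold: "smooth_manifold T A"
  using lie_group by (simp add: lie_group_def)

lemma chart_c: "is_chart T c"
  using manifold c by (auto simp: smooth_manifold_def smooth_structure_def)

lemma V_carrier: "V \<subseteq> carrier G"
  using chart_c lie_group openin_subset by (fastforce simp: V_def is_chart_def lie_group_def)

lemma one_V: "\<one> \<in> V"
  using c by (simp add: V_def)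

lemma \<psi>_\<kappa>: "p \<in> V \<Longrightarrow> \<psi> (\<kappa> p) = p"
  unfolding \<psi>_def \<kappa>_def V_def by (rule chart_inv_chart[OF chart_c])

lemma \<psi>_in: "x \<in> \<kappa> ` V \<Longrightarrow> \<psi> x \<in> V" and \<kappa>_\<psi>: "x \<in> \<kappa> ` V \<Longrightarrow> \<kappa> (\<psi> x) = x"
  unfolding \<psi>_def \<kappa>_def V_def by (rule chart_inv_in, simp) (rule chart_chart_inv, simp)

lemma \<psi>_carrier: "x \<in> \<kappa> ` V \<Longrightarrow> \<psi> x \<in> carrier G"
  using \<psi>_in V_carrier by blast

lemma \<psi>_mu: "(x, y) \<in> \<Omega> \<Longrightarrow> \<psi> (mu x y) = \<psi> x \<otimes> \<psi> y"
  by (simp add: mu_def \<Omega>_def \<psi>_\<kappa>)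

lemma \<psi>_io: "x \<in> W \<Longrightarrow> \<psi> (io x) = inv (\<psi> x)"
  by (simp add: io_def W_def \<psi>_\<kappa>)

lemma io_in: "x \<in> W \<Longrightarrow> io x \<in> \<kappa> ` V"
  by (simp add: io_def W_def)

lemma x0_eq: "snd c \<one> = x0"
  by (simp add: x0_def \<kappa>_def)

lemma \<psi>_x0: "\<psi> x0 = \<one>"
  by (simp add: x0_def \<psi>_\<kappa> one_V)

lemma x0_in: "x0 \<in> \<kappa> ` V"
  using one_V by (simp add: x0_def)

lemma open_\<Omega>: "open \<Omega>"
proof (rule Topological_Spaces.openI)
  fix p assume "p \<in> \<Omega>"
  then obtain x y where p: "p = (x, y)" "x \<in> \<kappa> ` V" "y \<in> \<kappa> ` V" "\<psi> x \<otimes> \<psi> y \<in> V"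
    by (auto simp: \<Omega>_def)
  let ?N = "{p \<in> topspace (prod_topology T T). (\<lambda>(a, b). a \<otimes> b) p \<in> V}"
  have "openin (prod_topology T T) ?N"
    by (rule openin_continuous_map_preimage)
      (use lie_group chart_c in \<open>auto simp: lie_group_def smooth_map_def is_chart_def V_def\<close>)
  moreover have "(\<psi> x, \<psi> y) \<in> ?N"
    using p \<psi>_carrier lie_group by (auto simp: lie_group_def)
  ultimately have "\<exists>X Y. openin T X \<and> openin T Y \<and> \<psi> x \<in> X \<and> \<psi> y \<in> Y \<and> X \<times> Y \<subseteq> ?N"
    by (rule openin_prod_topology_alt[THEN iffD1, rule_format])
  then obtain X Y where XY: "openin T X" "openin T Y" "\<psi> x \<in> X" "\<psi> y \<in> Y" "X \<times> Y \<subseteq> ?N"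
    by (elim exE conjE)
  let ?S = "\<kappa> ` (V \<inter> X) \<times> \<kappa> ` (V \<inter> Y)"
  have "open ?S"
    unfolding \<kappa>_def V_def by (intro open_Times chart_open_image[OF chart_c] XY)
  moreover have "p \<in> ?S"
  proof -
    have "\<kappa> (\<psi> x) \<in> \<kappa> ` (V \<inter> X)" "\<kappa> (\<psi> y) \<in> \<kappa> ` (V \<inter> Y)"
      using XY(3,4) \<psi>_in[OF p(2)] \<psi>_in[OF p(3)] by blast+
    then show ?thesis by (simp add: p(1) \<kappa>_\<psi>[OF p(2)] \<kappa>_\<psi>[OF p(3)])
  qed
  moreover have "?S \<subseteq> \<Omega>"
    using XY(5) by (auto simp: \<Omega>_def \<psi>_\<kappa>)
  ultimately show "\<exists>S. open S \<and> p \<in> S \<and> S \<subseteq> \<Omega>" by blast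
qed

lemma Ck_mu: "Ck_on k \<Omega> (\<lambda>p. mu (fst p) (snd p))"
proof -
  let ?d = "(fst c \<times> fst c, map_prod (snd c) (snd c))"
  let ?m = "\<lambda>(a, b). a \<otimes> b"
  have inj: "inj_on (map_prod \<kappa> \<kappa>) (V \<times> V)"
    using chart_inj[OF chart_c] by (auto simp: inj_on_def \<kappa>_def V_def)
  have inv: "chart_inv ?d (x, y) = (\<psi> x, \<psi> y)" if "x \<in> \<kappa> ` V" "y \<in> \<kappa> ` V" for x y
  proof -
    have "inv_into (V \<times> V) (map_prod \<kappa> \<kappa>) (map_prod \<kappa> \<kappa> (\<psi> x, \<psi> y)) = (\<psi> x, \<psi> y)"
      by (rule inv_into_f_f[OF inj]) (use that \<psi>_in in auto)
    then show ?thesis using that by (simp add: chart_inv_def \<kappa>_\<psi> flip: \<kappa>_def V_def)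
  qed
  have dom: "coord_dom ?d c ?m = \<Omega>"
    unfolding coord_dom_def \<Omega>_def by (force simp: \<psi>_\<kappa> simp flip: \<kappa>_def V_def)
  have "?d \<in> prod_atlas A A" using c(1) unfolding prod_atlas_def by blast
  then have "smooth_on (coord_dom ?d c ?m) (coord_rep ?d c ?m)"
    using lie_group c(1) unfolding lie_group_def smooth_map_def by blast
  then have "Ck_on k \<Omega> (coord_rep ?d c ?m)" unfolding dom smooth_on_def ..
  then show ?thesis
    by (rule Ck_on_cong[OF open_\<Omega>, rotated]) (auto simp: \<Omega>_def coord_rep_def inv mu_def, simp_all add: \<kappa>_def)
qed

lemma W_coord_dom: "W = coord_dom c c (\<lambda>a. inv a)"
  unfolding W_def by (auto simp: coord_dom_iff[OF chart_c] V_def \<kappa>_def \<psi>_def)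

lemma
  shows open_W: "open W" and Ck_io: "Ck_on k W io"
proof -
  have inv: "smooth_map T A T A (\<lambda>a. inv a)" using lie_group by (simp add: lie_group_def)
  then show "open W"
    unfolding W_coord_dom by (intro open_coord_dom[OF chart_c chart_c]) (simp add: smooth_map_def)
  have "io = coord_rep c c (\<lambda>a. inv a)"
    by (auto simp: io_def coord_rep_def \<kappa>_def \<psi>_def)
  then show "Ck_on k W io"
    using inv c unfolding W_coord_dom by (simp add: smooth_map_def smooth_on_def)
qed

lemma finite_dim: "\<exists>B::'e set. finite B \<and> span B = UNIV"
  using manifold by (simp add: smooth_manifold_def)

definition B :: "'e set" where "B = (SOME B. finite_dim_space B)"

lemma finite_dim_space_B: "finite_dim_space B"
  unfolding B_def using finite_dim finite_dim_space_exists by (metis someI)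

text \<open>\<psi> carries \<open>mu\<close> and \<open>io\<close> to product and inverse wherever
  these stay in \<open>V\<close>, so each coordinate law is the image of a group law.\<close>

sublocale local_lie_group B mu io \<Omega> W x0
proof (intro local_lie_group.intro finite_dim_space_B local_lie_group_axioms.intro)
  have W: "x \<in> \<kappa> ` V" "\<psi> x \<in> carrier G" "inv (\<psi> x) \<in> V" if "x \<in> W" for x
    using that \<psi>_carrier by (auto simp: W_def)
  have \<Omega>: "x \<in> \<kappa> ` V" "y \<in> \<kappa> ` V" "\<psi> x \<in> carrier G" "\<psi> y \<in> carrier G" if "(x, y) \<in> \<Omega>" for x y
    using that \<psi>_carrier by (auto simp: \<Omega>_def)
  show "open \<Omega>" "open W" by (rule open_\<Omega> open_W)+
  show "x0 \<in> W" using one_V x0_in by (simp add: W_def \<psi>_x0)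
  show "Ck_on k \<Omega> (\<lambda>p. mu (fst p) (snd p))" "Ck_on k W io" for k by (rule Ck_mu Ck_io)+
  show "(x, x0) \<in> \<Omega> \<and> mu x x0 = x" "(x0, x) \<in> \<Omega> \<and> mu x0 x = x" if "x \<in> W" for x
    using W[OF that] x0_in \<psi>_in by (auto simp: \<Omega>_def mu_def \<psi>_x0 \<kappa>_\<psi>)
  show "(io x, x) \<in> \<Omega> \<and> mu (io x) x = x0" "(x, io x) \<in> \<Omega> \<and> mu x (io x) = x0" if "x \<in> W" for x
    using W[OF that] io_in[OF that] one_V by (auto simp: \<Omega>_def mu_def \<psi>_io[OF that] x0_def)
  show "mu (io x) (mu x y) = y" if "x \<in> W" "(x, y) \<in> \<Omega>" for x y
    using W[OF that(1)] \<Omega>[OF that(2)]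
    by (simp add: mu_def[of "io x"] \<psi>_io[OF that(1)] \<psi>_mu[OF that(2)] G.inv_mult_cancel \<kappa>_\<psi>)
  show "mu x (mu (io x) y) = y" if "x \<in> W" "(io x, y) \<in> \<Omega>" for x y
    using W[OF that(1)] \<Omega>[OF that(2)]
    by (simp add: mu_def[of x] \<psi>_io[OF that(1)] \<psi>_mu[OF that(2)] G.mult_inv_cancel \<kappa>_\<psi>)
  show "mu (io (mu x y)) (mu x z) = mu (io y) z"
    if "x \<in> W" "(x, y) \<in> \<Omega>" "mu x y \<in> W" "y \<in> W" "(x, z) \<in> \<Omega>" "(io y, z) \<in> \<Omega>" for x y z
    using \<Omega>[OF that(2)] \<Omega>[OF that(5)]
    by (simp add: mu_def[of "io _"] \<psi>_io that \<psi>_mu G.inv_mult_cancel_left)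
  show "mu (mu (mu x y) (io x)) x = mu x y"
    if "x \<in> W" "(x, y) \<in> \<Omega>" "(mu x y, io x) \<in> \<Omega>" for x y
    using \<Omega>[OF that(2)]
    by (simp add: mu_def[of "mu (mu x y) (io x)"] \<psi>_mu[OF that(3)] \<psi>_mu[OF that(2)] \<psi>_io that(1) G.m_assoc)
      (simp add: mu_def)
qed

lemma coord_rep_left_mult: "coord_rep c c (\<lambda>b. \<psi> x \<otimes> b) = mu x"
  by (auto simp: coord_rep_def mu_def \<kappa>_def \<psi>_def)

lemma left_invariant_field_eq: "left_invariant_field G c v x = L x v"
  by (simp add: left_invariant_field_def tangent_map_def L_def x0_eq
      coord_rep_left_mult[unfolded \<psi>_def])

lemma lie_bracket_eq: "lie_bracket G c u v = br u v"
  by (simp add: lie_bracket_def br_def DL_def left_invariant_field_eq[abs_def] x0_eq)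

lemma \<psi>_conj:
  assumes "x \<in> W" "(x, y) \<in> \<Omega>" "(mu x y, io x) \<in> \<Omega>"
  shows "\<psi> x \<otimes> \<psi> y \<otimes> inv (\<psi> x) \<in> V" "mu (mu x y) (io x) = \<kappa> (\<psi> x \<otimes> \<psi> y \<otimes> inv (\<psi> x))"
  using assms(3) by (auto simp: \<Omega>_def \<psi>_mu[OF assms(2)] \<psi>_io[OF assms(1)] mu_def[of "mu x y"])

text \<open>The two coordinate expressions are compared only while the intermediate product x y
  stays in the chart; agreement near \<open>x0\<close> suffices for the derivatives.\<close>

lemma Ad_eq:
  assumes x: "x \<in> W"
  shows "Ad G c (\<psi> x) = conj_deriv x"
proof -
  have "frechet_derivative (coord_rep c c (\<lambda>b. \<psi> x \<otimes> b \<otimes> inv (\<psi> x))) (at x0) =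
    frechet_derivative (\<lambda>y. mu (mu x y) (io x)) (at x0)"
  proof (rule frechet_derivative_cong_nhds)
    have "\<forall>\<^sub>F y in nhds x0. (x, y) \<in> \<Omega> \<and> (mu x y, io x) \<in> \<Omega>"
      using eventually_nhds_in_open[OF open_conj_domain[OF x]] by simp
    then show "\<forall>\<^sub>F y in nhds x0. coord_rep c c (\<lambda>b. \<psi> x \<otimes> b \<otimes> inv (\<psi> x)) y = mu (mu x y) (io x)"
      by eventually_elim (simp add: \<psi>_conj[OF x] coord_rep_def \<kappa>_def \<psi>_def)
  qed
  then show ?thesis by (simp add: Ad_def tangent_map_def conj_deriv_def x0_eq)
qed

lemma left_invariant_metric_eq:
  assumes x: "x \<in> W"
  shows "left_invariant_metric G c P c x v w = P (\<theta> x v) (\<theta> x w)"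
proof -
  have "coord_rep c c (\<lambda>b. inv (\<psi> x) \<otimes> b) = mu (io x)"
    using x by (auto simp: coord_rep_def mu_def \<psi>_io \<kappa>_def \<psi>_def[symmetric])
  moreover have "snd c (\<psi> x) = x" using x \<kappa>_\<psi> by (simp add: W_def flip: \<kappa>_def)
  ultimately show ?thesis
    by (simp add: left_invariant_metric_def tangent_map_def \<theta>_def Let_def flip: \<psi>_def)
qed

section \<open>The Lie algebra of a subgroup\<close>

lemma tangent_curveE:
  assumes "v \<in> lie_algebra_of G c H"
  obtains q :: "real \<Rightarrow> 'e" and e where "e > 0" "q 0 = x0" "(q has_vector_derivative v) (at 0)"
    "\<And>s. \<bar>s\<bar> < e \<Longrightarrow> \<psi> (q s) \<in> H \<and> q s \<in> \<kappa> ` V" "smooth_on {-e<..<e} q"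
proof -
  obtain \<gamma> :: "real \<Rightarrow> 'm" and e where \<gamma>: "e > 0" "\<gamma> 0 = \<one>" "\<gamma> ` {-e<..<e} \<subseteq> H \<inter> V"
    "smooth_on {-e<..<e} (\<kappa> \<circ> \<gamma>)" "((\<kappa> \<circ> \<gamma>) has_vector_derivative v) (at 0)"
    using assms unfolding lie_algebra_of_def tangent_space_of_def \<kappa>_def V_def by blast
  have "\<psi> ((\<kappa> \<circ> \<gamma>) s) \<in> H \<and> (\<kappa> \<circ> \<gamma>) s \<in> \<kappa> ` V" if "\<bar>s\<bar> < e" for s
  proof -
    have "s \<in> {-e<..<e}" using that by auto
    then have "\<gamma> s \<in> H" "\<gamma> s \<in> V" using \<gamma>(3) by blast+
    then show ?thesis by (simp add: \<psi>_\<kappa>)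
  qed
  then show thesis using that[of e "\<kappa> \<circ> \<gamma>"] \<gamma> by (simp add: x0_def)
qed

text \<open>Conjugation by an element of \<open>H\<close> takes a curve in \<open>H\<close> through
  the identity to another one, which stays in the chart for small parameters.\<close>

lemma conj_deriv_lie_algebra_of:
  assumes H: "subgroup H G" and x: "x \<in> W" "\<psi> x \<in> H" and v: "v \<in> lie_algebra_of G c H"
  shows "conj_deriv x v \<in> lie_algebra_of G c H"
proof -
  obtain q :: "real \<Rightarrow> 'e" and e where q: "e > 0" "q 0 = x0" "(q has_vector_derivative v) (at 0)"
    "\<And>s. \<bar>s\<bar> < e \<Longrightarrow> \<psi> (q s) \<in> H \<and> q s \<in> \<kappa> ` V" "smooth_on {-e<..<e} q"
    by (rule tangent_curveE[OF v]) blast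
  let ?N = "{y. (x, y) \<in> \<Omega> \<and> (mu x y, io x) \<in> \<Omega>}"
  note N = open_conj_domain[OF x(1)]
  obtain e' where e': "e' > 0" "\<And>s. \<bar>s\<bar> < e' \<Longrightarrow> q s \<in> ?N"
    by (rule vector_derivative_eventually_in[OF q(3) N(1) N(2)[folded q(2)]]) blast
  define d where "d = min e e'"
  define \<gamma> where "\<gamma> s = \<psi> x \<otimes> \<psi> (q s) \<otimes> inv (\<psi> x)" for s
  let ?C = "\<lambda>y. mu (mu x y) (io x)"
  have d: "d > 0" using q(1) e'(1) by (simp add: d_def)
  have \<gamma>: "\<gamma> s \<in> H" "\<gamma> s \<in> V" "\<kappa> (\<gamma> s) = ?C (q s)" if "\<bar>s\<bar> < d" for s
  proof -
    have s: "q s \<in> ?N" "\<psi> (q s) \<in> H" using that e' q by (auto simp: d_def)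
    show "\<gamma> s \<in> H" unfolding \<gamma>_def using H x s by (simp add: subgroup.m_closed subgroup.m_inv_closed)
    show "\<gamma> s \<in> V" "\<kappa> (\<gamma> s) = ?C (q s)" using \<psi>_conj[OF x(1), of "q s"] s by (auto simp: \<gamma>_def)
  qed
  have "smooth_on {-d<..<d} (\<kappa> \<circ> \<gamma>)"
    unfolding smooth_on_def
  proof
    fix k
    have "Ck_on k {-d<..<d} (\<lambda>s. ?C (q s))"
    proof (rule Ck_on_compose[OF _ N(1) _ Ck_conj[OF x(1)]])
      show "Ck_on k {-d<..<d} q"
        using q(5) Ck_on_subset unfolding smooth_on_def by (rule allE) (auto simp: d_def intro: Ck_on_subset)
    qed (use e' in \<open>auto simp: d_def\<close>)
    then show "Ck_on k {-d<..<d} (\<kappa> \<circ> \<gamma>)"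
      by (rule Ck_on_cong[rotated 2]) (use \<gamma>(3) in auto)
  qed
  moreover have "((\<kappa> \<circ> \<gamma>) has_vector_derivative conj_deriv x v) (at 0)"
  proof -
    have "(?C has_derivative conj_deriv x) (at (q 0))" unfolding q(2) by (rule conj_deriv_deriv[OF x(1)])
    from has_vector_derivative_compose[OF q(3) this]
    show ?thesis
      by (rule has_vector_derivative_transform_within_open[of _ _ _ "{-d<..<d}"]) (use d \<gamma>(3) in auto)
  qed
  moreover have "\<gamma> 0 = \<one>"
    using \<psi>_carrier x(1) by (simp add: \<gamma>_def q(2) \<psi>_x0 W_def)
  moreover have "\<gamma> ` {-d<..<d} \<subseteq> H \<inter> V" using \<gamma> by auto
  ultimately show ?thesis
    unfolding lie_algebra_of_def tangent_space_of_def \<kappa>_def V_def using d by blast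
qed

context
  fixes H :: "'m set"
  assumes H: "subgroup H G" "embedded_submanifold T A H"
begin

lemma subspace_lie_algebra_of: "subspace (lie_algebra_of G c H)"
  unfolding lie_algebra_of_def
  by (rule subspace_tangent_space_of[OF manifold H(2) _ c]) (rule subgroup.one_closed[OF H(1)])

text \<open>Along a curve in \<open>H\<close> with velocity \<open>v\<close> the vectors Ad(q s) w
  remain in the Lie algebra, a subspace, and so does their derivative, which is the bracket.\<close>

lemma lie_algebra_of_br:
  assumes "v \<in> lie_algebra_of G c H" "w \<in> lie_algebra_of G c H"
  shows "br v w \<in> lie_algebra_of G c H"
proof -
  obtain q :: "real \<Rightarrow> 'e" and e where q: "e > 0" "q 0 = x0" "(q has_vector_derivative v) (at 0)"
    "\<And>s. \<bar>s\<bar> < e \<Longrightarrow> \<psi> (q s) \<in> H \<and> q s \<in> \<kappa> ` V"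
    using tangent_curveE[OF assms(1)] by metis
  obtain e' where e': "e' > 0" "\<And>s. \<bar>s\<bar> < e' \<Longrightarrow> q s \<in> W"
    by (rule vector_derivative_eventually_in[OF q(3) open_W x0_W[folded q(2)]]) blast
  have "((\<lambda>s. conj_deriv (q s) w) has_vector_derivative br v w) (at 0)"
    using has_vector_derivative_compose[OF q(3), of "\<lambda>x. conj_deriv x w" "\<lambda>u. br u w"]
      conj_deriv_has_derivative[of w] q(2) by simp
  then show ?thesis
  proof (rule vector_derivative_in_subspace[OF subspace_lie_algebra_of finite_dim])
    show "min e e' > 0" using q(1) e'(1) by simp
    show "conj_deriv (q s) w \<in> lie_algebra_of G c H" if "\<bar>s\<bar> < min e e'" for s
      using conj_deriv_lie_algebra_of[OF H(1) _ _ assms(2)] q(4) e'(2) that by simp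
  qed
qed

end

text \<open>Skewness is the derivative at the identity of the invariance of \<open>Q\<close> under
  Ad.\<close>

lemma compact_lie_algebra_br:
  assumes biinv: "biinvariant_inner_product G c Q"
  shows "compact_lie_algebra Q br"
proof -
  interpret finite_inner_product_form Q
    by unfold_locales (use biinv finite_dim in \<open>auto simp: biinvariant_inner_product_def\<close>)
  have "Q (br w u) v = - Q u (br w v)" for u v w
  proof -
    have id: "conj_deriv x0 u = u" for u
      using R_conj_deriv[OF x0_W, of u] by (simp add: R_x0 L_x0)
    have "((\<lambda>x. Q (conj_deriv x u) (conj_deriv x v)) has_derivative
        (\<lambda>w. Q (conj_deriv x0 u) (br w v) + Q (br w u) (conj_deriv x0 v))) (at x0)"
      by (rule bounded_bilinear.FDERIV[OF bilinear_imp_bounded[OF bilinear_Q]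
        conj_deriv_has_derivative conj_deriv_has_derivative])
    note * = has_derivative_unique_open[OF this has_derivative_const[of "Q u v"] open_W x0_W]
    have "Q (conj_deriv x0 u) (br w v) + Q (br w u) (conj_deriv x0 v) = 0"
    proof -
      have "Q (conj_deriv x u) (conj_deriv x v) = Q u v" if "x \<in> W" for x
      proof -
        have "\<psi> x \<in> carrier G" using \<psi>_carrier that by (simp add: W_def)
        then show ?thesis
          using biinv unfolding biinvariant_inner_product_def Ad_eq[OF that, symmetric] by blast
      qed
      then show ?thesis using * by (auto dest: fun_cong)
    qed
    then show ?thesis by (simp add: id)
  qed
  then show ?thesis
    by unfold_locales (rule bilinear_br br_antisym br_jacobi | assumption)+
qed

end

section \<open>The rescaled product and the Koszul connection\<close>

context finite_inner_product_form
begin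

lemma rescaled_product_inner_product:
  assumes h: "subspace h" and t: "t > 0"
  shows "inner_product (rescaled_product Q h t)"
proof -
  let ?P = "orth_proj Q h"
  have P: "?P (x + y) = ?P x + ?P y" "?P (a *\<^sub>R x) = a *\<^sub>R ?P x" for x y a
    using orth_proj_linear[OF h] by (simp_all add: linear_add linear_scale)
  have "bilinear (rescaled_product Q h t)"
    unfolding bilinear_def rescaled_product_def
    by (auto intro!: linearI simp: P Q_simps algebra_simps)
  moreover have "rescaled_product Q h t u v = rescaled_product Q h t v u" for u v
    unfolding rescaled_product_def by (simp only: Q_commute[of "?P u"] Q_commute[of "u - ?P u"])
  moreover have "rescaled_product Q h t v v > 0" if "v \<noteq> 0" for v
  proof (cases "?P v = 0")
    case True
    then show ?thesis using Q_pos[OF that] by (simp add: rescaled_product_def Q_simps)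
  next
    case False
    then have "t * Q (?P v) (?P v) > 0" using t Q_pos by simp
    then show ?thesis using Q_nonneg[of "v - ?P v"] by (simp add: rescaled_product_def)
  qed
  ultimately show ?thesis by (simp add: inner_product_def)
qed

text \<open>The right side is a linear functional of \<open>w\<close>, represented through its
  values on an orthonormal basis.\<close>

lemma koszul_connection_exists:
  assumes br: "bilinear br"
  obtains nab where "bilinear nab"
    "\<And>u v w. 2 * Q (nab u v) w = Q (br u v) w - Q v (br u w) - Q u (br v w)"
proof -
  obtain C where C: "finite C" "span C = (UNIV :: 'e set)" "\<And>c. c \<in> C \<Longrightarrow> Q c c = 1"
    "\<And>c d. c \<in> C \<Longrightarrow> d \<in> C \<Longrightarrow> c \<noteq> d \<Longrightarrow> Q c d = 0"
    by (rule orthonormal_basis_subspace[OF subspace_UNIV]) blast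
  note br_simps = bilinear_ladd[OF br] bilinear_radd[OF br] bilinear_lmul[OF br] bilinear_rmul[OF br]
  define F where "F u v w = Q (br u v) w - Q v (br u w) - Q u (br v w)" for u v w
  define nab where "nab u v = (\<Sum>c\<in>C. (F u v c / 2) *\<^sub>R c)" for u v
  have F: "linear (\<lambda>u. F u v w)" "linear (\<lambda>v. F u v w)" "linear (F u v)" for u v w
    by (auto intro!: linearI simp: F_def br_simps Q_simps algebra_simps)
  have "bilinear nab"
    unfolding bilinear_def nab_def
    by (auto intro!: linearI simp: linear_add[OF F(1)] linear_scale[OF F(1)] linear_add[OF F(2)]
        linear_scale[OF F(2)] add_divide_distrib scaleR_add_left sum.distrib scaleR_sum_right)
  moreover have "2 * Q (nab u v) w = F u v w" for u v w
  proof -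
    have "(\<Sum>c\<in>C. Q w c *\<^sub>R c) = w"
      by (rule orthonormal_expansion) (use C in auto)
    then have "F u v w = F u v (\<Sum>c\<in>C. Q w c *\<^sub>R c)" by simp
    also have "\<dots> = (\<Sum>c\<in>C. Q w c * F u v c)"
      by (simp add: linear_sum[OF F(3)] linear_scale[OF F(3)])
    finally show ?thesis
      by (simp add: nab_def Q_sum_left Q_simps sum_distrib_left Q_commute[of w] mult.commute)
  qed
  ultimately show thesis using that unfolding F_def by blast
qed

end

text \<open>Supplies the positive denominator of the sectional curvature.\<close>

lemma (in inner_product_form) Cauchy_Schwarz_strict:
  assumes "u \<noteq> 0" "\<And>s. v \<noteq> s *\<^sub>R u"
  shows "(Q u v)\<^sup>2 < Q u u * Q v v"
proof -
  let ?s = "Q u v / Q u u"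
  have pos: "Q u u > 0" by (rule Q_pos[OF assms(1)])
  have "v - ?s *\<^sub>R u \<noteq> 0" using assms(2) by simp
  then have "0 < Q (v - ?s *\<^sub>R u) (v - ?s *\<^sub>R u)" by (rule Q_pos)
  also have "\<dots> = Q v v - (Q u v)\<^sup>2 / Q u u"
    using pos by (simp add: Q_simps Q_commute[of v u] field_simps power2_eq_square)
  finally show ?thesis using pos by (simp add: field_simps)
qed

theorem theorem1p1:
  fixes G :: "('m, 'b) monoid_scheme"
    and T :: "'m topology"
    and A :: "('m, 'e::real_inner) chart set"
    and c :: "('m, 'e) chart"
    and H :: "'m set"
    and Q :: "'e \<Rightarrow> 'e \<Rightarrow> real"
    and h :: "'e set"
  assumes "lie_group G T A" and "compact_space T"
    and "compact_lie_subgroup G T A H"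
    and "c \<in> A" and "\<one>\<^bsub>G\<^esub> \<in> fst c"
    and "h = lie_algebra_of G c H"
    and "biinvariant_inner_product G c Q"
    and "\<exists>t>1. nonneg_sectional_curvature A (left_invariant_metric G c (rescaled_product Q h t))"
  shows "lie_ideal G c (semisimple_part G c h)"
proof -
  interpret group G using assms(1) by (simp add: lie_group_def)
  interpret lie_group_chart G T A c
    by unfold_locales (use assms in auto)
  interpret compact_lie_algebra Q br by (rule compact_lie_algebra_br[OF assms(7)])
  have H: "subgroup H G" "embedded_submanifold T A H"
    using assms(3) by (auto simp: compact_lie_subgroup_def)
  have h: "subspace h" "\<And>x y. x \<in> h \<Longrightarrow> y \<in> h \<Longrightarrow> br x y \<in> h"
    unfolding assms(6) by (rule subspace_lie_algebra_of[OF H], rule lie_algebra_of_br[OF H])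
  obtain t where t: "t > 1"
    and nonneg: "nonneg_sectional_curvature A (left_invariant_metric G c (rescaled_product Q h t))"
    using assms(8) by blast
  define P where "P = rescaled_product Q h t"
  define g where "g = left_invariant_metric G c P c"
  have "inner_product P"
    unfolding P_def by (rule rescaled_product_inner_product[OF h(1)]) (use t in simp)
  then interpret P: finite_inner_product_form P
    by unfold_locales (use finite_dim in auto)
  obtain nab where nab: "bilinear nab"
    "\<And>u v w. 2 * P (nab u v) w = P (br u v) w - P v (br u w) - P u (br v w)"
    using P.koszul_connection_exists[OF bilinear_br] by metis
  interpret left_invariant_local_metric B mu io \<Omega> W x0 P nab g
    by unfold_locales (use nab left_invariant_metric_eq in \<open>auto simp: g_def\<close>)
  have "P (nab u (nab v v) - nab v (nab u v) - nab (br u v) v) u \<ge> 0" for u v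
  \<comment> \<open>Sectional curvature speaks of independent pairs only. For a dependent pair the
    curvature expression vanishes: its first two terms agree and the bracket is 0.\<close>
  proof (cases "u = 0 \<or> (\<exists>s. v = s *\<^sub>R u)")
    case True
    then have "nab u (nab v v) - nab v (nab u v) - nab (br u v) v = 0"
      using nab(1) bilinear_br
      by (auto simp: bilinear_lmul bilinear_rmul bilinear_lzero bilinear_rzero br_self)
    then show ?thesis by (simp add: P.Q_simps)
  next
    case False
    then have "u \<noteq> v" by (metis scaleR_one)
    moreover have "independent {u, v}"
      using False \<open>u \<noteq> v\<close> by (auto simp: insert_commute[of u v] independent_insert span_singleton)
    ultimately have "sectional_curvature g x0 u v \<ge> 0"
      using nonneg c x0_in unfolding nonneg_sectional_curvature_def g_def P_def \<kappa>_def V_def by blast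
    moreover have "g x0 a b = P a b" for a b by (simp add: g_eq x0_W \<theta>_x0)
    moreover have "P u u * P v v - (P u v)\<^sup>2 > 0"
      using P.Cauchy_Schwarz_strict[of u v] False by auto
    ultimately show ?thesis
      by (simp add: sectional_curvature_def curvature_tensor_eq zero_le_divide_iff)
  qed
  then have bd: "proj_bounded h"
    using nonneg_curvature_imp_proj_bounded[OF h t] nab(2) unfolding P_def by blast
  let ?s = "{br u v |u v. u \<in> h \<and> v \<in> h}"
  have "br x y \<in> span ?s" if "y \<in> span ?s" for x y
    using that
  proof (induction rule: span_induct_alt)
    case base
    then show ?case by (simp add: br_simps span_zero)
  next
    case (step r y z)
    then obtain a b where ab: "y = br a b" "a \<in> h" "b \<in> h" by blast
    \<comment> \<open>The component of \<open>x\<close> normal to \<open>h\<close> commutes with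
      brackets of \<open>h\<close>, so only \<open>?p\<close> acts, and it produces another bracket
      of \<open>h\<close>.\<close>
    let ?p = "orth_proj Q h x"
    have "br (br a b) (x - ?p) = 0"
      by (rule proj_bounded_derived_commutes[OF h bd ab(2,3) orth_proj_diff[OF h(1)]])
    then have "br x y = br ?p y"
      using br_eq_0_commute[of "br a b" "x - ?p"] by (simp add: ab br_simps)
    also have "\<dots> \<in> span ?s"
      using ab h(2) orth_proj_in[OF h(1)] by (intro span_base) blast
    finally show ?case using step by (simp add: br_simps span_add span_scale)
  qed
  then show ?thesis
    by (simp add: lie_ideal_def semisimple_part_def lie_bracket_eq)
qed

end
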